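(* Let $x$ be fixed. Then: (i) $\overline y$ is strictly decreasing in $Y$ and in $\underline L$, and is strictly increasing in $\overline L$. (ii) The post-retirement optimal consumption $c_*^{\mathrm{post}}(x)$ and portfolio $\pi_*^{\mathrm{post}}(x)$ are independent of $(Y,\underline L,\overline L)$. (iii) If $(-\tilde V_{\mathrm{pre}}')^{-1}(x)\ge A(\underline L)$, then $c_*^{\mathrm{pre}}(x)=0$ and $\pi_*^{\mathrm{pre}}(x)=\frac{\theta(1-m_-)}{\sigma}\left(x+\frac Yr\right)$. If $(-\tilde V_{\mathrm{pre}}')^{-1}(x)<A(\underline L)$, then $c_*^{\mathrm{pre}}(x)$ is strictly increasing in $Y$ and in $\underline L$, and is non-increasing in $\overline L$; and $\pi_*^{\mathrm{pre}}(x)$ is strictly decreasing in $\underline L$, and is non-decreasing in $\overline L$.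
   Context: Constants: $r>0$, $\mu>r$, $\sigma>0$, $\theta:=(\mu-r)/\sigma>0$, $\beta>0$, $\alpha\in(0,1)$, $\gamma^*>0$, $\gamma:=\alpha\gamma^*$, $Y>0$ (labor income), $0<\underline{L}<\overline{L}$ (leisure before and after retirement). $(B_t)$ is a standard Brownian motion. $A(l):=e^{-\gamma^*(1-\alpha)l}$. $m_-<0<1<m_+$ are the roots of $\theta^2m^2+(2(\beta-r)-\theta^2)m-2\beta=0$. For $y>0$, $\overline U(y):=\sup_{c\ge0}(-\frac{e^{-\gamma c}}{\gamma}A(\overline L)-cy)$ and $\underline U(y):=\sup_{c\ge0}(-\frac{e^{-\gamma c}}{\gamma}A(\underline L)-cy)$. The dual process is $y_t=y\,e^{(\beta-r-\theta^2/2)t-\theta B_t}$; $\mathbb{E}^y$ is expectation when $y_0=y$. Retirement boundary $\overline y$: if $Y\ge\frac{1-\alpha}{\alpha}(\overline L-\underline L)$ then $\overline y:=0$ (the agent never retires); otherwise $\overline y>0$ is the unique positive solution of $\int_{\overline y}^\infty z^{-1-m_+}\{\underline U(z)-\overline U(z)+Yz\}dz=0$. Let $\tau^*=\inf\{s>0:y_s\le\overline y\}$ (with $\inf\emptyset=\infty$) be the optimal retirement time. Dual functions: $$\tilde V_{\mathrm{post}}(y)=\mathbb{E}^y\left[\int_0^\infty e^{-\beta s}\overline U(y_s)ds\right],\qquad \tilde V_{\mathrm{pre}}(y)=\mathbb{E}^y\left[\int_0^{\tau^*}e^{-\beta s}\underline U(y_s)ds\right]+\frac Yr y .$$ $I_{\mathrm{post}}:=(-\tilde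 V_{\mathrm{post}}')^{-1}$ on $(0,\infty)$. $I_{\mathrm{pre}}:=(-\tilde V_{\mathrm{pre}}')^{-1}$ is the inverse of $-\tilde V_{\mathrm{pre}}'$ restricted to $y>\overline y$ (extended by continuity to $\overline y$ when $\overline y>0$), defined for $x$ in the range of $-\tilde V_{\mathrm{pre}}'$ there. Optimal policies at wealth $x$: for $i\in\{\mathrm{pre},\mathrm{post}\}$, with $L_{\mathrm{pre}}=\underline L$, $L_{\mathrm{post}}=\overline L$ and $(a)^+=\max(a,0)$, $$c_*^{i}(x):=\frac1\gamma\left(\ln\frac{A(L_i)}{I_i(x)}\right)^+,\qquad \pi_*^{i}(x):=\frac{\theta\, I_i(x)\,\tilde V_i''(I_i(x))}{\sigma}.$$
   Formalization: Strictness in (i), and in L̲ in (iii), fails if the agent never retires (ȳ=0, no dependence on L̲); there only weak monotonicity is asserted. It is strict when, of the two parameter values compared, the one with the larger ȳ has Y<((1-α)/α)(L̄-L̲). *)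

theory Defs
  imports "HOL-Probability.Probability"
begin

section \<open>Model parameters\<close>

record economy =
  rate :: real          \<comment> \<open>r\<close>
  drift :: real         \<comment> \<open>\<mu>\<close>
  vol :: real           \<comment> \<open>\<sigma>\<close>
  discount :: real      \<comment> \<open>\<beta>\<close>
  cweight :: real       \<comment> \<open>\<alpha>\<close>
  riskav :: real        \<comment> \<open>\<gamma>*\<close>
  income :: real        \<comment> \<open>Y\<close>
  leisure_pre :: real   \<comment> \<open>leisure before retirement\<close>
  leisure_post :: real  \<comment> \<open>leisure after retirement\<close>

definition admissible :: "economy \<Rightarrow> bool" where
  "admissible p \<longleftrightarrow>
     0 < rate p \<and> rate p < drift p \<and> 0 < vol p \<and> 0 < discount p \<and>
     0 < cweight p \<and> cweight p < 1 \<and> 0 < riskav p \<and> 0 < income p \<and>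
     0 < leisure_pre p \<and> leisure_pre p < leisure_post p"

definition theta :: "economy \<Rightarrow> real" where
  "theta p = (drift p - rate p) / vol p"

definition gam :: "economy \<Rightarrow> real" where
  "gam p = cweight p * riskav p"

definition A :: "economy \<Rightarrow> real \<Rightarrow> real" where
  "A p l = exp (- riskav p * (1 - cweight p) * l)"

definition char_poly :: "economy \<Rightarrow> real \<Rightarrow> real" where
  "char_poly p m =
     (theta p)\<^sup>2 * m\<^sup>2 + (2 * (discount p - rate p) - (theta p)\<^sup>2) * m - 2 * discount p"

definition m_minus :: "economy \<Rightarrow> real" where
  "m_minus p = (THE m. m < 0 \<and> char_poly p m = 0)"

definition m_plus :: "economy \<Rightarrow> real" where
  "m_plus p = (THE m. 1 < m \<and> char_poly p m = 0)"

definition conj_util :: "economy \<Rightarrow> real \<Rightarrow> real \<Rightarrow> real" where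
  "conj_util p l y = (SUP c\<in>{0..}. - (exp (- gam p * c) / gam p) * A p l - c * y)"

definition U_post :: "economy \<Rightarrow> real \<Rightarrow> real" where
  "U_post p y = conj_util p (leisure_post p) y"

definition U_pre :: "economy \<Rightarrow> real \<Rightarrow> real" where
  "U_pre p y = conj_util p (leisure_pre p) y"

section \<open>Brownian motion and the dual process\<close>

text \<open>Brownian motion indexed by the nonnegative reals; values at negative times are irrelevant.
  As usual every path (not just almost every path) starts at 0 and is continuous, so that
  pathwise time integrals and hitting times are measurable without completing the measure.\<close>

definition brownian_motion :: "'w measure \<Rightarrow> (real \<Rightarrow> 'w \<Rightarrow> real) \<Rightarrow> bool" where
  "brownian_motion M B \<longleftrightarrow>
     prob_space M \<and>
     (\<forall>t\<ge>0. B t \<in> borel_measurable M) \<and>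
     (\<forall>\<omega>\<in>space M. B 0 \<omega> = 0) \<and>
     (\<forall>\<omega>\<in>space M. continuous_on {0..} (\<lambda>t. B t \<omega>)) \<and>
     (\<forall>s t. 0 \<le> s \<and> s < t \<longrightarrow>
        distributed M lborel (\<lambda>\<omega>. B t \<omega> - B s \<omega>) (normal_density 0 (sqrt (t - s)))) \<and>
     (\<forall>(n::nat) (t :: nat \<Rightarrow> real). 0 \<le> t 0 \<and> incseq t \<longrightarrow>
        prob_space.indep_vars M (\<lambda>_. borel) (\<lambda>i \<omega>. B (t (Suc i)) \<omega> - B (t i) \<omega>) {..<n})"

definition dual_proc ::
    "(real \<Rightarrow> 'w \<Rightarrow> real) \<Rightarrow> economy \<Rightarrow> real \<Rightarrow> real \<Rightarrow> 'w \<Rightarrow> real" where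
  "dual_proc B p y t \<omega> =
     y * exp ((discount p - rate p - (theta p)\<^sup>2 / 2) * t - theta p * B t \<omega>)"

section \<open>Retirement\<close>

text \<open>The agent retires at some level of wealth exactly when this holds.\<close>

definition ever_retires :: "economy \<Rightarrow> bool" where
  "ever_retires p \<longleftrightarrow>
     income p < (1 - cweight p) / cweight p * (leisure_post p - leisure_pre p)"

definition ybar :: "economy \<Rightarrow> real" where
  "ybar p =
     (if ever_retires p
      then THE b. 0 < b \<and>
        (LINT z:{b<..}|lborel. z powr (- 1 - m_plus p) * (U_pre p z - U_post p z + income p * z)) = 0
      else 0)"

definition tau ::
    "(real \<Rightarrow> 'w \<Rightarrow> real) \<Rightarrow> economy \<Rightarrow> real \<Rightarrow> 'w \<Rightarrow> ereal" where
  "tau B p y \<omega> = Inf (ereal ` {s. 0 < s \<and> dual_proc B p y s \<omega> \<le> ybar p})"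

section \<open>Dual functions and their inverse marginals\<close>

definition V_post ::
    "'w measure \<Rightarrow> (real \<Rightarrow> 'w \<Rightarrow> real) \<Rightarrow> economy \<Rightarrow> real \<Rightarrow> real" where
  "V_post M B p y =
     (LINT \<omega>|M. (LINT s:{0..}|lborel. exp (- discount p * s) * U_post p (dual_proc B p y s \<omega>)))"

definition V_pre ::
    "'w measure \<Rightarrow> (real \<Rightarrow> 'w \<Rightarrow> real) \<Rightarrow> economy \<Rightarrow> real \<Rightarrow> real" where
  "V_pre M B p y =
     (LINT \<omega>|M. (LINT s:{s. 0 \<le> s \<and> ereal s < tau B p y \<omega>}|lborel.
        exp (- discount p * s) * U_pre p (dual_proc B p y s \<omega>)))
     + income p / rate p * y"

definition I_post ::
    "'w measure \<Rightarrow> (real \<Rightarrow> 'w \<Rightarrow> real) \<Rightarrow> economy \<Rightarrow> real \<Rightarrow> real" where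
  "I_post M B p = inv_into {0<..} (\<lambda>y. - deriv (V_post M B p) y)"

text \<open>\<^const>\<open>V_pre\<close> has a kink at \<^term>\<open>ybar p\<close>, so its derivatives there are taken to be
  the limits from the right.\<close>

definition ext_right :: "real \<Rightarrow> (real \<Rightarrow> real) \<Rightarrow> real \<Rightarrow> real" where
  "ext_right b f y = (if y = b then Lim (at_right b) f else f y)"

definition dV_pre ::
    "'w measure \<Rightarrow> (real \<Rightarrow> 'w \<Rightarrow> real) \<Rightarrow> economy \<Rightarrow> real \<Rightarrow> real" where
  "dV_pre M B p = ext_right (ybar p) (deriv (V_pre M B p))"

definition ddV_pre ::
    "'w measure \<Rightarrow> (real \<Rightarrow> 'w \<Rightarrow> real) \<Rightarrow> economy \<Rightarrow> real \<Rightarrow> real" where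
  "ddV_pre M B p = ext_right (ybar p) (deriv (deriv (V_pre M B p)))"

text \<open>\<open>y > ybar\<close>, together with the end point \<open>ybar\<close> when that is positive.\<close>

definition dual_pre_dom :: "economy \<Rightarrow> real set" where
  "dual_pre_dom p = {y. 0 < y \<and> ybar p \<le> y}"

definition wealth_pre_dom ::
    "'w measure \<Rightarrow> (real \<Rightarrow> 'w \<Rightarrow> real) \<Rightarrow> economy \<Rightarrow> real set" where
  "wealth_pre_dom M B p = (\<lambda>y. - dV_pre M B p y) ` dual_pre_dom p"

definition I_pre ::
    "'w measure \<Rightarrow> (real \<Rightarrow> 'w \<Rightarrow> real) \<Rightarrow> economy \<Rightarrow> real \<Rightarrow> real" where
  "I_pre M B p = inv_into (dual_pre_dom p) (\<lambda>y. - dV_pre M B p y)"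

section \<open>Optimal policies\<close>

definition c_post ::
    "'w measure \<Rightarrow> (real \<Rightarrow> 'w \<Rightarrow> real) \<Rightarrow> economy \<Rightarrow> real \<Rightarrow> real" where
  "c_post M B p x = 1 / gam p * max (ln (A p (leisure_post p) / I_post M B p x)) 0"

definition pi_post ::
    "'w measure \<Rightarrow> (real \<Rightarrow> 'w \<Rightarrow> real) \<Rightarrow> economy \<Rightarrow> real \<Rightarrow> real" where
  "pi_post M B p x =
     theta p * I_post M B p x * deriv (deriv (V_post M B p)) (I_post M B p x) / vol p"

definition c_pre ::
    "'w measure \<Rightarrow> (real \<Rightarrow> 'w \<Rightarrow> real) \<Rightarrow> economy \<Rightarrow> real \<Rightarrow> real" where
  "c_pre M B p x = 1 / gam p * max (ln (A p (leisure_pre p) / I_pre M B p x)) 0"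

definition pi_pre ::
    "'w measure \<Rightarrow> (real \<Rightarrow> 'w \<Rightarrow> real) \<Rightarrow> economy \<Rightarrow> real \<Rightarrow> real" where
  "pi_pre M B p x = theta p * I_pre M B p x * ddV_pre M B p (I_pre M B p x) / vol p"

text \<open>The economies in which the agent with pre-retirement wealth \<open>x\<close> consumes.\<close>

definition consuming ::
    "'w measure \<Rightarrow> (real \<Rightarrow> 'w \<Rightarrow> real) \<Rightarrow> real \<Rightarrow> economy \<Rightarrow> bool" where
  "consuming M B x p \<longleftrightarrow>
     admissible p \<and> x \<in> wealth_pre_dom M B p \<and> I_pre M B p x < A p (leisure_pre p)"

end

theory Submission
  imports Defs "HOL-Real_Asymp.Real_Asymp"
begin

text \<open>
  Divided by \<open>A p (leisure_pre p)\<close>, the dual process is the exponential of a Brownian motion with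
  drift \<open>\<nu>\<close> and volatility \<open>\<theta>\<close>. The resolvent of the latter has an explicit two-sided exponential
  kernel, so a bounded \<open>C\<^sup>2\<close> solution of \<open>\<beta> w - \<nu> w' - \<theta>\<^sup>2 / 2 w'' = f\<close> is the expected discounted integral
  of \<open>f\<close>; by the Markov property this remains true up to the hitting time of a zero of \<open>w\<close>. Hence,
  with \<open>x\<close> the logarithm of the scaled dual variable, the pre-retirement dual value is
  \<open>G x - k * exp (m_neg * x)\<close> plus a linear term, where only \<open>k \<le> 0\<close> depends on the retirement
  boundary, and \<open>k\<close> decreases as the scaled boundary increases. The equation for the scaled
  boundary involves the parameters only through \<open>\<rho> = A p (leisure_post p) / A p (leisure_pre p)\<close> and
  \<open>\<eta> = gam p * income p\<close>, and its integrand increases with both, so the boundary decreases with both.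
  For fixed wealth, strict convexity turns the monotonicity of \<open>k\<close> into one of \<open>x\<close>. Consumption
  is \<open>max (- x) 0 / gam p\<close>, and elimination of \<open>k\<close> by means of the wealth equation shows that the
  portfolio is a function of wealth and income plus a multiple of \<open>R x\<close>, where \<open>R\<close> increases for
  \<open>x < 0\<close> and vanishes for \<open>x \<ge> 0\<close>.
\<close>

section \<open>Gaussian resolvent\<close>

text \<open>The usual route through Ito's formula and optional stopping is replaced by explicit
  computations. The discounted Gaussian density has an antiderivative in time built from the normal
  distribution function, and \<open>op w w1 w2\<close> times an exponential has one in space.
  Stopping rests on \<open>residual\<close>, the difference between the limit and the current value
  of the martingale that Ito's formula would provide. It has mean zero on events of the past, and
  the hitting time is approached through grid times from above. The normalised utility takes values
  in \<open>[- 1, 0]\<close> for positive arguments, so Fubini and dominated convergence only ever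
  need constants times \<open>exp (- \<beta> * s)\<close>. In return test functions must be bounded
  on the whole line, whereas \<open>exp (m_neg * x)\<close> explodes on the left. Hence the
  artificial continuation \<open>E\<close>, harmless because a path stopped at \<open>c\<close> is
  never evaluated below \<open>c\<close>. The sign of \<open>k\<close> comes from
  \<open>G < 0\<close>, and it is this sign that preserves strict convexity. Strictness in the
  boundary needs actual retirement, since economies without it all have boundary 0.\<close>

abbreviation std_normal_cdf :: "real \<Rightarrow> real" where
  "std_normal_cdf \<equiv> cdf std_normal_distribution"

text \<open>On a window around \<open>x\<close> the distribution function is a constant plus an
  integral over a compact interval, to which the fundamental theorem of calculus applies.\<close>

lemma std_normal_cdf_deriv:
  "(std_normal_cdf has_field_derivative std_normal_density x) (at x)"
proof -
  interpret N: real_distribution std_normal_distribution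
    by (rule real_dist_normal_dist)
  let ?l = "x - 1" and ?u = "x + 1"
  have "((\<lambda>u. LBINT y=?l..u. std_normal_density y) has_vector_derivative std_normal_density x)
      (at x within {?l..?u})"
    by (rule interval_integral_FTC2) (auto intro!: continuous_intros simp: normal_density_def)
  then have d: "((\<lambda>u. LBINT y=?l..u. std_normal_density y) has_real_derivative std_normal_density x) (at x)"
    unfolding has_real_derivative_iff_has_vector_derivative
    by (subst (asm) at_within_interior) auto
  have eq: "std_normal_cdf ?l + (LBINT y=?l..u. std_normal_density y) = std_normal_cdf u"
    if "u \<in> {?l<..<?u}" for u
  proof -
    have "std_normal_cdf u - std_normal_cdf ?l = measure std_normal_distribution {?l<..u}"
      using that by (intro N.cdf_diff_eq) auto
    also have "\<dots> = (LINT y:{?l<..u}|lborel. std_normal_density y)"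
      unfolding set_lebesgue_integral_def scaleR_conv_of_real
      by (simp add: mult.commute[of _ "std_normal_density _"] integral_real_density[symmetric])
    also have "\<dots> = (LBINT y=?l..u. std_normal_density y)"
      using that by (subst interval_integral_Ioc) auto
    finally show ?thesis by simp
  qed
  have "((\<lambda>u. std_normal_cdf ?l + (LBINT y=?l..u. std_normal_density y)) has_real_derivative
      std_normal_density x) (at x)"
    using d by (auto intro!: derivative_eq_intros)
  then show ?thesis
    by (rule has_field_derivative_transform_within_open[where S = "{?l<..<?u}"]) (use eq in auto)
qed

locale discounted_gaussian =
  fixes \<beta> \<nu> \<theta> :: real
  assumes \<beta>_pos: "0 < \<beta>" and \<theta>_pos: "0 < \<theta>"
begin

text \<open>Square root of the discriminant of
  \<open>\<theta>\<^sup>2 / 2 * m\<^sup>2 + \<nu> * m - \<beta>\<close>.\<close>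

definition \<delta> :: real where
  "\<delta> = sqrt (\<nu>\<^sup>2 + 2 * \<beta> * \<theta>\<^sup>2)"

lemma \<delta>_sq: "\<delta>\<^sup>2 = \<nu>\<^sup>2 + 2 * \<beta> * \<theta>\<^sup>2"
  using \<beta>_pos by (simp add: \<delta>_def)

lemma \<delta>_gt: "\<bar>\<nu>\<bar> < \<delta>"
  using \<beta>_pos \<theta>_pos unfolding \<delta>_def by (intro real_less_rsqrt) (auto simp: power2_abs)

lemma \<delta>_pos: "0 < \<delta>"
  using \<delta>_gt by linarith

text \<open>The Green function of Brownian motion with drift. Since the integrand is nonnegative,
  integrability follows from the two boundary limits of an antiderivative. At \<open>u = 0\<close>
  the arguments of the distribution function would tend to 0 rather than to infinity at time 0; a
  single point is negligible later.\<close>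

lemma resolvent_kernel:
  assumes "u \<noteq> 0"
  defines "k \<equiv> \<lambda>s. exp (- \<beta> * s) * normal_density (\<nu> * s) (\<theta> * sqrt s) u"
  shows "set_integrable lborel {0<..} k"
    and "(LINT s:{0<..}|lborel. k s) = exp ((\<nu> * u - \<delta> * \<bar>u\<bar>) / \<theta>\<^sup>2) / \<delta>"
proof -
  define a where "a = \<bar>u\<bar>"
  have a: "a > 0" "a\<^sup>2 = u\<^sup>2" using assms by (auto simp: a_def)
  define F where "F s = exp (\<nu> * u / \<theta>\<^sup>2) / \<delta> *
     (exp (- (\<delta> * a / \<theta>\<^sup>2)) * std_normal_cdf ((\<delta> * sqrt s - a / sqrt s) / \<theta>)
      + exp (\<delta> * a / \<theta>\<^sup>2) * std_normal_cdf ((\<delta> * sqrt s + a / sqrt s) / \<theta>))" for s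
  have dF: "DERIV F s :> k s" if s: "s > 0" for s
  proof -
    define q where "q = sqrt s"
    have q: "q > 0" "s = q\<^sup>2" using s by (auto simp: q_def)
    \<comment> \<open>The two squares differ only in the sign of the cross term
      \<open>2 * \<delta> * a\<close>. The prefactors in \<open>F\<close> cancel it, so both
      densities reduce to the same \<open>E\<close>.\<close>
    define E where "E = exp (- (\<delta>\<^sup>2 * s + a\<^sup>2 / s) / (2 * \<theta>\<^sup>2)) / sqrt (2 * pi)"
    have E1: "exp (- (\<delta> * a / \<theta>\<^sup>2)) * std_normal_density ((\<delta> * sqrt s - a / sqrt s) / \<theta>) = E"
      unfolding E_def std_normal_density_def q_def[symmetric] q(2)
      using q \<theta>_pos by (simp add: mult_exp_exp power2_eq_square field_simps)
    have E2: "exp (\<delta> * a / \<theta>\<^sup>2) * std_normal_density ((\<delta> * sqrt s + a / sqrt s) / \<theta>) = E"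
      unfolding E_def std_normal_density_def q_def[symmetric] q(2)
      using q \<theta>_pos by (simp add: mult_exp_exp power2_eq_square field_simps)
    define d1 where "d1 = (\<delta> / (2 * q) + a / (2 * q ^ 3)) / \<theta>"
    define d2 where "d2 = (\<delta> / (2 * q) - a / (2 * q ^ 3)) / \<theta>"
    have D1: "((\<lambda>s. (\<delta> * sqrt s - a / sqrt s) / \<theta>) has_real_derivative d1) (at s)"
      unfolding d1_def using s \<theta>_pos q
      by (auto intro!: derivative_eq_intros simp: q_def[symmetric])
         (simp add: field_simps power2_eq_square power3_eq_cube)
    have D2: "((\<lambda>s. (\<delta> * sqrt s + a / sqrt s) / \<theta>) has_real_derivative d2) (at s)"
      unfolding d2_def using s \<theta>_pos q
      by (auto intro!: derivative_eq_intros simp: q_def[symmetric])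
         (simp add: field_simps power2_eq_square power3_eq_cube)
    have "DERIV F s :> exp (\<nu> * u / \<theta>\<^sup>2) / \<delta> *
       (exp (- (\<delta> * a / \<theta>\<^sup>2)) * (std_normal_density ((\<delta> * sqrt s - a / sqrt s) / \<theta>) * d1)
      + exp (\<delta> * a / \<theta>\<^sup>2) * (std_normal_density ((\<delta> * sqrt s + a / sqrt s) / \<theta>) * d2))" (is "DERIV F s :> ?d")
      unfolding F_def
      by (intro DERIV_cmult DERIV_add DERIV_chain2[OF std_normal_cdf_deriv] D1 D2)
    also have "?d = exp (\<nu> * u / \<theta>\<^sup>2) / \<delta> * (E * (d1 + d2))"
      unfolding mult.assoc[symmetric] E1 E2 by (simp add: algebra_simps)
    \<comment> \<open>The contributions of \<open>a / sqrt s\<close> cancel, leaving the factor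
      \<open>1 / sqrt s\<close> of the normal density.\<close>
    also have "d1 + d2 = \<delta> / (q * \<theta>)"
      using q \<theta>_pos unfolding d1_def d2_def by (simp add: field_simps)
    also have "exp (\<nu> * u / \<theta>\<^sup>2) / \<delta> * (E * (\<delta> / (q * \<theta>))) = k s"
    proof -
      have "\<nu> * u / \<theta>\<^sup>2 + (- (\<delta>\<^sup>2 * s + a\<^sup>2 / s) / (2 * \<theta>\<^sup>2))
          = - \<beta> * s + - (u - \<nu> * s)\<^sup>2 / (2 * (\<theta> * sqrt s)\<^sup>2)"
        using s \<theta>_pos unfolding \<delta>_sq a(2) power_mult_distrib
        by (simp add: field_simps power2_eq_square)
      from arg_cong[OF this, of exp] have "exp (\<nu> * u / \<theta>\<^sup>2) * exp (- (\<delta>\<^sup>2 * s + a\<^sup>2 / s) / (2 * \<theta>\<^sup>2))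
          = exp (- \<beta> * s) * exp (- (u - \<nu> * s)\<^sup>2 / (2 * (\<theta> * sqrt s)\<^sup>2))"
        unfolding exp_add .
      moreover have "sqrt (2 * pi * (\<theta> * sqrt s)\<^sup>2) = sqrt (2 * pi) * (q * \<theta>)"
        using q \<theta>_pos by (simp add: real_sqrt_mult q_def[symmetric])
      ultimately show ?thesis
        unfolding k_def normal_density_def E_def using q \<theta>_pos \<delta>_pos by (simp add: field_simps)
    qed
    finally show ?thesis .
  qed
  have cont: "isCont k s" if "s > 0" for s
    using that \<theta>_pos unfolding k_def normal_density_def
    by (auto intro!: continuous_intros simp: real_sqrt_mult)
  interpret N: real_distribution std_normal_distribution
    by (rule real_dist_normal_dist)
  have top: "(std_normal_cdf \<longlongrightarrow> 1) at_top" and bot: "(std_normal_cdf \<longlongrightarrow> 0) at_bot"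
    by (rule N.cdf_lim_at_top_prob N.cdf_lim_at_bot)+
  have l: "filterlim (\<lambda>s. (\<delta> * sqrt s - a / sqrt s) / \<theta>) at_top at_top"
     "filterlim (\<lambda>s. (\<delta> * sqrt s + a / sqrt s) / \<theta>) at_top at_top"
     "filterlim (\<lambda>s. (\<delta> * sqrt s - a / sqrt s) / \<theta>) at_bot (at_right 0)"
     "filterlim (\<lambda>s. (\<delta> * sqrt s + a / sqrt s) / \<theta>) at_top (at_right 0)"
    using a \<delta>_pos \<theta>_pos by real_asymp+
  \<comment> \<open>Both distribution functions tend to 1 at infinity. At 0 the first tends to 0 and
    the second to 1, so the growing exponential drops out of the difference.\<close>
  have FB: "(F \<longlongrightarrow> exp (\<nu> * u / \<theta>\<^sup>2) / \<delta> * (exp (- (\<delta> * a / \<theta>\<^sup>2)) * 1 + exp (\<delta> * a / \<theta>\<^sup>2) * 1)) at_top"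
    unfolding F_def by (intro tendsto_intros filterlim_compose[OF top] l)
  have FA: "(F \<longlongrightarrow> exp (\<nu> * u / \<theta>\<^sup>2) / \<delta> * (exp (- (\<delta> * a / \<theta>\<^sup>2)) * 0 + exp (\<delta> * a / \<theta>\<^sup>2) * 1)) (at_right 0)"
    unfolding F_def by (intro tendsto_intros filterlim_compose[OF top] filterlim_compose[OF bot] l)
  have *: "set_integrable lborel (einterval (ereal 0) \<infinity>) k"
     "(LBINT x=ereal 0..\<infinity>. k x) = exp (\<nu> * u / \<theta>\<^sup>2) / \<delta> * (exp (- (\<delta> * a / \<theta>\<^sup>2)) * 1 + exp (\<delta> * a / \<theta>\<^sup>2) * 1)
        - exp (\<nu> * u / \<theta>\<^sup>2) / \<delta> * (exp (- (\<delta> * a / \<theta>\<^sup>2)) * 0 + exp (\<delta> * a / \<theta>\<^sup>2) * 1)"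
    by (rule interval_integral_FTC_nonneg[where F = F];
        use FA FB dF cont in \<open>force simp: ereal_tendsto_simps k_def\<close>)+
  have e: "einterval (ereal 0) \<infinity> = {0<..}" by (auto simp: einterval_def)
  show "set_integrable lborel {0<..} k" using *(1) unfolding e .
  have "(LINT s:{0<..}|lborel. k s) = exp (\<nu> * u / \<theta>\<^sup>2) / \<delta> * exp (- (\<delta> * a / \<theta>\<^sup>2))"
    using *(2) unfolding interval_lebesgue_integral_def e by (simp add: algebra_simps)
  also have "\<dots> = exp ((\<nu> * u - \<delta> * \<bar>u\<bar>) / \<theta>\<^sup>2) / \<delta>"
    by (simp add: a_def exp_add[symmetric] diff_divide_distrib exp_diff exp_minus field_simps)
  finally show "(LINT s:{0<..}|lborel. k s) = exp ((\<nu> * u - \<delta> * \<bar>u\<bar>) / \<theta>\<^sup>2) / \<delta>" .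
qed

end

section \<open>Bounded test functions and the inversion of the resolvent\<close>

lemma borel_measurable_normal_density_params [measurable (raw)]:
  assumes [measurable]: "f \<in> borel_measurable N" "g \<in> borel_measurable N" "h \<in> borel_measurable N"
  shows "(\<lambda>x. normal_density (f x) (g x) (h x)) \<in> borel_measurable N"
  unfolding normal_density_def by measurable

lemma exp_decay_Ioi:
  fixes m x :: real
  assumes "0 < m"
  shows "set_integrable lborel {x<..} (\<lambda>z. exp (- m * (z - x)))"
    and "set_integrable lborel {..<x} (\<lambda>z. exp (m * (z - x)))"
    and "(LINT z:{x<..}|lborel. exp (- m * (z - x))) = 1 / m"
proof -
  have e: "einterval (ereal x) \<infinity> = {x<..}" "einterval (-\<infinity>) (ereal x) = {..<x}"
    by (auto simp: einterval_def)
  let ?F = "\<lambda>z. - exp (- m * (z - x)) / m" and ?G = "\<lambda>z. exp (m * (z - x)) / m"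
  have F: "(?F \<longlongrightarrow> - 1 / m) (at_right x)"
    using assms by (auto intro!: tendsto_eq_intros)
  have F': "(?F \<longlongrightarrow> 0) at_top" using assms by real_asymp
  have G: "(?G \<longlongrightarrow> 1 / m) (at_left x)"
    using assms by (auto intro!: tendsto_eq_intros)
  have G': "(?G \<longlongrightarrow> 0) at_bot" using assms by real_asymp
  have 1: "set_integrable lborel (einterval (ereal x) \<infinity>) (\<lambda>z. exp (- m * (z - x)))"
     "(LBINT z=ereal x..\<infinity>. exp (- m * (z - x))) = 0 - (- 1 / m)"
    by (rule interval_integral_FTC_nonneg[where F = ?F]; use assms F F' in
       \<open>(auto intro!: derivative_eq_intros continuous_intros simp: ereal_tendsto_simps)\<close>)+
  have 2: "set_integrable lborel (einterval (-\<infinity>) (ereal x)) (\<lambda>z. exp (m * (z - x)))"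
    by (rule interval_integral_FTC_nonneg[where F = ?G]; use assms G G' in
       \<open>(auto intro!: derivative_eq_intros continuous_intros simp: ereal_tendsto_simps)\<close>)+
  show "set_integrable lborel {x<..} (\<lambda>z. exp (- m * (z - x)))"
    "set_integrable lborel {..<x} (\<lambda>z. exp (m * (z - x)))"
    using 1(1) 2 unfolding e by auto
  show "(LINT z:{x<..}|lborel. exp (- m * (z - x))) = 1 / m"
    using 1(2) unfolding interval_lebesgue_integral_def e by simp
qed

lemma set_integrable_mult_bounded:
  fixes f g :: "real \<Rightarrow> real"
  assumes "set_integrable lborel S g" "f \<in> borel_measurable borel" "\<And>z. \<bar>f z\<bar> \<le> C" "S \<in> sets borel"
  shows "set_integrable lborel S (\<lambda>z. g z * f z)"
proof -
  have "integrable lborel (\<lambda>z. f z * (indicator S z * g z))"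
    by (rule Bochner_Integration.integrable_bound[where f = "\<lambda>z. C * (indicator S z * g z)"])
       (use assms in \<open>auto simp: set_integrable_def abs_mult intro!: mult_right_mono order_trans[OF assms(3) abs_ge_self]
          dest: borel_measurable_integrable\<close>)
  then show ?thesis by (simp add: set_integrable_def ac_simps)
qed

text \<open>The derivatives are arguments instead of values of \<open>deriv\<close>, which keeps
  \<open>op\<close> linear without side conditions. Bounds on all three functions make
  \<open>op w w1 w2\<close> bounded.\<close>

definition C2_bounded :: "(real \<Rightarrow> real) \<Rightarrow> (real \<Rightarrow> real) \<Rightarrow> (real \<Rightarrow> real) \<Rightarrow> bool" where
  "C2_bounded w w1 w2 \<longleftrightarrow>
     (\<forall>x. (w has_real_derivative w1 x) (at x)) \<and> (\<forall>x. (w1 has_real_derivative w2 x) (at x)) \<and>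
     continuous_on UNIV w2 \<and> bounded (range w) \<and> bounded (range w1) \<and> bounded (range w2)"

context discounted_gaussian
begin

definition m_pos :: real where "m_pos = (- \<nu> + \<delta>) / \<theta>\<^sup>2"
definition m_neg :: real where "m_neg = (- \<nu> - \<delta>) / \<theta>\<^sup>2"

lemma m_pos_pos: "0 < m_pos" and m_neg_neg: "m_neg < 0"
  using \<delta>_gt \<theta>_pos by (auto simp: m_pos_def m_neg_def field_simps)

lemma m_root:
  "\<theta>\<^sup>2 / 2 * m_pos\<^sup>2 + \<nu> * m_pos - \<beta> = 0" "\<theta>\<^sup>2 / 2 * m_neg\<^sup>2 + \<nu> * m_neg - \<beta> = 0"
proof -
  have "\<theta>\<^sup>2 * m_pos = - \<nu> + \<delta>" "\<theta>\<^sup>2 * m_neg = - \<nu> - \<delta>"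
    using \<theta>_pos by (simp_all add: m_pos_def m_neg_def)
  then have "\<theta>\<^sup>2 * (\<theta>\<^sup>2 / 2 * m_pos\<^sup>2 + \<nu> * m_pos - \<beta>) = 0" "\<theta>\<^sup>2 * (\<theta>\<^sup>2 / 2 * m_neg\<^sup>2 + \<nu> * m_neg - \<beta>) = 0"
    using \<delta>_sq by algebra+
  then show "\<theta>\<^sup>2 / 2 * m_pos\<^sup>2 + \<nu> * m_pos - \<beta> = 0" "\<theta>\<^sup>2 / 2 * m_neg\<^sup>2 + \<nu> * m_neg - \<beta> = 0"
    using \<theta>_pos by simp_all
qed

text \<open>Normalises the resolvent: this factor multiplies \<open>w x\<close> once the two
  half-line integrals are added, and it cancels the \<open>1 / \<delta>\<close> of the
  kernel.\<close>

lemma m_diff: "\<beta> * (1 / m_pos - 1 / m_neg) = \<delta>"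
proof -
  have a: "m_pos - m_neg = 2 * \<delta> / \<theta>\<^sup>2" by (simp add: m_pos_def m_neg_def diff_divide_distrib[symmetric])
  have b: "m_pos * m_neg = - 2 * \<beta> / \<theta>\<^sup>2"
  proof -
    have "m_pos * m_neg = (\<nu>\<^sup>2 - \<delta>\<^sup>2) / (\<theta>\<^sup>2 * \<theta>\<^sup>2)"
      unfolding m_pos_def m_neg_def by (simp add: algebra_simps power2_eq_square)
    also have "\<nu>\<^sup>2 - \<delta>\<^sup>2 = - 2 * \<beta> * \<theta>\<^sup>2" using \<delta>_sq by simp
    finally show ?thesis using \<theta>_pos by (simp add: power2_eq_square)
  qed
  have "\<beta> * (1 / m_pos - 1 / m_neg) = - \<beta> * (m_pos - m_neg) / (m_pos * m_neg)"
    using m_pos_pos m_neg_neg by (simp add: field_simps)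
  then show ?thesis unfolding a b using \<theta>_pos \<beta>_pos by simp
qed

text \<open>\<open>\<beta> - L\<close> where \<open>L\<close> generates Brownian motion with drift \<open>\<nu>\<close> and volatility \<open>\<theta>\<close>.\<close>

definition op :: "(real \<Rightarrow> real) \<Rightarrow> (real \<Rightarrow> real) \<Rightarrow> (real \<Rightarrow> real) \<Rightarrow> real \<Rightarrow> real" where
  "op w w1 w2 z = \<beta> * w z - \<nu> * w1 z - \<theta>\<^sup>2 / 2 * w2 z"

lemma op_bounded:
  assumes "C2_bounded w w1 w2"
  obtains C where "\<And>z. \<bar>op w w1 w2 z\<bar> \<le> C"
proof -
  obtain a b c where "\<And>z. \<bar>w z\<bar> \<le> a" "\<And>z. \<bar>w1 z\<bar> \<le> b" "\<And>z. \<bar>w2 z\<bar> \<le> c"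
    using assms unfolding C2_bounded_def bounded_iff by (auto simp: image_iff)
  then have "\<bar>op w w1 w2 z\<bar> \<le> \<beta> * a + \<bar>\<nu>\<bar> * b + \<theta>\<^sup>2 / 2 * c" for z
    unfolding op_def
    by (intro order_trans[OF abs_triangle_ineq4] add_mono)
       (use \<beta>_pos in \<open>auto simp: abs_mult intro!: mult_left_mono\<close>)
  then show ?thesis by (rule that)
qed

lemma op_continuous:
  assumes "C2_bounded w w1 w2"
  shows "continuous_on UNIV (op w w1 w2)"
proof -
  have "continuous_on UNIV w" "continuous_on UNIV w1"
    using assms unfolding C2_bounded_def
    by (auto intro!: continuous_at_imp_continuous_on dest: DERIV_isCont)
  then show ?thesis
    using assms unfolding C2_bounded_def op_def by (auto intro!: continuous_intros)
qed

text \<open>For a root \<open>m\<close> of the characteristic equation the integrand is the exact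
  derivative of \<open>F m\<close>: the equation turns the coefficient of \<open>w1\<close> into
  \<open>- \<nu>\<close>. Only the boundary term at \<open>x\<close> survives, as the exponential
  decays on the half-line in question.\<close>

lemma resolvent_half_lines:
  assumes C2: "C2_bounded w w1 w2"
  shows "(LINT z:{x<..}|lborel. exp (- m_pos * (z - x)) * op w w1 w2 z)
            = \<theta>\<^sup>2 / 2 * w1 x + \<beta> / m_pos * w x"
    and "(LINT z:{..<x}|lborel. exp (- m_neg * (z - x)) * op w w1 w2 z)
            = - (\<theta>\<^sup>2 / 2) * w1 x - \<beta> / m_neg * w x"
proof -
  obtain C where C: "\<And>z. \<bar>op w w1 w2 z\<bar> \<le> C" using op_bounded[OF C2] by blast
  have cont: "continuous_on UNIV (op w w1 w2)" by (rule op_continuous[OF C2])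
  then have meas: "op w w1 w2 \<in> borel_measurable borel" by (rule borel_measurable_continuous_onI)
  have e: "einterval (ereal x) \<infinity> = {x<..}" "einterval (-\<infinity>) (ereal x) = {..<x}"
    by (auto simp: einterval_def)
  define F where "F m z = exp (- m * (z - x)) * (- (\<theta>\<^sup>2 / 2) * w1 z - \<beta> / m * w z)" for m z
  have w: "(w has_real_derivative w1 z) (at z)" "(w1 has_real_derivative w2 z) (at z)" for z
    using C2 by (auto simp: C2_bounded_def)
  have dF: "(F m has_real_derivative exp (- m * (z - x)) * op w w1 w2 z) (at z)"
    if "\<theta>\<^sup>2 / 2 * m\<^sup>2 + \<nu> * m - \<beta> = 0" "m \<noteq> 0" for m z
  proof -
    have "\<theta>\<^sup>2 / 2 * m - \<beta> / m = - \<nu>"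
      using that by (simp add: field_simps power2_eq_square)
    then have "m * (\<theta>\<^sup>2 / 2) * w1 z - \<beta> / m * w1 z = - \<nu> * w1 z"
      by (metis left_diff_distrib mult.commute)
    then have eq: "- m * (- (\<theta>\<^sup>2 / 2) * w1 z - \<beta> / m * w z) + (- (\<theta>\<^sup>2 / 2) * w2 z - \<beta> / m * w1 z)
        = op w w1 w2 z"
      unfolding op_def using that(2) by (simp add: algebra_simps)
    show ?thesis
      unfolding F_def eq[symmetric]
      by (rule derivative_eq_intros w refl | simp)+ (simp add: algebra_simps)
  qed
  obtain D where D: "\<And>m z. \<bar>- (\<theta>\<^sup>2 / 2) * w1 z - \<beta> / m * w z\<bar> \<le> D m"
  proof -
    obtain a b where *: "\<And>z. \<bar>w z\<bar> \<le> a" "\<And>z. \<bar>w1 z\<bar> \<le> b"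
      using C2 unfolding C2_bounded_def bounded_iff by (auto simp: image_iff)
    have "\<bar>- (\<theta>\<^sup>2 / 2) * w1 z - \<beta> / m * w z\<bar> \<le> \<theta>\<^sup>2 / 2 * b + \<bar>\<beta> / m\<bar> * a" for m z
      by (intro order_trans[OF abs_triangle_ineq4] add_mono)
         (use * in \<open>auto simp: abs_mult intro!: mult_left_mono divide_right_mono\<close>)
    then show ?thesis by (rule that)
  qed
  have lim0: "(F m \<longlongrightarrow> 0) G" if "((\<lambda>z. exp (- m * (z - x))) \<longlongrightarrow> 0) G" for m G
  proof (rule Lim_null_comparison)
    show "\<forall>\<^sub>F z in G. norm (F m z) \<le> exp (- m * (z - x)) * D m"
      unfolding F_def norm_mult using D by (auto intro!: always_eventually mult_left_mono)
    show "((\<lambda>z. exp (- m * (z - x)) * D m) \<longlongrightarrow> 0) G"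
      using tendsto_mult_left_zero[OF that] by simp
  qed
  have contF: "isCont (F m) z" if "m \<noteq> 0" for m z
    unfolding F_def using that DERIV_isCont[OF w(1)] DERIV_isCont[OF w(2)] by (auto intro!: continuous_intros)
  have Fx: "F m x = - (\<theta>\<^sup>2 / 2) * w1 x - \<beta> / m * w x" for m by (simp add: F_def)
  have p: "m_pos \<noteq> 0" "m_neg \<noteq> 0" using m_pos_pos m_neg_neg by auto
  have i1: "set_integrable lborel {x<..} (\<lambda>z. exp (- m_pos * (z - x)) * op w w1 w2 z)"
    by (rule set_integrable_mult_bounded[OF exp_decay_Ioi(1)[OF m_pos_pos] meas C]) auto
  have i2: "set_integrable lborel {..<x} (\<lambda>z. exp (- m_neg * (z - x)) * op w w1 w2 z)"
    by (rule set_integrable_mult_bounded[OF exp_decay_Ioi(2)[of "- m_neg"] meas C]) (use m_neg_neg in auto)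
  have "(LBINT z=ereal x..\<infinity>. exp (- m_pos * (z - x)) * op w w1 w2 z) = 0 - F m_pos x"
  proof (rule interval_integral_FTC_integrable)
    show "((F m_pos \<circ> real_of_ereal) \<longlongrightarrow> F m_pos x) (at_right (ereal x))"
      unfolding ereal_tendsto_simps
      using contF[OF p(1)] by (simp add: isCont_def filterlim_at_split)
    have "((\<lambda>z. exp (- m_pos * (z - x))) \<longlongrightarrow> 0) at_top"
      using m_pos_pos by real_asymp
    from lim0[OF this] show "((F m_pos \<circ> real_of_ereal) \<longlongrightarrow> 0) (at_left \<infinity>)"
      unfolding ereal_tendsto_simps .
  qed (use i1 dF[OF m_root(1) p(1)] cont in
       \<open>auto simp: e has_real_derivative_iff_has_vector_derivative[symmetric] continuous_on_eq_continuous_at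
          intro!: continuous_intros\<close>)
  then show "(LINT z:{x<..}|lborel. exp (- m_pos * (z - x)) * op w w1 w2 z)
            = \<theta>\<^sup>2 / 2 * w1 x + \<beta> / m_pos * w x"
    unfolding interval_lebesgue_integral_def e by (simp add: Fx)
  have "(LBINT z=-\<infinity>..ereal x. exp (- m_neg * (z - x)) * op w w1 w2 z) = F m_neg x - 0"
  proof (rule interval_integral_FTC_integrable)
    show "((F m_neg \<circ> real_of_ereal) \<longlongrightarrow> F m_neg x) (at_left (ereal x))"
      unfolding ereal_tendsto_simps
      using contF[OF p(2)] by (simp add: isCont_def filterlim_at_split)
    have "((\<lambda>z. exp (- m_neg * (z - x))) \<longlongrightarrow> 0) at_bot"
      using m_neg_neg by real_asymp
    from lim0[OF this] show "((F m_neg \<circ> real_of_ereal) \<longlongrightarrow> 0) (at_right (-\<infinity>))"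
      unfolding ereal_tendsto_simps .
  qed (use i2 dF[OF m_root(2) p(2)] cont in
       \<open>auto simp: e has_real_derivative_iff_has_vector_derivative[symmetric] continuous_on_eq_continuous_at
          intro!: continuous_intros\<close>)
  then show "(LINT z:{..<x}|lborel. exp (- m_neg * (z - x)) * op w w1 w2 z)
            = - (\<theta>\<^sup>2 / 2) * w1 x - \<beta> / m_neg * w x"
    unfolding interval_lebesgue_integral_def e by (simp add: Fx)
qed

text \<open>The transition operator of Brownian motion with drift \<nu> and volatility \<theta>. At
  \<open>s = 0\<close> the density degenerates to 0, so it is applied for \<open>s > 0\<close> only
  and time integrals run over \<open>{0<..}\<close>.\<close>

definition trans :: "(real \<Rightarrow> real) \<Rightarrow> real \<Rightarrow> real \<Rightarrow> real" where
  "trans f s x = (LINT z|lborel. normal_density (x + \<nu> * s) (\<theta> * sqrt s) z * f z)"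

lemma trans_bounded:
  assumes "f \<in> borel_measurable borel" "\<And>z. \<bar>f z\<bar> \<le> C"  "s > 0"
  shows "\<bar>trans f s x\<bar> \<le> C"
    and "integrable lborel (\<lambda>z. normal_density (x + \<nu> * s) (\<theta> * sqrt s) z * f z)"
    and "(LINT z|lborel. normal_density (x + \<nu> * s) (\<theta> * sqrt s) z * \<bar>f z\<bar>) \<le> C"
proof -
  let ?n = "normal_density (x + \<nu> * s) (\<theta> * sqrt s)"
  have [measurable]: "f \<in> borel_measurable borel" by fact
  have n: "integrable lborel ?n" "integral\<^sup>L lborel ?n = 1"
    using assms(3) \<theta>_pos by auto
  show i: "integrable lborel (\<lambda>z. ?n z * f z)"
    by (rule Bochner_Integration.integrable_bound[where f = "\<lambda>z. ?n z * C"])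
       (use n assms(2) in \<open>auto simp: abs_mult intro!: mult_left_mono order_trans[OF assms(2) abs_ge_self]\<close>)
  then have "integrable lborel (\<lambda>z. \<bar>?n z * f z\<bar>)" by (rule integrable_abs)
  then have i': "integrable lborel (\<lambda>z. ?n z * \<bar>f z\<bar>)" by (simp add: abs_mult)
  have "(LINT z|lborel. ?n z * \<bar>f z\<bar>) \<le> (LINT z|lborel. ?n z * C)"
    by (rule integral_mono) (use i' n assms(2) in \<open>auto intro!: mult_left_mono\<close>)
  also have "\<dots> = C" using n by simp
  finally show *: "(LINT z|lborel. ?n z * \<bar>f z\<bar>) \<le> C" .
  have "\<bar>trans f s x\<bar> \<le> (LINT z|lborel. \<bar>?n z * f z\<bar>)"
    unfolding trans_def by (rule integral_abs_bound)
  then show "\<bar>trans f s x\<bar> \<le> C" using * by (simp add: abs_mult)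
qed

text \<open>After Fubini the inner time integral is the kernel at \<open>z - x\<close>, with
  exponent \<open>- m_pos * (z - x)\<close> to the right of \<open>x\<close> and
  \<open>- m_neg * (z - x)\<close> to the left. The terms with \<open>w1 x\<close> from the two
  sides cancel.\<close>

theorem resolvent_eq:
  assumes C2: "C2_bounded w w1 w2"
  shows "(LINT s:{0<..}|lborel. exp (- \<beta> * s) * trans (op w w1 w2) s x) = w x"
proof -
  let ?f = "op w w1 w2"
  obtain C where C: "\<And>z. \<bar>?f z\<bar> \<le> C" using op_bounded[OF C2] by blast
  have C0: "0 \<le> C" using C[of 0] by linarith
  have [measurable]: "?f \<in> borel_measurable borel"
    by (rule borel_measurable_continuous_onI[OF op_continuous[OF C2]])
  define g where "g s z = indicator {0<..} s * exp (- \<beta> * s) * normal_density (x + \<nu> * s) (\<theta> * sqrt s) z * ?f z"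
    for s z
  have [measurable]: "case_prod g \<in> borel_measurable (lborel \<Otimes>\<^sub>M lborel)"
    unfolding g_def by measurable
  have g_int: "integrable lborel (\<lambda>z. g s z)" for s
    using trans_bounded(2)[of ?f C s x] C
    by (cases "s > 0") (auto simp: g_def mult.assoc)
  have "integrable (lborel \<Otimes>\<^sub>M lborel) (case_prod g)"
  proof (rule lborel_pair.Fubini_integrable)
    show "integrable lborel (\<lambda>s. \<integral>z. norm (case_prod g (s, z)) \<partial>lborel)"
    proof (rule Bochner_Integration.integrable_bound)
      show "integrable lborel (\<lambda>s. C * (indicator {0<..} s * exp (- \<beta> * (s - 0))))"
        using exp_decay_Ioi(1)[OF \<beta>_pos, of 0] by (simp add: set_integrable_def)
      show "AE s in lborel. norm (\<integral>z. norm (case_prod g (s, z)) \<partial>lborel)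
           \<le> norm (C * (indicator {0<..} s * exp (- \<beta> * (s - 0))))"
      proof (rule AE_I2)
        fix s :: real
        have "(\<integral>z. norm (case_prod g (s, z)) \<partial>lborel) = indicator {0<..} s * exp (- \<beta> * s) *
            (LINT z|lborel. normal_density (x + \<nu> * s) (\<theta> * sqrt s) z * \<bar>?f z\<bar>)"
          unfolding g_def by (simp add: abs_mult mult.assoc)
        also have "\<dots> \<le> C * (indicator {0<..} s * exp (- \<beta> * (s - 0)))"
          using trans_bounded(3)[of ?f C s x] C by (auto simp: indicator_def)
        finally show "norm (\<integral>z. norm (case_prod g (s, z)) \<partial>lborel)
           \<le> norm (C * (indicator {0<..} s * exp (- \<beta> * (s - 0))))"
          using C0 by simp
      qed
    qed measurable
  qed (use g_int in auto)
  from lborel_pair.Fubini_integral[OF this]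
  have "(\<integral>s. (\<integral>z. g s z \<partial>lborel) \<partial>lborel) = (\<integral>z. (\<integral>s. g s z \<partial>lborel) \<partial>lborel)" by simp
  moreover have "(\<integral>z. g s z \<partial>lborel) = indicator {0<..} s *\<^sub>R (exp (- \<beta> * s) * trans ?f s x)" for s
    unfolding g_def trans_def by (simp add: mult.assoc)
  ultimately have "(LINT s:{0<..}|lborel. exp (- \<beta> * s) * trans ?f s x) = (\<integral>z. (\<integral>s. g s z \<partial>lborel) \<partial>lborel)"
    unfolding set_lebesgue_integral_def by simp
  also have "\<dots> = (\<integral>z. (1 / \<delta>) * (indicator {x<..} z *\<^sub>R (exp (- m_pos * (z - x)) * ?f z)
        + indicator {..<x} z *\<^sub>R (exp (- m_neg * (z - x)) * ?f z)) \<partial>lborel)"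
  proof (rule integral_cong_AE)
    have "(\<integral>s. g s z \<partial>lborel) = (1 / \<delta>) * (indicator {x<..} z *\<^sub>R (exp (- m_pos * (z - x)) * ?f z)
        + indicator {..<x} z *\<^sub>R (exp (- m_neg * (z - x)) * ?f z))" if z: "z \<noteq> x" for z
    proof -
      have nd: "normal_density (x + \<nu> * s) \<sigma> z = normal_density (\<nu> * s) \<sigma> (z - x)" for s \<sigma>
        by (simp add: normal_density_def algebra_simps)
      have "(\<integral>s. g s z \<partial>lborel)
          = (LINT s:{0<..}|lborel. exp (- \<beta> * s) * normal_density (\<nu> * s) (\<theta> * sqrt s) (z - x)) * ?f z"
        unfolding g_def nd set_lebesgue_integral_def
        by (subst integral_mult_left_zero[symmetric]) (simp add: mult.assoc)
      also have "\<dots> = exp ((\<nu> * (z - x) - \<delta> * \<bar>z - x\<bar>) / \<theta>\<^sup>2) / \<delta> * ?f z"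
        using resolvent_kernel(2)[of "z - x"] z by simp
      also have "(\<nu> * (z - x) - \<delta> * \<bar>z - x\<bar>) / \<theta>\<^sup>2 = - (if x < z then m_pos else m_neg) * (z - x)"
        using z by (auto simp: m_pos_def m_neg_def field_simps add_divide_distrib diff_divide_distrib)
      finally show ?thesis using z by (auto simp: indicator_def)
    qed
    then show "AE z in lborel. (\<integral>s. g s z \<partial>lborel) = (1 / \<delta>) * (indicator {x<..} z *\<^sub>R (exp (- m_pos * (z - x)) * ?f z)
        + indicator {..<x} z *\<^sub>R (exp (- m_neg * (z - x)) * ?f z))"
      using AE_lborel_singleton[of x] by (auto elim: eventually_mono)
  qed measurable
  also have "\<dots> = (1 / \<delta>) * ((LINT z:{x<..}|lborel. exp (- m_pos * (z - x)) * ?f z)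
      + (LINT z:{..<x}|lborel. exp (- m_neg * (z - x)) * ?f z))"
  proof -
    have "integrable lborel (\<lambda>z. indicator {x<..} z *\<^sub>R (exp (- m_pos * (z - x)) * ?f z))"
      using set_integrable_mult_bounded[OF exp_decay_Ioi(1)[OF m_pos_pos], of ?f C x] C
      by (simp add: set_integrable_def)
    moreover have "integrable lborel (\<lambda>z. indicator {..<x} z *\<^sub>R (exp (- m_neg * (z - x)) * ?f z))"
      using set_integrable_mult_bounded[OF exp_decay_Ioi(2)[of "- m_neg"], of ?f C x] C m_neg_neg
      by (simp add: set_integrable_def)
    ultimately show ?thesis
      unfolding set_lebesgue_integral_def by (simp add: Bochner_Integration.integral_add)
  qed
  also have "\<dots> = (1 / \<delta>) * (\<beta> * (1 / m_pos - 1 / m_neg) * w x)"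
    unfolding resolvent_half_lines[OF C2] by (simp add: algebra_simps)
  also have "\<dots> = w x" unfolding m_diff using \<delta>_pos by simp
  finally show ?thesis .
qed

end

section \<open>Brownian motion and the Markov property\<close>

text \<open>Freezing lemma: independence makes the joint law a product, so \<open>V\<close> may be
  held fixed while \<open>W\<close> is averaged. Stating it on \<open>M\<close> alone keeps image
  measures out of the later arguments.\<close>

lemma (in prob_space) integral_indep_var:
  fixes h :: "_ \<Rightarrow> real"
  assumes ind: "indep_var S V T W"
    and h [measurable]: "h \<in> borel_measurable (S \<Otimes>\<^sub>M T)" and C: "\<And>v. \<bar>h v\<bar> \<le> C"
  shows "(LINT \<omega>|M. h (V \<omega>, W \<omega>)) = (LINT \<omega>|M. LINT \<omega>'|M. h (V \<omega>, W \<omega>'))"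
proof -
  have [measurable]: "V \<in> measurable M S" "W \<in> measurable M T"
    using ind by (auto dest: indep_var_rv1 indep_var_rv2)
  have eq: "distr M S V \<Otimes>\<^sub>M distr M T W = distr M (S \<Otimes>\<^sub>M T) (\<lambda>x. (V x, W x))"
    using ind by (auto simp: indep_var_distribution_eq)
  interpret PV: prob_space "distr M S V" by (rule prob_space_distr) simp
  interpret PW: prob_space "distr M T W" by (rule prob_space_distr) simp
  interpret P: pair_prob_space "distr M S V" "distr M T W" ..
  have "integrable (distr M S V \<Otimes>\<^sub>M distr M T W) h"
    by (rule P.P.integrable_const_bound[where B = C]) (use C in auto)
  then have "(LINT p|(distr M S V \<Otimes>\<^sub>M distr M T W). h p) = (LINT v|distr M S V. LINT w|distr M T W. h (v, w))"
    by (rule P.integral_fst'[symmetric])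
  then have "(LINT \<omega>|M. h (V \<omega>, W \<omega>)) = (LINT \<omega>|M. LINT w|distr M T W. h (V \<omega>, w))"
    unfolding eq by (simp add: integral_distr)
  also have "\<dots> = (LINT \<omega>|M. LINT \<omega>'|M. h (V \<omega>, W \<omega>'))"
  proof (rule Bochner_Integration.integral_cong[OF refl])
    fix \<omega> assume "\<omega> \<in> space M"
    then have [measurable]: "V \<omega> \<in> space S" by (rule measurable_space[rotated]) simp
    show "(LINT w|distr M T W. h (V \<omega>, w)) = (LINT \<omega>'|M. h (V \<omega>, W \<omega>'))"
      by (rule integral_distr) measurable
  qed
  finally show ?thesis .
qed

locale drifted_bm = discounted_gaussian \<beta> \<nu> \<theta> for \<beta> \<nu> \<theta> :: real +
  fixes M :: "'w measure" and B :: "real \<Rightarrow> 'w \<Rightarrow> real"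
  assumes bm: "brownian_motion M B"
begin

sublocale prob_space M
  using bm by (simp add: brownian_motion_def)

lemma B_measurable [measurable]: "0 \<le> t \<Longrightarrow> B t \<in> borel_measurable M"
  using bm by (auto simp: brownian_motion_def)

text \<open>Paths are frozen at negative times, which makes them continuous on the whole line.\<close>

definition X :: "real \<Rightarrow> real \<Rightarrow> 'w \<Rightarrow> real" where
  "X x t \<omega> = x + \<nu> * t - \<theta> * B (max 0 t) \<omega>"

lemma X_measurable_t [measurable]: "X x t \<in> borel_measurable M"
  unfolding X_def[abs_def] by measurable

lemma X_continuous: "\<omega> \<in> space M \<Longrightarrow> continuous_on UNIV (\<lambda>t. X x t \<omega>)"
proof -
  assume "\<omega> \<in> space M"
  then have "continuous_on {0..} (\<lambda>t. B t \<omega>)" using bm by (auto simp: brownian_motion_def)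
  then have "continuous_on UNIV (\<lambda>t. B (max 0 t) \<omega>)"
    by (rule continuous_on_compose2[where f = "max 0"]) (auto intro!: continuous_intros)
  then show ?thesis unfolding X_def by (intro continuous_intros)
qed

lemma X_tendsto: "\<omega> \<in> space M \<Longrightarrow> (f \<longlongrightarrow> t) F \<Longrightarrow> ((\<lambda>n. X x (f n) \<omega>) \<longlongrightarrow> X x t \<omega>) F"
  using continuous_on_tendsto_compose[OF X_continuous, of \<omega> f t F x] by auto

lemma X_0: "\<omega> \<in> space M \<Longrightarrow> X x 0 \<omega> = x"
  using bm by (auto simp: brownian_motion_def X_def)

text \<open>Rounding time down to multiples of \<open>1 / (i + 1)\<close> leaves countably many
  values, hence joint measurability at each stage; continuity of paths gives the limit.\<close>

lemma X_measurable [measurable]: "(\<lambda>p. X x (fst p) (snd p)) \<in> borel_measurable (borel \<Otimes>\<^sub>M M)"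
proof (rule borel_measurable_LIMSEQ_real)
  define q where "q i t = real_of_int \<lfloor>t * real (Suc i)\<rfloor> / real (Suc i)" for i t
  fix i
  have "(\<lambda>p. X x (real_of_int n / real (Suc i)) (snd p)) \<in> borel_measurable (borel \<Otimes>\<^sub>M M)" for n
    by measurable
  moreover have "(\<lambda>p. \<lfloor>fst p * real (Suc i)\<rfloor>) \<in> measurable (borel \<Otimes>\<^sub>M M) (count_space UNIV)"
    by measurable
  ultimately show "(\<lambda>p. X x (q i (fst p)) (snd p)) \<in> borel_measurable (borel \<Otimes>\<^sub>M M)"
    unfolding q_def by (rule measurable_compose_countable)
next
  define q where "q i t = real_of_int \<lfloor>t * real (Suc i)\<rfloor> / real (Suc i)" for i t
  fix p :: "real \<times> 'w" assume "p \<in> space (borel \<Otimes>\<^sub>M M)"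
  then have sp: "snd p \<in> space M" by (auto simp: space_pair_measure)
  have "(\<lambda>i. q i (fst p)) \<longlonglongrightarrow> fst p"
  proof (rule LIMSEQ_I)
    fix e :: real assume "e > 0"
    then obtain N where N: "inverse (real (Suc N)) < e" using reals_Archimedean by blast
    have "norm (q i (fst p) - fst p) < e" if "i \<ge> N" for i
    proof -
      have "\<bar>q i (fst p) - fst p\<bar> \<le> inverse (real (Suc i))"
      proof -
        define r where "r = real (Suc i)"
        have r: "r > 0" by (simp add: r_def)
        have "q i (fst p) - fst p = (real_of_int \<lfloor>fst p * r\<rfloor> - fst p * r) / r"
          using r unfolding q_def r_def[symmetric] by (simp add: field_simps)
        moreover have "\<bar>real_of_int \<lfloor>fst p * r\<rfloor> - fst p * r\<bar> \<le> 1" by linarith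
        ultimately have "\<bar>q i (fst p) - fst p\<bar> \<le> 1 / r"
          using r by (simp add: abs_divide divide_right_mono)
        then show ?thesis by (simp add: r_def inverse_eq_divide)
      qed
      also have "\<dots> \<le> inverse (real (Suc N))" using that by (simp add: field_simps)
      finally show ?thesis using N by simp
    qed
    then show "\<exists>N. \<forall>i\<ge>N. norm (q i (fst p) - fst p) < e" by blast
  qed
  from X_tendsto[OF sp this]
  show "(\<lambda>i. X x (real_of_int \<lfloor>fst p * real (Suc i)\<rfloor> / real (Suc i)) (snd p)) \<longlonglongrightarrow> X x (fst p) (snd p)"
    unfolding q_def .
qed

lemma X_measurable' [measurable (raw)]:
  assumes [measurable]: "f \<in> borel_measurable N" "g \<in> measurable N M"
  shows "(\<lambda>p. X x (f p) (g p)) \<in> borel_measurable N"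
  using measurable_compose[OF measurable_Pair[OF assms] X_measurable] by simp

lemma trans_measurable [measurable (raw)]:
  assumes [measurable]: "\<phi> \<in> borel_measurable borel" "f \<in> borel_measurable N" "g \<in> borel_measurable N"
  shows "(\<lambda>p. trans \<phi> (f p) (g p)) \<in> borel_measurable N"
  unfolding trans_def by measurable

lemma integral_shifted_increment:
  assumes "0 \<le> T" "0 < s" and [measurable]: "\<phi> \<in> borel_measurable borel"
  shows "(LINT \<omega>|M. \<phi> (a + \<nu> * s - \<theta> * (B (T + s) \<omega> - B T \<omega>))) = trans \<phi> s a"
proof -
  have "distributed M lborel (\<lambda>\<omega>. B (T + s) \<omega> - B T \<omega>) (normal_density 0 (sqrt (T + s - T)))"
  proof -
    have "\<forall>s t. 0 \<le> s \<and> s < t \<longrightarrow>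
        distributed M lborel (\<lambda>\<omega>. B t \<omega> - B s \<omega>) (normal_density 0 (sqrt (t - s)))"
      using bm by (simp add: brownian_motion_def)
    from this[rule_format, of T "T + s"] show ?thesis using assms by simp
  qed
  from normal_density_affine[OF this, of "- \<theta>" "a + \<nu> * s"]
  have d: "distributed M lborel (\<lambda>\<omega>. a + \<nu> * s - \<theta> * (B (T + s) \<omega> - B T \<omega>))
      (normal_density (a + \<nu> * s) (\<theta> * sqrt s))"
    using assms \<theta>_pos by simp
  show ?thesis
    unfolding trans_def by (rule distributed_integral[OF d, symmetric]) auto
qed

text \<open>Observation at finitely many times makes the event a function of finitely many
  increments, the form in which \<open>brownian_motion\<close> provides independence.\<close>

definition grid_event :: "real \<Rightarrow> real \<Rightarrow> real \<Rightarrow> nat \<Rightarrow> 'w set" where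
  "grid_event x c T N = {\<omega> \<in> space M. \<forall>j\<le>N. c \<le> X x (real j * T / real N) \<omega>}"

lemma grid_event_sets [measurable]: "grid_event x c T N \<in> sets M"
  unfolding grid_event_def by measurable

text \<open>Freezing the increments of the past turns the average over the last increment into
  \<open>trans\<close>. The observation horizon \<open>T'\<close> is kept apart from
  \<open>T\<close> because a later argument tests events at both ends of a mesh interval against its
  right end.\<close>

lemma markov_grid:
  assumes T: "0 \<le> T'" "T' \<le> T" and s: "0 < s" and N: "0 < N"
    and \<phi> [measurable]: "\<phi> \<in> borel_measurable borel" and C: "\<And>z. \<bar>\<phi> z\<bar> \<le> C"
  shows "(LINT \<omega>|M. indicator (grid_event x c T' N) \<omega> * \<phi> (X x (T + s) \<omega>))
       = (LINT \<omega>|M. indicator (grid_event x c T' N) \<omega> * trans \<phi> s (X x T \<omega>))"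
proof -
  \<comment> \<open>The grid of \<open>[0, T']\<close> has the indices up to \<open>N\<close>; then
    come \<open>T\<close> and \<open>T + s\<close>. Coinciding times, as for \<open>T' = T\<close>,
    merely give zero increments, which the weak monotonicity in \<open>brownian_motion\<close>
    admits.\<close>
  define t where "t j = (if j \<le> N then real j * T' / real N else if j = Suc N then T else T + s)" for j
  define Z where "Z i \<omega> = B (t (Suc i)) \<omega> - B (t i) \<omega>" for i \<omega>
  have le: "real j * T' / real N \<le> T'" if "j \<le> N" for j
    using that T N by (simp add: field_simps) (simp add: mult.commute mult_left_mono)
  have t_mono: "incseq t"
  proof (rule incseq_SucI)
    fix n
    have "real n * T' / real N \<le> real (Suc n) * T' / real N"
      using T by (intro divide_right_mono mult_right_mono) auto
    then show "t n \<le> t (Suc n)" using T s le[of n] by (auto simp: t_def)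
  qed
  have t0: "t 0 = 0" by (simp add: t_def)
  have ind: "indep_vars (\<lambda>_. borel) Z {..<N + 2}"
    using bm t_mono t0 unfolding brownian_motion_def Z_def[abs_def] by auto
  have sumZ: "(\<Sum>i<j. Z i \<omega>) = B (t j) \<omega>" if "\<omega> \<in> space M" for j \<omega>
  proof -
    have "(\<Sum>i<j. Z i \<omega>) = B (t j) \<omega> - B (t 0) \<omega>"
      unfolding Z_def by (rule sum_lessThan_telescope)
    then show ?thesis using bm that by (simp add: t0 brownian_motion_def)
  qed
  \<comment> \<open>Increments 0 to \<open>N\<close> determine the path on the grid and at
    \<open>T\<close>; increment \<open>Suc N\<close> is the future.\<close>
  define V where "V \<omega> = restrict (\<lambda>i. Z i \<omega>) {..<Suc N}" for \<omega>
  define W where "W \<omega> = restrict (\<lambda>i. Z i \<omega>) {Suc N}" for \<omega>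
  have iv: "indep_var (PiM {..<Suc N} (\<lambda>_. borel)) V (PiM {Suc N} (\<lambda>_. borel)) W"
    unfolding V_def[abs_def] W_def[abs_def] by (rule indep_var_restrict[OF ind]) auto
  define S where "S j v = (\<Sum>i<j. v i :: real)" for j :: nat and v :: "nat \<Rightarrow> real"
  have S_meas [measurable]: "j \<le> Suc N \<Longrightarrow> (\<lambda>v. S j v) \<in> borel_measurable (PiM {..<Suc N} (\<lambda>_. borel))" for j
    unfolding S_def by (intro borel_measurable_sum measurable_component_singleton) auto
  have SV: "S j (V \<omega>) = B (t j) \<omega>" if "\<omega> \<in> space M" "j \<le> Suc N" for j \<omega>
  proof -
    have "S j (V \<omega>) = (\<Sum>i<j. Z i \<omega>)"
      unfolding S_def V_def using that(2) by (intro sum.cong) auto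
    then show ?thesis using sumZ that(1) by simp
  qed
  define J where "J v = (if \<forall>j\<in>{..N}. c \<le> x + \<nu> * t j - \<theta> * S j v then 1 else 0 :: real)" for v
  have [measurable]: "J \<in> borel_measurable (PiM {..<Suc N} (\<lambda>_. borel))"
    unfolding J_def[abs_def]
  proof (intro measurable_If borel_measurable_const, rule sets.sets_Collect_finite_All')
    fix j assume "j \<in> {..N}"
    then have [measurable]: "(\<lambda>v. S j v) \<in> borel_measurable (PiM {..<Suc N} (\<lambda>_. borel))" by simp
    show "{v \<in> space (PiM {..<Suc N} (\<lambda>_. borel)). c \<le> x + \<nu> * t j - \<theta> * S j v}
        \<in> sets (PiM {..<Suc N} (\<lambda>_. borel))"
      by measurable
  qed auto
  have JV: "J (V \<omega>) = indicator (grid_event x c T' N) \<omega>" if "\<omega> \<in> space M" for \<omega>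
  proof -
    have "t j \<ge> 0" "j \<le> N \<Longrightarrow> t j = real j * T' / real N" for j using T s by (auto simp: t_def)
    then have "x + \<nu> * t j - \<theta> * S j (V \<omega>) = X x (real j * T' / real N) \<omega>" if "j \<le> N" for j
      using SV[OF \<open>\<omega> \<in> space M\<close>, of j] that T by (simp add: X_def)
    then show ?thesis using that by (auto simp: J_def grid_event_def indicator_def)
  qed
  have XT: "x + \<nu> * T - \<theta> * S (Suc N) (V \<omega>) = X x T \<omega>" if "\<omega> \<in> space M" for \<omega>
    using SV[OF that, of "Suc N"] T by (simp add: X_def t_def)
  have Zl: "W \<omega> (Suc N) = B (T + s) \<omega> - B T \<omega>" for \<omega> by (simp add: W_def Z_def t_def)
  define h where "h = (\<lambda>(v, z). J v * \<phi> (x + \<nu> * T - \<theta> * S (Suc N) v + \<nu> * s - \<theta> * z (Suc N)))"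
  have h_meas: "h \<in> borel_measurable (PiM {..<Suc N} (\<lambda>_. borel) \<Otimes>\<^sub>M PiM {Suc N} (\<lambda>_. borel))"
    using S_meas[of "Suc N"] unfolding h_def by measurable
  have h_bd: "\<bar>h p\<bar> \<le> C" for p
    using C by (auto simp: h_def J_def abs_mult split: prod.splits intro: order_trans[OF abs_ge_zero])
  have "(LINT \<omega>|M. indicator (grid_event x c T' N) \<omega> * \<phi> (X x (T + s) \<omega>))
      = (LINT \<omega>|M. h (V \<omega>, W \<omega>))"
  proof (rule Bochner_Integration.integral_cong[OF refl])
    fix \<omega> assume \<omega>: "\<omega> \<in> space M"
    have "x + \<nu> * T - \<theta> * S (Suc N) (V \<omega>) + \<nu> * s - \<theta> * W \<omega> (Suc N) = X x (T + s) \<omega>"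
      unfolding XT[OF \<omega>] Zl using T s by (simp add: X_def algebra_simps)
    then show "indicator (grid_event x c T' N) \<omega> * \<phi> (X x (T + s) \<omega>) = h (V \<omega>, W \<omega>)"
      by (simp add: h_def JV[OF \<omega>])
  qed
  also have "\<dots> = (LINT \<omega>|M. LINT \<omega>'|M. h (V \<omega>, W \<omega>'))"
    by (rule integral_indep_var[OF iv h_meas h_bd])
  also have "\<dots> = (LINT \<omega>|M. indicator (grid_event x c T' N) \<omega> * trans \<phi> s (X x T \<omega>))"
  proof (rule Bochner_Integration.integral_cong[OF refl])
    fix \<omega> assume \<omega>: "\<omega> \<in> space M"
    have "(LINT \<omega>'|M. h (V \<omega>, W \<omega>'))
       = J (V \<omega>) * (LINT \<omega>'|M. \<phi> (X x T \<omega> + \<nu> * s - \<theta> * (B (T + s) \<omega>' - B T \<omega>')))"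
      unfolding h_def case_prod_conv Zl XT[OF \<omega>] by simp
    then show "(LINT \<omega>'|M. h (V \<omega>, W \<omega>'))
        = indicator (grid_event x c T' N) \<omega> * trans \<phi> s (X x T \<omega>)"
      using integral_shifted_increment[of T s \<phi>] T s by (simp add: JV[OF \<omega>])
  qed
  finally show ?thesis .
qed

end

section \<open>From grid events to events of the whole path\<close>

context drifted_bm
begin

definition above :: "real \<Rightarrow> real \<Rightarrow> real \<Rightarrow> 'w set" where
  "above x c T = {\<omega> \<in> space M. \<forall>t\<in>{0..T}. c < X x t \<omega>}"

text \<open>The grids are not nested, so this is pointwise convergence and not a decreasing
  intersection. By continuity a dip below \<open>c\<close> at time \<open>u\<close> is eventually
  seen from the grid points that approach \<open>u\<close>.\<close>

lemma grid_event_limit: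
  assumes "0 \<le> T" and \<omega>: "\<omega> \<in> space M"
  shows "(\<lambda>N. indicator (grid_event x c T (Suc N)) \<omega> :: real)
           \<longlonglongrightarrow> indicator {\<omega>. \<forall>t\<in>{0..T}. c \<le> X x t \<omega>} \<omega>"
proof (cases "\<forall>t\<in>{0..T}. c \<le> X x t \<omega>")
  case True
  have "real j * T / real (Suc N) \<in> {0..T}" if "j \<le> Suc N" for j N
    using that assms mult_right_mono[of "real j" "real (Suc N)" T] by (simp add: field_simps)
  then have "\<omega> \<in> grid_event x c T (Suc N)" for N
    using True \<omega> unfolding grid_event_def by blast
  then show ?thesis using True by simp
next
  case False
  then obtain u where u: "u \<in> {0..T}" "X x u \<omega> < c" by force
  \<comment> \<open>Index of the grid point at \<open>u\<close> or next to its left. For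
    \<open>T = 0\<close> division by zero gives index 0, which is right because then
    \<open>u = 0\<close>.\<close>
  define j where "j N = nat \<lfloor>u / T * real (Suc N)\<rfloor>" for N
  have uT: "0 \<le> u / T" "u / T \<le> 1" using u by (auto simp: divide_le_eq_1)
  have j: "real (j N) \<le> u / T * real (Suc N)" "u / T * real (Suc N) < real (j N) + 1" for N
  proof -
    have "0 \<le> u / T * real (Suc N)" using uT(1) by (intro mult_nonneg_nonneg) auto
    then show "real (j N) \<le> u / T * real (Suc N)" "u / T * real (Suc N) < real (j N) + 1"
      unfolding j_def by linarith+
  qed
  have jN: "j N \<le> Suc N" for N
  proof -
    have "u / T * real (Suc N) \<le> 1 * real (Suc N)" using uT by (intro mult_right_mono) auto
    from order_trans[OF j(1) this] show ?thesis by simp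
  qed
  have "(\<lambda>N. real (j N) * T / real (Suc N)) \<longlonglongrightarrow> u"
  proof (rule LIMSEQ_I)
    fix e :: real assume e: "e > 0"
    obtain K where K: "T / e < real K" using reals_Archimedean2 by blast
    have "norm (real (j N) * T / real (Suc N) - u) < e" if "N \<ge> K" for N
    proof (cases "T = 0")
      case True then show ?thesis using u e by simp
    next
      case False
      then have T: "T > 0" using assms by simp
      define n where "n = real (Suc N)"
      have n: "n > 0" by (simp add: n_def)
      have "\<bar>real (j N) - u / T * n\<bar> < 1" using j[of N] unfolding n_def by linarith
      then have "\<bar>real (j N) - u / T * n\<bar> * (T / n) < 1 * (T / n)" using T n by (intro mult_strict_right_mono) auto
      moreover have "real (j N) * T / n - u = (real (j N) - u / T * n) * (T / n)"
        using T n by (simp add: field_simps)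
      ultimately have "\<bar>real (j N) * T / n - u\<bar> < T / n" using T n by (simp add: abs_mult)
      also have "T / n < e"
      proof -
        have "T / e < n" using K that unfolding n_def by linarith
        then show ?thesis using e n by (simp add: field_simps)
      qed
      finally show ?thesis by (simp add: n_def)
    qed
    then show "\<exists>K. \<forall>N\<ge>K. norm (real (j N) * T / real (Suc N) - u) < e" by blast
  qed
  from X_tendsto[OF \<omega> this] have "(\<lambda>N. X x (real (j N) * T / real (Suc N)) \<omega>) \<longlonglongrightarrow> X x u \<omega>" .
  from order_tendstoD(2)[OF this u(2)]
  have "\<forall>\<^sub>F N in sequentially. indicator (grid_event x c T (Suc N)) \<omega> = (0::real)"
    by eventually_elim (use jN in \<open>force simp: grid_event_def indicator_def not_le\<close>)
  then show ?thesis using False by (simp add: tendsto_eventually)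
qed

text \<open>A path above \<open>c\<close> attains its minimum on the compact interval, hence clears
  the level \<open>c + 1 / (n + 1)\<close> for large \<open>n\<close>.\<close>

lemma above_limit:
  assumes "0 \<le> T" and \<omega>: "\<omega> \<in> space M"
  shows "(\<lambda>n. indicator {\<omega>. \<forall>t\<in>{0..T}. c + 1 / real (Suc n) \<le> X x t \<omega>} \<omega> :: real)
           \<longlonglongrightarrow> indicator (above x c T) \<omega>"
proof (cases "\<omega> \<in> above x c T")
  case True
  have "continuous_on {0..T} (\<lambda>t. X x t \<omega>)"
    using X_continuous[OF \<omega>] by (rule continuous_on_subset) auto
  from continuous_attains_inf[OF _ _ this] obtain u
    where u: "u \<in> {0..T}" "\<And>t. t \<in> {0..T} \<Longrightarrow> X x u \<omega> \<le> X x t \<omega>"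
    using assms by auto
  then have "0 < X x u \<omega> - c" using True by (auto simp: above_def)
  then obtain K where K: "inverse (real (Suc K)) < X x u \<omega> - c" using reals_Archimedean by blast
  have "\<forall>\<^sub>F n in sequentially. indicator {\<omega>. \<forall>t\<in>{0..T}. c + 1 / real (Suc n) \<le> X x t \<omega>} \<omega> = (1::real)"
    using eventually_ge_at_top[of K]
  proof eventually_elim
    fix n assume "K \<le> n"
    then have "1 / real (Suc n) \<le> inverse (real (Suc K))" by (simp add: field_simps)
    then have "c + 1 / real (Suc n) \<le> X x u \<omega>" using K by linarith
    then have "\<forall>t\<in>{0..T}. c + 1 / real (Suc n) \<le> X x t \<omega>" using u(2) order_trans by blast
    then show "indicator {\<omega>. \<forall>t\<in>{0..T}. c + 1 / real (Suc n) \<le> X x t \<omega>} \<omega> = (1::real)" by simp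
  qed
  then show ?thesis using True by (simp add: tendsto_eventually)
next
  case False
  then obtain u where "u \<in> {0..T}" "X x u \<omega> \<le> c" using \<omega> by (auto simp: above_def not_less)
  moreover have "c < c + 1 / real (Suc n)" for n by simp
  ultimately have "\<omega> \<notin> {\<omega>. \<forall>t\<in>{0..T}. c + 1 / real (Suc n) \<le> X x t \<omega>}" for n
    by (fastforce dest: order_trans simp: not_le)
  then show ?thesis using False by simp
qed

text \<open>The premise covers every level because the strict event is reached through raised
  levels. Measurability of \<open>above\<close>, an uncountable intersection, comes out of the same
  limits.\<close>

lemma grid_to_above:
  assumes H: "integrable M H" and T: "0 \<le> T"
    and grid: "\<And>c N. (LINT \<omega>|M. indicator (grid_event x c T (Suc N)) \<omega> * H \<omega>) = (0::real)"
  shows "above x c T \<in> sets M" "(LINT \<omega>|M. indicator (above x c T) \<omega> * H \<omega>) = 0"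
proof -
  define L where "L c = {\<omega>. \<forall>t\<in>{0..T}. c \<le> X x t \<omega>}" for c
  have [measurable]: "H \<in> borel_measurable M" using H by auto
  have L_meas [measurable]: "(\<lambda>\<omega>. indicator (L c) \<omega> :: real) \<in> borel_measurable M" for c
    unfolding L_def by (rule borel_measurable_LIMSEQ_real[OF grid_event_limit]) (use T in auto)
  have A_meas: "(\<lambda>\<omega>. indicator (above x c T) \<omega> :: real) \<in> borel_measurable M"
    by (rule borel_measurable_LIMSEQ_real[OF above_limit]) (use T L_meas in \<open>auto simp: L_def\<close>)
  then have "{\<omega> \<in> space M. indicator (above x c T) \<omega> = (1::real)} \<in> sets M"
    by measurable
  also have "{\<omega> \<in> space M. indicator (above x c T) \<omega> = (1::real)} = above x c T"
    by (auto simp: above_def indicator_def)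
  finally show "above x c T \<in> sets M" .
  have gl: "(\<lambda>N. indicator (grid_event x c T (Suc N)) \<omega> :: real) \<longlonglongrightarrow> indicator (L c) \<omega>"
    and al: "(\<lambda>n. indicator (L (c + 1 / real (Suc n))) \<omega> :: real) \<longlonglongrightarrow> indicator (above x c T) \<omega>"
    if "\<omega> \<in> space M" for \<omega> c
    using grid_event_limit[OF T that] above_limit[OF T that] by (simp_all only: L_def)
  have dom: "AE \<omega> in M. norm (indicator A \<omega> * H \<omega>) \<le> \<bar>H \<omega>\<bar>" for A
    by (auto simp: indicator_def)
  have "(LINT \<omega>|M. indicator (L c) \<omega> * H \<omega>) = 0" for c
  proof (rule LIMSEQ_unique)
    show "(\<lambda>N. LINT \<omega>|M. indicator (grid_event x c T (Suc N)) \<omega> * H \<omega>) \<longlonglongrightarrow> (LINT \<omega>|M. indicator (L c) \<omega> * H \<omega>)"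
    proof (rule integral_dominated_convergence[where w = "\<lambda>\<omega>. \<bar>H \<omega>\<bar>"])
      show "integrable M (\<lambda>\<omega>. \<bar>H \<omega>\<bar>)" using H by (rule integrable_abs)
      show "AE \<omega> in M. (\<lambda>N. indicator (grid_event x c T (Suc N)) \<omega> * H \<omega>) \<longlonglongrightarrow> indicator (L c) \<omega> * H \<omega>"
        by (intro AE_I2 tendsto_mult gl tendsto_const)
      show "AE \<omega> in M. norm (indicator (grid_event x c T (Suc N)) \<omega> * H \<omega>) \<le> \<bar>H \<omega>\<bar>" for N by (rule dom)
    qed measurable
  qed (simp add: grid)
  moreover have "(\<lambda>n. LINT \<omega>|M. indicator (L (c + 1 / real (Suc n))) \<omega> * H \<omega>)
      \<longlonglongrightarrow> (LINT \<omega>|M. indicator (above x c T) \<omega> * H \<omega>)"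
  proof (rule integral_dominated_convergence[where w = "\<lambda>\<omega>. \<bar>H \<omega>\<bar>"])
    show "integrable M (\<lambda>\<omega>. \<bar>H \<omega>\<bar>)" using H by (rule integrable_abs)
    show "AE \<omega> in M. (\<lambda>n. indicator (L (c + 1 / real (Suc n))) \<omega> * H \<omega>) \<longlonglongrightarrow> indicator (above x c T) \<omega> * H \<omega>"
      by (intro AE_I2 tendsto_mult al tendsto_const)
    show "AE \<omega> in M. norm (indicator (L (c + 1 / real (Suc n))) \<omega> * H \<omega>) \<le> \<bar>H \<omega>\<bar>" for n by (rule dom)
  qed (use A_meas in measurable)
  ultimately show "(LINT \<omega>|M. indicator (above x c T) \<omega> * H \<omega>) = 0"
    by (simp add: LIMSEQ_const_iff)
qed

text \<open>The payoff after \<open>T\<close>, discounted to time 0. Time is shifted so that the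
  domain and the majorant do not depend on \<open>T\<close>.\<close>

definition tail :: "(real \<Rightarrow> real) \<Rightarrow> real \<Rightarrow> real \<Rightarrow> 'w \<Rightarrow> real" where
  "tail \<phi> x T \<omega> = (LINT s|lborel. indicator {0<..} s * exp (- \<beta> * (T + s)) * \<phi> (X x (T + s) \<omega>))"

lemma exp_indicator_integrable:
  "integrable lborel (\<lambda>s. indicator {0<..} s * exp (- \<beta> * s))"
  "(LINT s|lborel. indicator {0<..} s * exp (- \<beta> * s)) = 1 / \<beta>"
  using exp_decay_Ioi(1,3)[OF \<beta>_pos, of 0] by (simp_all add: set_integrable_def set_lebesgue_integral_def)

lemma tail_measurable [measurable]:
  assumes [measurable]: "\<phi> \<in> borel_measurable borel"
  shows "(\<lambda>\<omega>. tail \<phi> x T \<omega>) \<in> borel_measurable M"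
  unfolding tail_def by measurable

context
  fixes \<phi> :: "real \<Rightarrow> real" and C :: real
  assumes \<phi> [measurable]: "\<phi> \<in> borel_measurable borel" and C: "\<And>z. \<bar>\<phi> z\<bar> \<le> C"
begin

lemma tail_dominated:
  assumes "0 \<le> T"
  shows "\<bar>indicator {0<..} s * exp (- \<beta> * (T + s)) * \<phi> z\<bar> \<le> C * (indicator {0<..} s * exp (- \<beta> * s))"
proof -
  have "exp (- \<beta> * (T + s)) \<le> exp (- \<beta> * s)" using assms \<beta>_pos by simp
  then have "exp (- \<beta> * (T + s)) * \<bar>\<phi> z\<bar> \<le> exp (- \<beta> * s) * C" using C by (intro mult_mono) auto
  then show ?thesis by (simp add: abs_mult indicator_def mult.commute)
qed

lemma tail_integrable:
  assumes "0 \<le> T" "\<omega> \<in> space M"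
  shows "integrable lborel (\<lambda>s. indicator {0<..} s * exp (- \<beta> * (T + s)) * \<phi> (X x (T + s) \<omega>))"
proof (rule Bochner_Integration.integrable_bound)
  show "integrable lborel (\<lambda>s. C * (indicator {0<..} s * exp (- \<beta> * s)))"
    using exp_indicator_integrable by simp
  have [measurable]: "(\<lambda>s. X x (T + s) \<omega>) \<in> borel_measurable borel"
    using assms by measurable
  show "(\<lambda>s. indicator {0<..} s * exp (- \<beta> * (T + s)) * \<phi> (X x (T + s) \<omega>)) \<in> borel_measurable lborel"
    by measurable
  show "AE s in lborel. norm (indicator {0<..} s * exp (- \<beta> * (T + s)) * \<phi> (X x (T + s) \<omega>))
      \<le> norm (C * (indicator {0<..} s * exp (- \<beta> * s)))"
    using tail_dominated[OF assms(1)] by (auto intro!: AE_I2 order_trans[OF _ abs_ge_self])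
qed

lemma tail_bounded:
  assumes "0 \<le> T" "\<omega> \<in> space M"
  shows "\<bar>tail \<phi> x T \<omega>\<bar> \<le> C / \<beta>"
proof -
  have "\<bar>tail \<phi> x T \<omega>\<bar> \<le> (LINT s|lborel. \<bar>indicator {0<..} s * exp (- \<beta> * (T + s)) * \<phi> (X x (T + s) \<omega>)\<bar>)"
    unfolding tail_def by (rule integral_abs_bound)
  also have "\<dots> \<le> (LINT s|lborel. C * (indicator {0<..} s * exp (- \<beta> * s)))"
    by (rule integral_mono)
       (use tail_integrable[OF assms] tail_dominated[OF assms(1)] exp_indicator_integrable in auto)
  also have "\<dots> = C / \<beta>" using exp_indicator_integrable(2) by simp
  finally show ?thesis .
qed

text \<open>The Markov property at each later time, integrated over time. The integral of
  \<open>trans\<close> on the right is the resolvent started from \<open>X x T\<close>.\<close>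

lemma markov_tail_grid:
  assumes T: "0 \<le> T'" "T' \<le> T" and N: "0 < N"
  shows "(LINT \<omega>|M. indicator (grid_event x c T' N) \<omega> * tail \<phi> x T \<omega>)
       = (LINT \<omega>|M. indicator (grid_event x c T' N) \<omega> *
            (exp (- \<beta> * T) * (LINT s:{0<..}|lborel. exp (- \<beta> * s) * trans \<phi> s (X x T \<omega>))))"
proof -
  let ?I = "\<lambda>\<omega>. indicator (grid_event x c T' N) \<omega> :: real"
  let ?e = "\<lambda>s. indicator {0<..} s * exp (- \<beta> * (T + s))"
  have T0: "0 \<le> T" using T by simp
  interpret L: pair_sigma_finite M "lborel :: real measure" ..
  \<comment> \<open>One exchange of expectation and time integral for an abstract bounded
    \<open>g\<close>, used forwards for the payoff and backwards for its conditional mean.\<close>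
  have fub: "(LINT \<omega>|M. LINT s|lborel. ?I \<omega> * (?e s * g s \<omega>)) = (LINT s|lborel. ?e s * (LINT \<omega>|M. ?I \<omega> * g s \<omega>))"
    if [measurable]: "case_prod g \<in> borel_measurable (borel \<Otimes>\<^sub>M M)"
      and bd: "\<And>s \<omega>. s > 0 \<Longrightarrow> \<omega> \<in> space M \<Longrightarrow> \<bar>g s \<omega>\<bar> \<le> C" for g
  proof -
    have dom: "\<bar>?I \<omega> * (?e s * g s \<omega>)\<bar> \<le> C * (indicator {0<..} s * exp (- \<beta> * s))"
      if "\<omega> \<in> space M" for s \<omega>
    proof (cases "s > 0")
      case True
      have "exp (- \<beta> * (T + s)) * \<bar>g s \<omega>\<bar> \<le> exp (- \<beta> * s) * C"
        using bd[OF True that] T0 \<beta>_pos by (intro mult_mono) auto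
      moreover from this have "0 \<le> exp (- \<beta> * s) * C" by (rule order_trans[rotated]) simp
      ultimately show ?thesis using True by (simp add: abs_mult indicator_def mult.commute)
    qed simp
    have gm: "(\<lambda>x. g (snd x) (fst x)) \<in> borel_measurable (M \<Otimes>\<^sub>M lborel)"
      using measurable_compose[OF measurable_Pair[OF measurable_snd measurable_fst] that(1)] by (simp add: measurable_lborel1 cong: measurable_cong_sets)
    have ii: "integrable (M \<Otimes>\<^sub>M lborel) (\<lambda>(\<omega>, s). ?I \<omega> * (?e s * g s \<omega>))"
    proof (rule Bochner_Integration.integrable_bound)
      show "integrable (M \<Otimes>\<^sub>M lborel) (\<lambda>(\<omega>, s). C * (indicator {0<..} s * exp (- \<beta> * s)))"
        by (rule L.Fubini_integrable) (use exp_indicator_integrable in auto)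
      show "(\<lambda>(\<omega>, s). ?I \<omega> * (?e s * g s \<omega>)) \<in> borel_measurable (M \<Otimes>\<^sub>M lborel)"
        using gm by (auto simp: split_beta' intro!: borel_measurable_times)
      show "AE p in M \<Otimes>\<^sub>M lborel. norm (case p of (\<omega>, s) \<Rightarrow> ?I \<omega> * (?e s * g s \<omega>))
         \<le> norm (case p of (\<omega>, s) \<Rightarrow> C * (indicator {0<..} s * exp (- \<beta> * s)))"
        using dom by (intro AE_I2) (auto simp: space_pair_measure intro!: order_trans[OF _ abs_ge_self])
    qed
    from L.Fubini_integral[OF this]
    have "(LINT \<omega>|M. LINT s|lborel. ?I \<omega> * (?e s * g s \<omega>)) = (LINT s|lborel. LINT \<omega>|M. ?I \<omega> * (?e s * g s \<omega>))"
      by simp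
    also have "\<dots> = (LINT s|lborel. ?e s * (LINT \<omega>|M. ?I \<omega> * g s \<omega>))"
      by (intro Bochner_Integration.integral_cong refl, subst integral_mult_right_zero[symmetric])
         (simp add: ac_simps)
    finally show ?thesis .
  qed
  have "(LINT \<omega>|M. ?I \<omega> * tail \<phi> x T \<omega>) = (LINT \<omega>|M. LINT s|lborel. ?I \<omega> * (?e s * \<phi> (X x (T + s) \<omega>)))"
    unfolding tail_def by simp
  also have "\<dots> = (LINT s|lborel. ?e s * (LINT \<omega>|M. ?I \<omega> * \<phi> (X x (T + s) \<omega>)))"
    by (rule fub) (use C in auto)
  also have "\<dots> = (LINT s|lborel. ?e s * (LINT \<omega>|M. ?I \<omega> * trans \<phi> s (X x T \<omega>)))"
    using markov_grid[OF T _ N \<phi> C] by (intro Bochner_Integration.integral_cong refl) (auto simp: indicator_def)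
  also have "\<dots> = (LINT \<omega>|M. LINT s|lborel. ?I \<omega> * (?e s * trans \<phi> s (X x T \<omega>)))"
    by (rule fub[symmetric]) (use trans_bounded(1)[OF \<phi> C] in auto)
  also have "\<dots> = (LINT \<omega>|M. ?I \<omega> *
            (exp (- \<beta> * T) * (LINT s:{0<..}|lborel. exp (- \<beta> * s) * trans \<phi> s (X x T \<omega>))))"
  proof (intro Bochner_Integration.integral_cong refl)
    fix \<omega>
    have "exp (- \<beta> * (T + s)) = exp (- \<beta> * T) * exp (- \<beta> * s)" for s
      by (simp add: mult_exp_exp distrib_left)
    then have "(LINT s|lborel. ?I \<omega> * (?e s * trans \<phi> s (X x T \<omega>)))
        = (LINT s|lborel. ?I \<omega> * (exp (- \<beta> * T) * (indicator {0<..} s * (exp (- \<beta> * s) * trans \<phi> s (X x T \<omega>)))))"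
      by (intro Bochner_Integration.integral_cong refl) (simp only: ac_simps)
    then show "(LINT s|lborel. ?I \<omega> * (?e s * trans \<phi> s (X x T \<omega>))) = ?I \<omega> *
            (exp (- \<beta> * T) * (LINT s:{0<..}|lborel. exp (- \<beta> * s) * trans \<phi> s (X x T \<omega>)))"
      unfolding set_lebesgue_integral_def by simp
  qed
  finally show ?thesis .
qed

end

end

section \<open>Discounted integrals up to a hitting time\<close>

context drifted_bm
begin

definition hit :: "real \<Rightarrow> real \<Rightarrow> 'w \<Rightarrow> ereal" where
  "hit x c \<omega> = Inf (ereal ` {s. 0 < s \<and> X x s \<omega> \<le> c})"

text \<open>As the path starts strictly above \<open>c\<close>, leaving time 0 out of
  \<open>hit\<close> is harmless. Strictness survives the infimum by continuity at
  \<open>T\<close>.\<close>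

lemma less_hit_iff:
  assumes \<omega>: "\<omega> \<in> space M" and c: "c < x" and T: "0 \<le> T"
  shows "ereal T < hit x c \<omega> \<longleftrightarrow> \<omega> \<in> above x c T"
proof
  assume *: "ereal T < hit x c \<omega>"
  show "\<omega> \<in> above x c T"
    unfolding above_def
  proof (intro CollectI conjI \<omega> ballI)
    fix t assume t: "t \<in> {0..T}"
    show "c < X x t \<omega>"
    proof (rule ccontr)
      assume n: "\<not> c < X x t \<omega>"
      then have "t \<noteq> 0" using X_0[OF \<omega>, of x] c by auto
      then have "ereal t \<in> ereal ` {s. 0 < s \<and> X x s \<omega> \<le> c}" using n t by auto
      then have "hit x c \<omega> \<le> ereal t" unfolding hit_def by (rule Inf_lower)
      then have "ereal T < ereal t" using * by (rule order.strict_trans2[rotated])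
      then show False using t by simp
    qed
  qed
next
  assume *: "\<omega> \<in> above x c T"
  \<comment> \<open>The path stays above \<open>c\<close> on a neighbourhood of \<open>T\<close>, so
    the infimum exceeds \<open>T\<close> by a positive amount.\<close>
  have "(\<lambda>t. X x t \<omega>) \<midarrow>T\<rightarrow> X x T \<omega>" by (rule X_tendsto[OF \<omega>]) (rule tendsto_ident_at)
  moreover have "c < X x T \<omega>" using * T by (auto simp: above_def)
  ultimately have "\<forall>\<^sub>F t in at T. c < X x t \<omega>" by (rule order_tendstoD)
  then obtain d where d: "d > 0" "\<And>t. t \<noteq> T \<Longrightarrow> dist t T < d \<Longrightarrow> c < X x t \<omega>"
    unfolding eventually_at by auto
  have "T + d \<le> s" if "0 < s" "X x s \<omega> \<le> c" for s
  proof (rule ccontr)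
    assume "\<not> T + d \<le> s"
    then have "s \<le> T \<or> s \<noteq> T \<and> dist s T < d" by (auto simp: dist_real_def)
    then have "c < X x s \<omega>" using d(2)[of s] that(1) * by (auto simp: above_def)
    then show False using that(2) by simp
  qed
  then have "ereal (T + d) \<le> hit x c \<omega>" unfolding hit_def by (auto intro!: Inf_greatest)
  then show "ereal T < hit x c \<omega>" using d(1) by (meson ereal_less(2) less_add_same_cancel1 less_ereal.simps(1) order_less_le_trans)
qed

text \<open>The path stays above \<open>c\<close> before \<open>T\<close>, which bounds its value at
  \<open>T\<close> from below by left limits. It does not stay above through \<open>T\<close>, so
  \<open>T\<close> itself must be the exception.\<close>

lemma X_at_hit:
  assumes \<omega>: "\<omega> \<in> space M" and c: "c < x" and h: "hit x c \<omega> = ereal T"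
  shows "0 < T" "X x T \<omega> = c"
proof -
  have "\<omega> \<in> above x c 0" using \<omega> c by (auto simp: above_def X_0)
  then have "ereal 0 < hit x c \<omega>" using less_hit_iff[OF \<omega> c] by simp
  then show T: "0 < T" unfolding h by simp
  have ab: "c < X x t \<omega>" if "0 \<le> t" "t < T" for t
    using less_hit_iff[OF \<omega> c that(1)] that unfolding h by (auto simp: above_def)
  have "\<omega> \<notin> above x c T" using less_hit_iff[OF \<omega> c, of T] T unfolding h by auto
  then obtain u where "0 \<le> u" "u \<le> T" "X x u \<omega> \<le> c" using \<omega> by (auto simp: above_def not_less)
  with ab[of u] have 1: "X x T \<omega> \<le> c" by (cases "u = T") auto
  have "((\<lambda>t. X x t \<omega>) \<longlongrightarrow> X x T \<omega>) (at_left T)" by (rule X_tendsto[OF \<omega>]) (rule tendsto_ident_at)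
  moreover have "\<forall>\<^sub>F t in at_left T. c \<le> X x t \<omega>"
    using eventually_at_left_real[OF T] by eventually_elim (use ab in \<open>auto intro: less_imp_le\<close>)
  ultimately have "c \<le> X x T \<omega>"
    by (intro tendsto_lowerbound) auto
  with 1 show "X x T \<omega> = c" by simp
qed

context
  fixes w w1 w2 :: "real \<Rightarrow> real"
  assumes C2: "C2_bounded w w1 w2"
begin

abbreviation "\<phi> \<equiv> op w w1 w2"

lemma op_measurable [measurable]: "\<phi> \<in> borel_measurable borel"
  by (rule borel_measurable_continuous_onI[OF op_continuous[OF C2]])

text \<open>Let \<open>N_T\<close> be the discounted integral of \<open>\<phi>\<close> up to
  \<open>T\<close> plus \<open>exp (- \<beta> * T) * w (X x T \<omega>)\<close>, a martingale by
  Ito's formula. This is its limit at infinity minus \<open>N_T\<close>.\<close>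

definition residual :: "real \<Rightarrow> real \<Rightarrow> 'w \<Rightarrow> real" where
  "residual x T \<omega> = tail \<phi> x T \<omega> - exp (- \<beta> * T) * w (X x T \<omega>)"

lemma w_continuous: "continuous_on UNIV w"
  using C2 unfolding C2_bounded_def by (auto intro!: continuous_at_imp_continuous_on dest: DERIV_isCont)

lemma w_measurable [measurable]: "w \<in> borel_measurable borel"
  by (rule borel_measurable_continuous_onI[OF w_continuous])

lemma residual_measurable [measurable]: "residual x T \<in> borel_measurable M"
  unfolding residual_def[abs_def] by measurable

lemma residual_bounded:
  obtains K where "\<And>x T \<omega>. 0 \<le> T \<Longrightarrow> \<omega> \<in> space M \<Longrightarrow> \<bar>residual x T \<omega>\<bar> \<le> K"
proof -
  obtain C where C: "\<And>z. \<bar>\<phi> z\<bar> \<le> C" using op_bounded[OF C2] by blast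
  obtain a where a: "\<And>z. \<bar>w z\<bar> \<le> a"
    using C2 unfolding C2_bounded_def bounded_iff by (auto simp: image_iff)
  have "\<bar>residual x T \<omega>\<bar> \<le> C / \<beta> + 1 * a" if "0 \<le> T" "\<omega> \<in> space M" for x T \<omega>
    unfolding residual_def
  proof (intro order_trans[OF abs_triangle_ineq4] add_mono)
    show "\<bar>tail \<phi> x T \<omega>\<bar> \<le> C / \<beta>" by (rule tail_bounded[OF op_measurable C that])
    show "\<bar>exp (- \<beta> * T) * w (X x T \<omega>)\<bar> \<le> 1 * a"
      unfolding abs_mult by (intro mult_mono) (use that a \<beta>_pos in auto)
  qed
  then show ?thesis by (rule that)
qed

lemma residual_integrable:
  assumes "0 \<le> T"
  shows "integrable M (residual x T)"
proof -
  obtain K where "\<And>x T \<omega>. 0 \<le> T \<Longrightarrow> \<omega> \<in> space M \<Longrightarrow> \<bar>residual x T \<omega>\<bar> \<le> K"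
    using residual_bounded by blast
  then show ?thesis
    by (intro integrable_const_bound[where B = K]) (use assms in \<open>auto intro!: AE_I2\<close>)
qed

text \<open>The Markov property replaces the tail by the discounted resolvent at
  \<open>X x T\<close>, which is \<open>w\<close> by \<open>resolvent_eq\<close>. So the residual
  averages to zero on grid events, and \<open>grid_to_above\<close> passes to path events.\<close>

lemma residual_above:
  assumes T: "0 \<le> T'" "T' \<le> T"
  shows "above x c T' \<in> sets M" "(LINT \<omega>|M. indicator (above x c T') \<omega> * residual x T \<omega>) = 0"
proof -
  have T0: "0 \<le> T" using T by simp
  obtain C where C: "\<And>z. \<bar>\<phi> z\<bar> \<le> C" using op_bounded[OF C2] by blast
  obtain a where a: "\<And>z. \<bar>w z\<bar> \<le> a"
    using C2 unfolding C2_bounded_def bounded_iff by (auto simp: image_iff)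
  have "(LINT \<omega>|M. indicator (grid_event x c T' (Suc N)) \<omega> * residual x T \<omega>) = 0" for c N
  proof -
    let ?I = "\<lambda>\<omega>. indicator (grid_event x c T' (Suc N)) \<omega> :: real"
    have C0: "0 \<le> C" using C[of 0] by linarith
    have i1: "integrable M (\<lambda>\<omega>. ?I \<omega> * tail \<phi> x T \<omega>)"
    proof (rule integrable_const_bound[where B = "1 * (C / \<beta>)"])
      show "AE \<omega> in M. norm (?I \<omega> * tail \<phi> x T \<omega>) \<le> 1 * (C / \<beta>)"
        unfolding norm_mult real_norm_def
        using tail_bounded[OF op_measurable C T0] C0 \<beta>_pos
        by (intro AE_I2 mult_mono) (auto simp: indicator_def)
    qed measurable
    have i2: "integrable M (\<lambda>\<omega>. ?I \<omega> * (exp (- \<beta> * T) * w (X x T \<omega>)))"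
    proof (rule integrable_const_bound[where B = "1 * (1 * a)"])
      show "AE \<omega> in M. norm (?I \<omega> * (exp (- \<beta> * T) * w (X x T \<omega>))) \<le> 1 * (1 * a)"
      proof (rule AE_I2)
        fix \<omega>
        have "\<bar>exp (- \<beta> * T)\<bar> * \<bar>w (X x T \<omega>)\<bar> \<le> 1 * a"
          by (intro mult_mono) (use a T0 \<beta>_pos in auto)
        moreover have "0 \<le> a" using a[of 0] by linarith
        ultimately show "norm (?I \<omega> * (exp (- \<beta> * T) * w (X x T \<omega>))) \<le> 1 * (1 * a)"
          by (simp add: abs_mult indicator_def)
      qed
    qed measurable
    have "(LINT \<omega>|M. ?I \<omega> * residual x T \<omega>)
        = (LINT \<omega>|M. ?I \<omega> * tail \<phi> x T \<omega>) - (LINT \<omega>|M. ?I \<omega> * (exp (- \<beta> * T) * w (X x T \<omega>)))"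
      unfolding residual_def right_diff_distrib using i1 i2 by (rule Bochner_Integration.integral_diff)
    also have "\<dots> = 0"
      unfolding markov_tail_grid[OF op_measurable C T zero_less_Suc] resolvent_eq[OF C2] by simp
    finally show ?thesis .
  qed
  from grid_to_above[OF residual_integrable[OF T0] T(1) this]
  show "above x c T' \<in> sets M" "(LINT \<omega>|M. indicator (above x c T') \<omega> * residual x T \<omega>) = 0" .
qed

lemma tail_continuous:
  assumes T: "\<And>n. 0 \<le> T n" "T \<longlonglongrightarrow> t" and \<omega>: "\<omega> \<in> space M"
  shows "(\<lambda>n. tail \<phi> x (T n) \<omega>) \<longlonglongrightarrow> tail \<phi> x t \<omega>"
proof -
  obtain C where C: "\<And>z. \<bar>\<phi> z\<bar> \<le> C" using op_bounded[OF C2] by blast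
  have [measurable]: "(\<lambda>s. X x (t + s) \<omega>) \<in> borel_measurable borel" for t
    using \<omega> by measurable
  show ?thesis
    unfolding tail_def
  proof (rule integral_dominated_convergence[where w = "\<lambda>s. C * (indicator {0<..} s * exp (- \<beta> * s))"])
    show "integrable lborel (\<lambda>s. C * (indicator {0<..} s * exp (- \<beta> * s)))"
      using exp_indicator_integrable by simp
    show "AE s in lborel. (\<lambda>n. indicator {0<..} s * exp (- \<beta> * (T n + s)) * \<phi> (X x (T n + s) \<omega>))
         \<longlonglongrightarrow> indicator {0<..} s * exp (- \<beta> * (t + s)) * \<phi> (X x (t + s) \<omega>)"
      by (intro AE_I2 tendsto_intros T continuous_on_tendsto_compose[OF op_continuous[OF C2]] X_tendsto[OF \<omega>]) auto
    show "AE s in lborel. norm (indicator {0<..} s * exp (- \<beta> * (T n + s)) * \<phi> (X x (T n + s) \<omega>))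
         \<le> C * (indicator {0<..} s * exp (- \<beta> * s))" for n
      using tail_dominated[OF op_measurable C T(1)] by (intro AE_I2) simp
  qed measurable
qed

text \<open>At time 0 and level \<open>x - 1\<close> the event \<open>above\<close> is the whole
  space, so the residual, here \<open>tail\<close> minus \<open>w x\<close>, has mean zero.\<close>

lemma tail_0_expectation: "(LINT \<omega>|M. tail \<phi> x 0 \<omega>) = w x"
proof -
  have "(LINT \<omega>|M. residual x 0 \<omega>) = (LINT \<omega>|M. indicator (above x (x - 1) 0) \<omega> * residual x 0 \<omega>)"
    by (intro Bochner_Integration.integral_cong refl) (auto simp: above_def X_0)
  also have "\<dots> = 0" by (rule residual_above) auto
  finally have "(LINT \<omega>|M. residual x 0 \<omega>) = 0" .
  moreover have "(LINT \<omega>|M. tail \<phi> x 0 \<omega>) = (LINT \<omega>|M. residual x 0 \<omega> + w x)"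
    by (intro Bochner_Integration.integral_cong refl) (simp add: residual_def X_0)
  ultimately show ?thesis
    using residual_integrable[of 0 x] prob_space by simp
qed

lemma tail_split:
  assumes \<omega>: "\<omega> \<in> space M" and T: "0 \<le> T"
  shows "(LINT s:{s. 0 \<le> s \<and> s < T}|lborel. exp (- \<beta> * s) * \<phi> (X x s \<omega>)) = tail \<phi> x 0 \<omega> - tail \<phi> x T \<omega>"
    and "(LINT s:{0..}|lborel. exp (- \<beta> * s) * \<phi> (X x s \<omega>)) = tail \<phi> x 0 \<omega>"
proof -
  obtain C where C: "\<And>z. \<bar>\<phi> z\<bar> \<le> C" using op_bounded[OF C2] by blast
  have [measurable]: "(\<lambda>s. X x (t + s) \<omega>) \<in> borel_measurable borel" "(\<lambda>s. X x s \<omega>) \<in> borel_measurable borel" for t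
    using \<omega> by measurable
  let ?f = "\<lambda>s. exp (- \<beta> * s) * \<phi> (X x s \<omega>)"
  have i0: "integrable lborel (\<lambda>s. indicator {0<..} s * ?f s)"
    using tail_integrable[OF op_measurable C order_refl \<omega>, of x] by (simp add: mult.assoc)
  then have iT: "integrable lborel (\<lambda>s. indicator {T<..} s * ?f s)"
  proof (rule Bochner_Integration.integrable_bound)
    show "AE s in lborel. norm (indicator {T<..} s * ?f s) \<le> norm (indicator {0<..} s * ?f s)"
      using T by (intro AE_I2) (auto simp: indicator_def)
  qed measurable
  have t0: "tail \<phi> x 0 \<omega> = (LINT s|lborel. indicator {0<..} s * ?f s)"
    unfolding tail_def by (simp add: mult.assoc)
  have tT: "tail \<phi> x T \<omega> = (LINT s|lborel. indicator {T<..} s * ?f s)"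
  proof -
    have "(LINT s|lborel. indicator {T<..} s * ?f s) = \<bar>1\<bar> *\<^sub>R (LINT s|lborel. indicator {T<..} (T + 1 * s) * ?f (T + 1 * s))"
      by (rule lborel_integral_real_affine) simp
    also have "\<dots> = tail \<phi> x T \<omega>"
      unfolding tail_def by (auto intro!: Bochner_Integration.integral_cong simp: indicator_def)
    finally show ?thesis by simp
  qed
  have "(LINT s:{s. 0 \<le> s \<and> s < T}|lborel. ?f s) = (LINT s|lborel. indicator {0<..} s * ?f s - indicator {T<..} s * ?f s)"
    unfolding set_lebesgue_integral_def
  proof (rule integral_cong_AE)
    show "AE s in lborel. indicator {s. 0 \<le> s \<and> s < T} s *\<^sub>R ?f s = indicator {0<..} s * ?f s - indicator {T<..} s * ?f s"
      using AE_lborel_singleton[of 0] AE_lborel_singleton[of T]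
      by eventually_elim (use T in \<open>auto simp: indicator_def\<close>)
  qed measurable
  also have "\<dots> = tail \<phi> x 0 \<omega> - tail \<phi> x T \<omega>"
    unfolding t0 tT using i0 iT by (rule Bochner_Integration.integral_diff)
  finally show "(LINT s:{s. 0 \<le> s \<and> s < T}|lborel. ?f s) = tail \<phi> x 0 \<omega> - tail \<phi> x T \<omega>" .
  show "(LINT s:{0..}|lborel. ?f s) = tail \<phi> x 0 \<omega>"
    unfolding t0 set_lebesgue_integral_def
  proof (rule integral_cong_AE)
    show "AE s in lborel. indicator {0..} s *\<^sub>R ?f s = indicator {0<..} s * ?f s"
      using AE_lborel_singleton[of 0] by eventually_elim (auto simp: indicator_def)
  qed measurable
qed

theorem discounted_integral: "(LINT \<omega>|M. (LINT s:{0..}|lborel. exp (- \<beta> * s) * \<phi> (X x s \<omega>))) = w x"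
proof -
  have "(LINT \<omega>|M. (LINT s:{0..}|lborel. exp (- \<beta> * s) * \<phi> (X x s \<omega>))) = (LINT \<omega>|M. tail \<phi> x 0 \<omega>)"
    by (intro Bochner_Integration.integral_cong refl tail_split(2)[where T = 0]) auto
  then show ?thesis using tail_0_expectation by simp
qed

text \<open>The hitting time is rounded up to the grid of mesh \<open>1 / (n + 1)\<close>, and the Markov property is
  applied at the grid points.\<close>

theorem discounted_integral_killed:
  assumes c: "c < x" and wc: "w c = 0"
  shows "(LINT \<omega>|M. (LINT s:{s. 0 \<le> s \<and> ereal s < hit x c \<omega>}|lborel. exp (- \<beta> * s) * \<phi> (X x s \<omega>))) = w x"
proof -
  define t where "t n k = real k / real (Suc n)" for n k
  have t_mono: "0 \<le> t n k" "t n k \<le> t n (Suc k)" for n k by (auto simp: t_def divide_right_mono)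
  \<comment> \<open>At most one summand survives, namely the residual at the first grid time not
    before the hit. Both indicators refer to times up to that of the residual, so every summand has
    mean zero. The \<open>(Suc n)\<^sup>2\<close> steps reach time \<open>n + 1\<close>, so the
    horizon grows while the mesh shrinks.\<close>
  define G where "G n \<omega> = (\<Sum>k<(Suc n)\<^sup>2. indicator (above x c (t n k)) \<omega> * residual x (t n (Suc k)) \<omega>
      - indicator (above x c (t n (Suc k))) \<omega> * residual x (t n (Suc k)) \<omega>)" for n \<omega>
  have above_meas [measurable]: "above x c T \<in> sets M" if "0 \<le> T" for T
    by (rule residual_above(1)[OF that order_refl])
  have ir: "integrable M (\<lambda>\<omega>. indicator (above x c (t n k)) \<omega> * residual x (t n j) \<omega>)" for n k j
    using integrable_mult_indicator[OF above_meas residual_integrable, of "t n k" "t n j" x] t_mono by simp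
  have EG: "(LINT \<omega>|M. G n \<omega>) = 0" for n
    unfolding G_def
    by (simp add: Bochner_Integration.integral_sum Bochner_Integration.integral_diff ir residual_above(2) t_mono)
  have [measurable]: "G n \<in> borel_measurable M" for n
    unfolding G_def[abs_def] using t_mono by measurable
  let ?L = "\<lambda>\<omega>. (LINT s:{s. 0 \<le> s \<and> ereal s < hit x c \<omega>}|lborel. exp (- \<beta> * s) * \<phi> (X x s \<omega>))"
  have G_inf: "G n \<omega> = 0" if \<omega>: "\<omega> \<in> space M" and h: "hit x c \<omega> = \<infinity>" for n \<omega>
    unfolding G_def using less_hit_iff[OF \<omega> c t_mono(1)] h by simp
  \<comment> \<open>The ceiling minus one makes the left inequality of
    \<open>t n k < T \<le> t n (Suc k)\<close> strict and the right one weak, matching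
    \<open>less_hit_iff\<close>.\<close>
  define k0 where "k0 n T = nat \<lceil>T * real (Suc n)\<rceil> - 1" for n and T :: real
  have k0: "t n k < T \<and> \<not> t n (Suc k) < T \<longleftrightarrow> k = k0 n T" if "0 < T" for n k T
  proof -
    have "t n k < T \<longleftrightarrow> real k < T * real (Suc n)" "t n (Suc k) < T \<longleftrightarrow> real (Suc k) < T * real (Suc n)"
      by (simp_all add: t_def field_simps)
    moreover have "0 < T * real (Suc n)" using that by simp
    ultimately show ?thesis unfolding k0_def by (auto simp: not_less) linarith+
  qed
  have G_fin: "G n \<omega> = (if k0 n T < (Suc n)\<^sup>2 then residual x (t n (Suc (k0 n T))) \<omega> else 0)"
    if \<omega>: "\<omega> \<in> space M" and h: "hit x c \<omega> = ereal T" for n \<omega> T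
  proof -
    have T: "0 < T" using X_at_hit[OF \<omega> c h] by simp
    have "G n \<omega> = (\<Sum>k<(Suc n)\<^sup>2. if k = k0 n T then residual x (t n (Suc k)) \<omega> else 0)"
      unfolding G_def
    proof (intro sum.cong refl)
      fix k
      have "\<omega> \<in> above x c (t n k) \<longleftrightarrow> t n k < T" for k
        using less_hit_iff[OF \<omega> c t_mono(1), of n k] h by simp
      moreover have "t n (Suc k) < T \<Longrightarrow> t n k < T" using t_mono(2)[of n k] by linarith
      ultimately show "indicator (above x c (t n k)) \<omega> * residual x (t n (Suc k)) \<omega>
          - indicator (above x c (t n (Suc k))) \<omega> * residual x (t n (Suc k)) \<omega>
          = (if k = k0 n T then residual x (t n (Suc k)) \<omega> else 0)"
        using k0[OF T, of n k] by (auto simp: indicator_def)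
    qed
    then show ?thesis by (simp add: sum.delta')
  qed
  \<comment> \<open>The limit is the tail from the hitting time on: \<open>w c = 0\<close> removes
    the other term of the residual there. If the level is never hit, both sides vanish.\<close>
  have lim: "(\<lambda>n. G n \<omega>) \<longlonglongrightarrow> tail \<phi> x 0 \<omega> - ?L \<omega>" if \<omega>: "\<omega> \<in> space M" for \<omega>
  proof (cases "hit x c \<omega>")
    case PInf
    then have "{s. 0 \<le> s \<and> ereal s < hit x c \<omega>} = {0..}" by auto
    then show ?thesis using G_inf[OF \<omega> PInf] tail_split(2)[OF \<omega>, of 0 x] by simp
  next
    case MInf
    have "ereal 0 \<le> hit x c \<omega>" unfolding hit_def by (auto intro!: Inf_greatest)
    then show ?thesis using MInf by simp
  next
    case (real T)
    then have h: "hit x c \<omega> = ereal T" .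
    note T = X_at_hit[OF \<omega> c h]
    have near: "T \<le> t n (Suc (k0 n T))" "t n (Suc (k0 n T)) \<le> T + 1 / real (Suc n)" for n
    proof -
      have "t n (k0 n T) < T \<and> \<not> t n (Suc (k0 n T)) < T" using k0[OF T(1)] by blast
      moreover have "t n (Suc k) = t n k + 1 / real (Suc n)" for k by (simp add: t_def add_divide_distrib)
      ultimately show "T \<le> t n (Suc (k0 n T))" "t n (Suc (k0 n T)) \<le> T + 1 / real (Suc n)" by auto
    qed
    have tl: "(\<lambda>n. t n (Suc (k0 n T))) \<longlonglongrightarrow> T"
    proof (rule tendsto_sandwich[where f = "\<lambda>_. T" and h = "\<lambda>n. T + 1 / real (Suc n)"])
      show "(\<lambda>n. T + 1 / real (Suc n)) \<longlonglongrightarrow> T"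
        using tendsto_add[OF tendsto_const LIMSEQ_inverse_real_of_nat, of T] by (simp add: inverse_eq_divide)
      show "(\<lambda>n. T) \<longlonglongrightarrow> T" by simp
      show "\<forall>\<^sub>F n in sequentially. T \<le> t n (Suc (k0 n T))" using near by simp
      show "\<forall>\<^sub>F n in sequentially. t n (Suc (k0 n T)) \<le> T + 1 / real (Suc n)"
        using near(2) by (intro always_eventually allI)
    qed
    have "(\<lambda>n. residual x (t n (Suc (k0 n T))) \<omega>) \<longlonglongrightarrow> tail \<phi> x T \<omega> - exp (- \<beta> * T) * w (X x T \<omega>)"
      unfolding residual_def
      by (intro tendsto_intros tail_continuous continuous_on_tendsto_compose[OF w_continuous] X_tendsto[OF \<omega>] tl t_mono \<omega>) auto
    then have r: "(\<lambda>n. residual x (t n (Suc (k0 n T))) \<omega>) \<longlonglongrightarrow> tail \<phi> x T \<omega>" by (simp add: T wc)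
    obtain K where K: "T \<le> real K" using real_arch_simple by blast
    have "k0 n T < (Suc n)\<^sup>2" if "n \<ge> K" for n
    proof -
      have "t n (k0 n T) < T" using k0[OF T(1)] by blast
      also have "T \<le> real (Suc n)" using K that by linarith
      finally have "real (k0 n T) < real (Suc n) * real (Suc n)" by (simp add: t_def field_simps)
      then have "k0 n T < Suc n * Suc n" by (metis of_nat_less_iff of_nat_mult)
      then show ?thesis by (simp add: power2_eq_square)
    qed
    then have "\<forall>\<^sub>F n in sequentially. G n \<omega> = residual x (t n (Suc (k0 n T))) \<omega>"
      using G_fin[OF \<omega> h] by (auto simp: eventually_sequentially)
    then have "(\<lambda>n. G n \<omega>) \<longlonglongrightarrow> tail \<phi> x T \<omega>" using r by (simp add: tendsto_cong)
    moreover have "{s. 0 \<le> s \<and> ereal s < hit x c \<omega>} = {s. 0 \<le> s \<and> s < T}" using h by simp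
    ultimately show ?thesis using tail_split(1)[OF \<omega>, of T x] T by simp
  qed
  obtain K where K: "\<And>x T \<omega>. 0 \<le> T \<Longrightarrow> \<omega> \<in> space M \<Longrightarrow> \<bar>residual x T \<omega>\<bar> \<le> K"
    using residual_bounded by blast
  have bd: "\<bar>G n \<omega>\<bar> \<le> K" if \<omega>: "\<omega> \<in> space M" for n \<omega>
  proof -
    have "0 \<le> K" using K[OF order_refl \<omega>, of x] by linarith
    moreover have "hit x c \<omega> \<noteq> - \<infinity>"
    proof -
      have "ereal 0 \<le> hit x c \<omega>" unfolding hit_def by (auto intro!: Inf_greatest)
      then show ?thesis by auto
    qed
    ultimately show ?thesis
      using G_inf[OF \<omega>] G_fin[OF \<omega>] K[OF t_mono(1) \<omega>] by (cases "hit x c \<omega>") auto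
  qed
  have m: "(\<lambda>\<omega>. tail \<phi> x 0 \<omega> - ?L \<omega>) \<in> borel_measurable M"
    by (rule borel_measurable_LIMSEQ_real[OF lim]) auto
  have "(\<lambda>n. LINT \<omega>|M. G n \<omega>) \<longlonglongrightarrow> (LINT \<omega>|M. tail \<phi> x 0 \<omega> - ?L \<omega>)"
    by (rule integral_dominated_convergence[where w = "\<lambda>_. K"]) (use m lim bd in auto)
  then have z: "(LINT \<omega>|M. tail \<phi> x 0 \<omega> - ?L \<omega>) = 0" unfolding EG by (simp add: LIMSEQ_const_iff)
  have i: "integrable M (\<lambda>\<omega>. tail \<phi> x 0 \<omega> - ?L \<omega>)"
  proof (rule integrable_const_bound[where B = K])
    show "AE \<omega> in M. norm (tail \<phi> x 0 \<omega> - ?L \<omega>) \<le> K"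
    proof (rule AE_I2)
      fix \<omega> assume \<omega>: "\<omega> \<in> space M"
      show "norm (tail \<phi> x 0 \<omega> - ?L \<omega>) \<le> K"
        by (rule LIMSEQ_le_const2[OF tendsto_norm[OF lim[OF \<omega>]]]) (use bd[OF \<omega>] in auto)
    qed
  qed (rule m)
  obtain C where C: "\<And>z. \<bar>\<phi> z\<bar> \<le> C" using op_bounded[OF C2] by blast
  have i0: "integrable M (\<lambda>\<omega>. tail \<phi> x 0 \<omega>)"
    by (rule integrable_const_bound[where B = "C / \<beta>"]) (use tail_bounded[OF op_measurable C] in auto)
  \<comment> \<open>The killed integral is recovered as a difference, since integrability is known
    for \<open>tail \<phi> x 0\<close> and for the limit of the \<open>G n\<close>.\<close>
  have "(LINT \<omega>|M. ?L \<omega>) = (LINT \<omega>|M. tail \<phi> x 0 \<omega> - (tail \<phi> x 0 \<omega> - ?L \<omega>))" by simp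
  also have "\<dots> = (LINT \<omega>|M. tail \<phi> x 0 \<omega>) - (LINT \<omega>|M. tail \<phi> x 0 \<omega> - ?L \<omega>)"
    by (rule Bochner_Integration.integral_diff[OF i0 i])
  finally show ?thesis using z tail_0_expectation by simp
qed

end
end

section \<open>The normalised dual value\<close>

lemma glue_deriv:
  fixes f g :: "real \<Rightarrow> real"
  assumes f: "\<And>x. (f has_real_derivative f' x) (at x)" and g: "\<And>x. (g has_real_derivative g' x) (at x)"
    and c: "f c = g c" "f' c = g' c"
  shows "((\<lambda>x. if x < c then f x else g x) has_real_derivative (if x < c then f' x else g' x)) (at x)"
proof -
  let ?h = "\<lambda>x. if x < c then f x else g x"
  consider "x < c" | "c < x" | "x = c" by linarith
  then show ?thesis
  proof cases
    case 1
    have "(?h has_real_derivative f' x) (at x)"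
      by (rule has_field_derivative_transform_within_open[OF f, of "{..<c}"]) (use 1 in auto)
    then show ?thesis using 1 by simp
  next
    case 2
    have "(?h has_real_derivative g' x) (at x)"
      by (rule has_field_derivative_transform_within_open[OF g, of "{c<..}"]) (use 2 in auto)
    then show ?thesis using 2 by simp
  next
    case 3
    have fl: "((\<lambda>y. (f y - f c) / (y - c)) \<longlongrightarrow> g' c) (at c)" "((\<lambda>y. (g y - g c) / (y - c)) \<longlongrightarrow> g' c) (at c)"
      using f[of c] g[of c] by (simp_all add: has_field_derivative_iff c)
    have "((\<lambda>y. (?h y - ?h c) / (y - c)) \<longlongrightarrow> g' c) (at c)"
    proof (rule filterlim_split_at_real)
      have "\<forall>\<^sub>F y in at_left c. (f y - f c) / (y - c) = (?h y - ?h c) / (y - c)"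
        unfolding eventually_at_filter by (auto simp: c)
      moreover have "((\<lambda>y. (f y - f c) / (y - c)) \<longlongrightarrow> g' c) (at_left c)"
        using fl(1) by (simp add: filterlim_at_split)
      ultimately show "((\<lambda>y. (?h y - ?h c) / (y - c)) \<longlongrightarrow> g' c) (at_left c)"
        by (rule Lim_transform_eventually[rotated])
      have "\<forall>\<^sub>F y in at_right c. (g y - g c) / (y - c) = (?h y - ?h c) / (y - c)"
        unfolding eventually_at_filter by (auto simp: c)
      moreover have "((\<lambda>y. (g y - g c) / (y - c)) \<longlongrightarrow> g' c) (at_right c)"
        using fl(2) by (simp add: filterlim_at_split)
      ultimately show "((\<lambda>y. (?h y - ?h c) / (y - c)) \<longlongrightarrow> g' c) (at_right c)"
        by (rule Lim_transform_eventually[rotated])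
    qed
    then show ?thesis using 3 by (simp add: has_field_derivative_iff c)
  qed
qed

lemma glue_continuous:
  fixes f g :: "real \<Rightarrow> real"
  assumes "continuous_on UNIV f" "continuous_on UNIV g" "f c = g c"
  shows "continuous_on UNIV (\<lambda>x. if x < c then f x else g x)"
proof -
  have "continuous_on ({..c} \<union> {c..}) (\<lambda>x. if x < c then f x else g x)"
    by (rule continuous_on_cases)
       (use assms in \<open>auto intro: continuous_on_subset simp: not_less dest!: order.antisym\<close>)
  also have "{..c} \<union> {c..} = UNIV" by auto
  finally show ?thesis .
qed

lemma C2_bounded_glue:
  assumes f: "\<And>x. (f has_real_derivative f1 x) (at x)" "\<And>x. (f1 has_real_derivative f2 x) (at x)"
      "continuous_on UNIV f2"
    and g: "\<And>x. (g has_real_derivative g1 x) (at x)" "\<And>x. (g1 has_real_derivative g2 x) (at x)"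
      "continuous_on UNIV g2"
    and eq: "f c = g c" "f1 c = g1 c" "f2 c = g2 c"
    and bd: "\<And>x. x < c \<Longrightarrow> \<bar>f x\<bar> \<le> K \<and> \<bar>f1 x\<bar> \<le> K \<and> \<bar>f2 x\<bar> \<le> K"
       "\<And>x. c \<le> x \<Longrightarrow> \<bar>g x\<bar> \<le> K \<and> \<bar>g1 x\<bar> \<le> K \<and> \<bar>g2 x\<bar> \<le> K"
  shows "C2_bounded (\<lambda>x. if x < c then f x else g x) (\<lambda>x. if x < c then f1 x else g1 x)
           (\<lambda>x. if x < c then f2 x else g2 x)"
  unfolding C2_bounded_def
proof (intro conjI allI)
  show "bounded (range (\<lambda>x. if x < c then f x else g x))" "bounded (range (\<lambda>x. if x < c then f1 x else g1 x))"
    "bounded (range (\<lambda>x. if x < c then f2 x else g2 x))"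
    unfolding bounded_iff using bd by (auto intro!: exI[of _ K])
qed (intro glue_deriv glue_continuous f g eq)+

lemma C2_bounded_lincomb:
  assumes v: "C2_bounded v v1 v2" and w: "C2_bounded w w1 w2"
  shows "C2_bounded (\<lambda>x. v x - a * w x) (\<lambda>x. v1 x - a * w1 x) (\<lambda>x. v2 x - a * w2 x)"
proof -
  have "bounded (range (\<lambda>x. f x - a * g x))" if bf: "bounded (range f)" and bg: "bounded (range g)" for f g :: "real \<Rightarrow> real"
  proof -
    obtain p where "\<And>x. \<bar>f x\<bar> \<le> p" using bf unfolding bounded_iff by (auto simp: image_iff)
    moreover obtain q where "\<And>x. \<bar>g x\<bar> \<le> q" using bg unfolding bounded_iff by (auto simp: image_iff)
    ultimately have "\<bar>f x - a * g x\<bar> \<le> p + \<bar>a\<bar> * q" for x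
      by (intro order_trans[OF abs_triangle_ineq4] add_mono) (auto simp: abs_mult intro: mult_left_mono)
    then show ?thesis unfolding bounded_iff by auto
  qed
  moreover have "((\<lambda>x. f x - a * g x) has_real_derivative f' x - a * g' x) (at x)"
    if "\<And>x. (f has_real_derivative f' x) (at x)" "\<And>x. (g has_real_derivative g' x) (at x)"
    for f g f' g' :: "real \<Rightarrow> real" and x
    by (intro DERIV_diff DERIV_cmult that)
  moreover have "continuous_on UNIV (\<lambda>x. v2 x - a * w2 x)"
    using v w by (intro continuous_intros) (auto simp: C2_bounded_def)
  ultimately show ?thesis
    using v w unfolding C2_bounded_def by blast
qed

text \<open>For \<open>z > 0\<close> this is the supremum over \<open>c \<ge> 0\<close> of
  \<open>- exp (- c) - c * z\<close>. The optimum is \<open>c = - ln z\<close> for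
  \<open>z < 1\<close> and the corner \<open>c = 0\<close> otherwise.\<close>

definition unit_util :: "real \<Rightarrow> real" where
  "unit_util z = (if z < 1 then z * (ln z - 1) else - 1)"

locale dual_model = discounted_gaussian \<beta> \<nu> \<theta> for \<beta> \<nu> \<theta> :: real +
  fixes r :: real
  assumes r_pos: "0 < r" and \<nu>_eq: "\<nu> = \<beta> - r - \<theta>\<^sup>2 / 2"
begin

lemma m_sum_prod: "\<theta>\<^sup>2 * (m_pos + m_neg) = - 2 * \<nu>" "\<theta>\<^sup>2 * (m_pos * m_neg) = - 2 * \<beta>"
proof -
  have 1: "\<theta>\<^sup>2 * m_pos = - \<nu> + \<delta>" "\<theta>\<^sup>2 * m_neg = - \<nu> - \<delta>"
    using \<theta>_pos by (simp_all add: m_pos_def m_neg_def)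
  then show "\<theta>\<^sup>2 * (m_pos + m_neg) = - 2 * \<nu>" by (simp add: distrib_left)
  have "\<theta>\<^sup>2 * (\<theta>\<^sup>2 * (m_pos * m_neg)) = (- \<nu> + \<delta>) * (- \<nu> - \<delta>)"
    unfolding 1[symmetric] by simp
  also have "\<dots> = \<theta>\<^sup>2 * (- 2 * \<beta>)" using \<delta>_sq by (simp add: algebra_simps power2_eq_square)
  finally show "\<theta>\<^sup>2 * (m_pos * m_neg) = - 2 * \<beta>"
    using \<theta>_pos by (subst (asm) mult_left_cancel) auto
qed

text \<open>The value of the characteristic polynomial at 1 is \<open>- 2 * r\<close>, which puts 1
  strictly between the roots.\<close>

lemma r_eq: "\<theta>\<^sup>2 * ((m_pos - 1) * (1 - m_neg)) = 2 * r"
proof -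
  have "\<theta>\<^sup>2 * ((m_pos - 1) * (1 - m_neg)) = \<theta>\<^sup>2 * (m_pos + m_neg) - \<theta>\<^sup>2 * (m_pos * m_neg) - \<theta>\<^sup>2"
    by (simp add: algebra_simps)
  then show ?thesis unfolding m_sum_prod using \<nu>_eq by linarith
qed

lemma m_pos_gt_1: "1 < m_pos"
proof -
  have "0 < \<theta>\<^sup>2 * ((m_pos - 1) * (1 - m_neg))" unfolding r_eq using r_pos by simp
  then have "0 < (m_pos - 1) * (1 - m_neg)" using \<theta>_pos by (simp add: zero_less_mult_iff)
  then show ?thesis using m_neg_neg by (simp add: zero_less_mult_iff)
qed

text \<open>The constant for which \<open>exp x / r * (x - 1 + \<kappa>)\<close> is a particular
  solution on \<open>x < 0\<close>; \<open>\<kappa>_eq\<close> is that condition. Its expression in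
  the roots makes the pasting identities rational in \<open>m_pos\<close> and
  \<open>m_neg\<close>.\<close>

definition \<kappa> :: real where "\<kappa> = 1 / (m_pos - 1) - 1 / (1 - m_neg)"

lemma \<kappa>_eq: "r * \<kappa> = \<beta> + \<theta>\<^sup>2 / 2 - r"
proof -
  have "2 * (r * \<kappa>) = \<theta>\<^sup>2 * ((m_pos - 1) * (1 - m_neg)) * \<kappa>" unfolding r_eq by simp
  also have "\<dots> = \<theta>\<^sup>2 * ((1 - m_neg) - (m_pos - 1))"
  proof -
    have "(m_pos - 1) * (1 - m_neg) * \<kappa> = (1 - m_neg) - (m_pos - 1)"
      using m_pos_gt_1 m_neg_neg unfolding \<kappa>_def by (simp add: divide_simps)
    then show ?thesis by (simp add: mult.assoc)
  qed
  also have "\<dots> = 2 * \<theta>\<^sup>2 - \<theta>\<^sup>2 * (m_pos + m_neg)" by (simp add: algebra_simps)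
  finally show ?thesis unfolding m_sum_prod using \<nu>_eq by linarith
qed

text \<open>Obtained by solving the linear system \<open>match1\<close>, \<open>match2\<close>.
  Boundedness selects the homogeneous solution \<open>exp (m_pos * x)\<close> on the left and
  \<open>exp (m_neg * x)\<close> on the right.\<close>

definition dl :: real where "dl = - (1 - m_neg) / (r * (m_pos - m_neg) * (m_pos - 1))"
definition dr :: real where "dr = - (m_pos - 1) / (r * (m_pos - m_neg) * (1 - m_neg))"

lemma dl_neg: "dl < 0" and dr_neg: "dr < 0"
  using m_pos_gt_1 m_neg_neg r_pos unfolding dl_def dr_def
  by (auto intro!: divide_neg_pos mult_pos_pos)

lemma match1: "\<kappa> / r + dl = dr"
  using m_pos_gt_1 m_neg_neg r_pos unfolding dl_def dr_def \<kappa>_def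
  by (simp add: divide_simps) (simp add: algebra_simps power2_eq_square)

lemma match2: "1 / r + dl * (m_pos - 1) = dr * (m_neg - 1)"
  using m_pos_gt_1 m_neg_neg r_pos unfolding dl_def dr_def
  by (simp add: divide_simps) (simp add: algebra_simps power2_eq_square)

text \<open>This third pasting condition is a consequence of the other two: both branches solve the
  same equation with value \<open>- 1\<close> on the right-hand side at 0, which determines the
  function from its first two derivatives.\<close>

lemma match0: "(\<kappa> - 1) / r + dl / m_pos = - 1 / \<beta> + dr / m_neg"
proof -
  have root: "\<nu> + \<theta>\<^sup>2 / 2 * m_pos = \<beta> / m_pos" "\<nu> + \<theta>\<^sup>2 / 2 * m_neg = \<beta> / m_neg"
    using m_root m_pos_pos m_neg_neg by (simp_all add: field_simps power2_eq_square)
  have "\<beta> * (- 1 / \<beta> + dr / m_neg) = - 1 + dr * (\<beta> / m_neg)" using \<beta>_pos by (simp add: field_simps)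
  also have "\<dots> = - 1 + (\<nu> + \<theta>\<^sup>2 / 2) * dr + \<theta>\<^sup>2 / 2 * (dr * (m_neg - 1))"
    unfolding root(2)[symmetric] by (simp add: algebra_simps)
  also have "\<dots> = - 1 + (\<nu> + \<theta>\<^sup>2 / 2) * (\<kappa> / r) + \<theta>\<^sup>2 / 2 / r + dl * (\<nu> + \<theta>\<^sup>2 / 2 * m_pos)"
    unfolding match2[symmetric] unfolding match1[symmetric] by (simp add: algebra_simps)
  also have "\<dots> = - 1 + (\<beta> - r) * (\<kappa> / r) + \<theta>\<^sup>2 / 2 / r + dl * (\<beta> / m_pos)"
  proof -
    have "\<nu> + \<theta>\<^sup>2 / 2 = \<beta> - r" using \<nu>_eq by simp
    then show ?thesis unfolding root(1) by simp
  qed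
  also have "(\<beta> - r) * (\<kappa> / r) = \<beta> * \<kappa> / r - \<kappa>" using r_pos by (simp add: field_simps)
  also have "- 1 + (\<beta> * \<kappa> / r - \<kappa>) + \<theta>\<^sup>2 / 2 / r = \<beta> * (\<kappa> - 1) / r"
    using \<kappa>_eq r_pos by (simp add: field_simps)
  finally have "\<beta> * (- 1 / \<beta> + dr / m_neg) = \<beta> * ((\<kappa> - 1) / r + dl / m_pos)"
    by (simp add: algebra_simps)
  then show ?thesis using \<beta>_pos by simp
qed

text \<open>\<open>G\<close> is the dual value of consuming for ever, for the normalised utility \<^const>\<open>unit_util\<close>, as a
  function of the logarithm of the dual variable. It solves \<open>\<beta> G - \<nu> G' - \<theta>\<^sup>2 / 2 G'' = unit_util \<circ> exp\<close>,
  and the coefficients \<open>dl\<close>, \<open>dr\<close> make the two branches agree to second order at 0.\<close>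

definition G :: "real \<Rightarrow> real" where
  "G x = (if x < 0 then exp x / r * (x - 1 + \<kappa>) + dl / m_pos * exp (m_pos * x)
          else - 1 / \<beta> + dr / m_neg * exp (m_neg * x))"
definition G1 :: "real \<Rightarrow> real" where
  "G1 x = (if x < 0 then exp x / r * (x + \<kappa>) + dl * exp (m_pos * x) else dr * exp (m_neg * x))"
definition G2 :: "real \<Rightarrow> real" where
  "G2 x = (if x < 0 then exp x / r * (x + \<kappa> + 1) + dl * m_pos * exp (m_pos * x)
           else dr * m_neg * exp (m_neg * x))"

lemma C2_bounded_G: "C2_bounded G G1 G2"
proof -
  have b1: "exp x * \<bar>x + a\<bar> \<le> 1 + \<bar>a\<bar>" if "x < 0" for x a :: real
  proof -
    have "exp x * (- x) \<le> 1"
    proof -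
      have "- x \<le> exp (- x)" using exp_ge_add_one_self[of "- x"] by linarith
      then have "exp x * (- x) \<le> exp x * exp (- x)" by (intro mult_left_mono) auto
      then show ?thesis by (simp add: mult_exp_exp)
    qed
    moreover have "exp x * \<bar>a\<bar> \<le> 1 * \<bar>a\<bar>" using that by (intro mult_right_mono) auto
    moreover have "exp x * \<bar>x + a\<bar> \<le> exp x * (- x) + exp x * \<bar>a\<bar>"
      unfolding distrib_left[symmetric] using that by (intro mult_left_mono) auto
    ultimately show ?thesis by linarith
  qed
  have b2: "\<bar>exp x / r * (x + a) + b * exp (m_pos * x)\<bar> \<le> (1 + \<bar>a\<bar>) / r + \<bar>b\<bar>" if "x < 0" for x a b
  proof -
    have "\<bar>exp x / r * (x + a)\<bar> = exp x * \<bar>x + a\<bar> / r" using r_pos by (simp add: abs_mult)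
    also have "\<dots> \<le> (1 + \<bar>a\<bar>) / r" using b1[OF that] r_pos by (intro divide_right_mono) auto
    finally have "\<bar>exp x / r * (x + a)\<bar> \<le> (1 + \<bar>a\<bar>) / r" .
    moreover have "\<bar>b * exp (m_pos * x)\<bar> \<le> \<bar>b\<bar> * 1"
      unfolding abs_mult using that m_pos_pos by (intro mult_left_mono) (auto simp: mult_pos_neg less_imp_le)
    ultimately show ?thesis by linarith
  qed
  have b3: "\<bar>b * exp (m_neg * x)\<bar> \<le> \<bar>b\<bar>" if "0 \<le> x" for x b
  proof -
    have "\<bar>b * exp (m_neg * x)\<bar> \<le> \<bar>b\<bar> * 1"
      unfolding abs_mult using that m_neg_neg by (intro mult_left_mono) (auto simp: mult_nonpos_nonneg)
    then show ?thesis by simp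
  qed
  define k1 where "k1 = (1 + \<bar>\<kappa> - 1\<bar>) / r + \<bar>dl / m_pos\<bar>"
  define k2 where "k2 = (1 + \<bar>\<kappa>\<bar>) / r + \<bar>dl\<bar>"
  define k3 where "k3 = (1 + \<bar>\<kappa> + 1\<bar>) / r + \<bar>dl * m_pos\<bar>"
  define k4 where "k4 = 1 / \<beta> + \<bar>dr / m_neg\<bar>"
  define K where "K = Max {k1, k2, k3, k4, \<bar>dr\<bar>, \<bar>dr * m_neg\<bar>}"
  have K: "k \<le> K" if "k \<in> {k1, k2, k3, k4, \<bar>dr\<bar>, \<bar>dr * m_neg\<bar>}" for k
    unfolding K_def using that by (intro Max_ge) auto
  show ?thesis
    unfolding G_def[abs_def] G1_def[abs_def] G2_def[abs_def]
  proof (rule C2_bounded_glue)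
    fix x :: real assume x: "x < 0"
    have "\<bar>exp x / r * (x - 1 + \<kappa>) + dl / m_pos * exp (m_pos * x)\<bar> \<le> k1"
      using b2[OF x, of "\<kappa> - 1" "dl / m_pos"] by (simp add: k1_def add_diff_eq diff_add_eq)
    moreover have "\<bar>exp x / r * (x + \<kappa>) + dl * exp (m_pos * x)\<bar> \<le> k2"
      unfolding k2_def by (rule b2[OF x])
    moreover have "\<bar>exp x / r * (x + \<kappa> + 1) + dl * m_pos * exp (m_pos * x)\<bar> \<le> k3"
      using b2[OF x, of "\<kappa> + 1" "dl * m_pos"] by (simp add: k3_def add.assoc)
    ultimately show "\<bar>exp x / r * (x - 1 + \<kappa>) + dl / m_pos * exp (m_pos * x)\<bar> \<le> K \<and>
        \<bar>exp x / r * (x + \<kappa>) + dl * exp (m_pos * x)\<bar> \<le> K \<and>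
        \<bar>exp x / r * (x + \<kappa> + 1) + dl * m_pos * exp (m_pos * x)\<bar> \<le> K"
      using K by (blast intro: order_trans)
  next
    fix x :: real assume x: "0 \<le> x"
    have "\<bar>- 1 / \<beta> + dr / m_neg * exp (m_neg * x)\<bar> \<le> k4"
      unfolding k4_def using b3[OF x, of "dr / m_neg"] \<beta>_pos
      by (intro order_trans[OF abs_triangle_ineq] add_mono) auto
    then show "\<bar>- 1 / \<beta> + dr / m_neg * exp (m_neg * x)\<bar> \<le> K \<and> \<bar>dr * exp (m_neg * x)\<bar> \<le> K \<and>
        \<bar>dr * m_neg * exp (m_neg * x)\<bar> \<le> K"
      using K b3[OF x, of dr] b3[OF x, of "dr * m_neg"] by (blast intro: order_trans)
  next
    show "exp 0 / r * (0 - 1 + \<kappa>) + dl / m_pos * exp (m_pos * 0) = - 1 / \<beta> + dr / m_neg * exp (m_neg * 0)"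
      using match0 by (simp add: field_simps)
    show "exp 0 / r * (0 + \<kappa>) + dl * exp (m_pos * 0) = dr * exp (m_neg * 0)"
      using match1 by simp
    have "(\<kappa> + 1) / r + dl * m_pos = (\<kappa> / r + dl) + (1 / r + dl * (m_pos - 1))"
      by (simp add: add_divide_distrib algebra_simps)
    then show "exp 0 / r * (0 + \<kappa> + 1) + dl * m_pos * exp (m_pos * 0) = dr * m_neg * exp (m_neg * 0)"
      unfolding match1 match2 by (simp add: algebra_simps add_divide_distrib)
  next
    fix x :: real
    show "((\<lambda>x. exp x / r * (x - 1 + \<kappa>) + dl / m_pos * exp (m_pos * x)) has_real_derivative
        exp x / r * (x + \<kappa>) + dl * exp (m_pos * x)) (at x)"
      using r_pos m_pos_pos by (auto intro!: derivative_eq_intros simp: field_simps)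
    show "((\<lambda>x. exp x / r * (x + \<kappa>) + dl * exp (m_pos * x)) has_real_derivative
        exp x / r * (x + \<kappa> + 1) + dl * m_pos * exp (m_pos * x)) (at x)"
      using r_pos m_pos_pos by (auto intro!: derivative_eq_intros simp: field_simps)
    show "((\<lambda>x. - 1 / \<beta> + dr / m_neg * exp (m_neg * x)) has_real_derivative dr * exp (m_neg * x)) (at x)"
      using m_neg_neg by (auto intro!: derivative_eq_intros)
    show "((\<lambda>x. dr * exp (m_neg * x)) has_real_derivative dr * m_neg * exp (m_neg * x)) (at x)"
      by (auto intro!: derivative_eq_intros)
  qed (use r_pos in \<open>auto intro!: continuous_intros\<close>)
qed

lemma op_G: "op G G1 G2 x = unit_util (exp x)"
proof -
  have root: "\<beta> / m_pos - \<nu> - \<theta>\<^sup>2 / 2 * m_pos = 0" "\<beta> / m_neg - \<nu> - \<theta>\<^sup>2 / 2 * m_neg = 0"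
    using m_root m_pos_pos m_neg_neg by (simp_all add: field_simps power2_eq_square)
  show ?thesis
  proof (cases "x < 0")
    case True
    have "op G G1 G2 x = exp x / r * (\<beta> * (x - 1 + \<kappa>) - \<nu> * (x + \<kappa>) - \<theta>\<^sup>2 / 2 * (x + \<kappa> + 1))
        + (\<beta> / m_pos - \<nu> - \<theta>\<^sup>2 / 2 * m_pos) * (dl * exp (m_pos * x))"
      using True unfolding op_def G_def G1_def G2_def by (simp add: algebra_simps)
    also have "\<beta> * (x - 1 + \<kappa>) - \<nu> * (x + \<kappa>) - \<theta>\<^sup>2 / 2 * (x + \<kappa> + 1) = r * x + r * \<kappa> - \<beta> - \<theta>\<^sup>2 / 2"
    proof -
      have "\<nu> * (x + \<kappa>) = (\<beta> - r - \<theta>\<^sup>2 / 2) * (x + \<kappa>)" using \<nu>_eq by simp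
      then show ?thesis by (simp add: algebra_simps add_divide_distrib)
    qed
    also have "\<dots> = r * (x - 1)" unfolding \<kappa>_eq by (simp add: algebra_simps)
    finally show ?thesis using True r_pos unfolding root by (simp add: unit_util_def)
  next
    case False
    have "op G G1 G2 x = - 1 + (\<beta> / m_neg - \<nu> - \<theta>\<^sup>2 / 2 * m_neg) * (dr * exp (m_neg * x))"
      using False \<beta>_pos unfolding op_def G_def G1_def G2_def by (simp add: algebra_simps)
    then show ?thesis using False unfolding root by (simp add: unit_util_def)
  qed
qed

text \<open>\<open>exp (m_neg * t)\<close> for \<open>t \<ge> 0\<close>, continued to negative \<open>t\<close> by a bounded function
  with the same second-order jet at 0.\<close>

definition E :: "real \<Rightarrow> real" where
  "E t = (if t < 0 then 1 + m_neg * sin t + m_neg\<^sup>2 * (1 - cos t) else exp (m_neg * t))"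
definition E1 :: "real \<Rightarrow> real" where
  "E1 t = (if t < 0 then m_neg * cos t + m_neg\<^sup>2 * sin t else m_neg * exp (m_neg * t))"
definition E2 :: "real \<Rightarrow> real" where
  "E2 t = (if t < 0 then - m_neg * sin t + m_neg\<^sup>2 * cos t else m_neg\<^sup>2 * exp (m_neg * t))"

lemma C2_bounded_E: "C2_bounded E E1 E2"
proof -
  define K where "K = 1 + \<bar>m_neg\<bar> + 2 * m_neg\<^sup>2"
  have s: "\<bar>m_neg * sin t\<bar> \<le> \<bar>m_neg\<bar>" "\<bar>m_neg * cos t\<bar> \<le> \<bar>m_neg\<bar>" "\<bar>m_neg\<^sup>2 * sin t\<bar> \<le> m_neg\<^sup>2" "\<bar>m_neg\<^sup>2 * cos t\<bar> \<le> m_neg\<^sup>2" for t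
    using mult_left_mono[OF abs_sin_le_one[of t], of "\<bar>m_neg\<bar>"] mult_left_mono[OF abs_cos_le_one[of t], of "\<bar>m_neg\<bar>"]
      mult_left_mono[OF abs_sin_le_one[of t], of "m_neg\<^sup>2"] mult_left_mono[OF abs_cos_le_one[of t], of "m_neg\<^sup>2"]
    by (simp_all add: abs_mult)
  have e: "0 \<le> exp (m_neg * t)" "exp (m_neg * t) \<le> 1" if "0 \<le> t" for t
    using that m_neg_neg by (auto simp: mult_nonpos_nonneg)
  show ?thesis
    unfolding E_def[abs_def] E1_def[abs_def] E2_def[abs_def]
  proof (rule C2_bounded_glue)
    fix t :: real assume t: "t < 0"
    have e: "1 + m_neg * sin t + m_neg\<^sup>2 * (1 - cos t) = 1 + m_neg * sin t + (m_neg\<^sup>2 - m_neg\<^sup>2 * cos t)"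
      by (simp add: algebra_simps)
    have "\<bar>1 + m_neg * sin t + m_neg\<^sup>2 * (1 - cos t)\<bar> \<le> 1 + \<bar>m_neg\<bar> + (m_neg\<^sup>2 + m_neg\<^sup>2)"
      unfolding e
      by (intro order_trans[OF abs_triangle_ineq] order_trans[OF abs_triangle_ineq4] add_mono s) auto
    moreover have "\<bar>m_neg * cos t + m_neg\<^sup>2 * sin t\<bar> \<le> \<bar>m_neg\<bar> + m_neg\<^sup>2"
      by (intro order_trans[OF abs_triangle_ineq] add_mono s)
    moreover have "\<bar>- m_neg * sin t + m_neg\<^sup>2 * cos t\<bar> \<le> \<bar>m_neg\<bar> + m_neg\<^sup>2"
      by (intro order_trans[OF abs_triangle_ineq] add_mono s) (use s in auto)
    moreover have "\<bar>m_neg\<bar> + m_neg\<^sup>2 \<le> K" "1 + \<bar>m_neg\<bar> + (m_neg\<^sup>2 + m_neg\<^sup>2) \<le> K" by (simp_all add: K_def)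
    ultimately show "\<bar>1 + m_neg * sin t + m_neg\<^sup>2 * (1 - cos t)\<bar> \<le> K \<and> \<bar>m_neg * cos t + m_neg\<^sup>2 * sin t\<bar> \<le> K
        \<and> \<bar>- m_neg * sin t + m_neg\<^sup>2 * cos t\<bar> \<le> K"
      by (blast intro: order_trans)
  next
    fix t :: real assume t: "0 \<le> t"
    have "\<bar>m_neg\<bar> * exp (m_neg * t) \<le> \<bar>m_neg\<bar> * 1" "m_neg\<^sup>2 * exp (m_neg * t) \<le> m_neg\<^sup>2 * 1"
      using e[OF t] by (intro mult_left_mono; simp)+
    moreover have "1 \<le> K" "\<bar>m_neg\<bar> * 1 \<le> K" "m_neg\<^sup>2 * 1 \<le> K" by (simp_all add: K_def add_nonneg_nonneg)
    moreover have "\<bar>exp (m_neg * t)\<bar> \<le> 1" "\<bar>m_neg * exp (m_neg * t)\<bar> = \<bar>m_neg\<bar> * exp (m_neg * t)"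
        "\<bar>m_neg\<^sup>2 * exp (m_neg * t)\<bar> = m_neg\<^sup>2 * exp (m_neg * t)"
      using e(2)[OF t] by (simp_all add: abs_mult)
    ultimately show "\<bar>exp (m_neg * t)\<bar> \<le> K \<and> \<bar>m_neg * exp (m_neg * t)\<bar> \<le> K \<and> \<bar>m_neg\<^sup>2 * exp (m_neg * t)\<bar> \<le> K"
      by (metis order_trans)
  qed (auto intro!: derivative_eq_intros continuous_intros simp: power2_eq_square algebra_simps)
qed

lemma C2_bounded_shift:
  assumes "C2_bounded w w1 w2"
  shows "C2_bounded (\<lambda>x. w (x - c)) (\<lambda>x. w1 (x - c)) (\<lambda>x. w2 (x - c))"
proof -
  have "bounded (range (\<lambda>x. f (x - c)))" if "bounded (range f)" for f :: "real \<Rightarrow> real"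
    by (rule bounded_subset[OF that]) auto
  moreover have "((\<lambda>x. f (x - c)) has_real_derivative f' (x - c)) (at x)"
    if "\<And>x. (f has_real_derivative f' x) (at x)" for f f' :: "real \<Rightarrow> real" and x
  proof -
    have "((\<lambda>x. f (x - c)) has_real_derivative f' (x - c) * 1) (at x)"
      by (rule DERIV_chain2[OF that]) (auto intro!: derivative_eq_intros)
    then show ?thesis by simp
  qed
  moreover have "continuous_on UNIV (\<lambda>x. w2 (x - c))"
    by (rule continuous_on_compose2[where g = w2 and t = UNIV])
       (use assms in \<open>auto simp: C2_bounded_def intro!: continuous_intros\<close>)
  ultimately show ?thesis
    using assms unfolding C2_bounded_def by blast
qed

lemma op_E: "0 \<le> t \<Longrightarrow> op E E1 E2 t = 0"
proof -
  assume "0 \<le> t"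
  then have "op E E1 E2 t = - (\<theta>\<^sup>2 / 2 * m_neg\<^sup>2 + \<nu> * m_neg - \<beta>) * exp (m_neg * t)"
    unfolding op_def E_def E1_def E2_def by (simp add: algebra_simps)
  then show ?thesis unfolding m_root by simp
qed

end

section \<open>Derivatives of the dual value in the dual variable\<close>

context dual_model
begin

text \<open>With \<open>z = exp x\<close>, \<open>H\<close> is the derivative of the dual value in
  \<open>z\<close>, and \<open>Q\<close> is \<open>z\<close> times the second derivative in
  \<open>z\<close>; equivalently \<open>Q\<close> is the derivative of \<open>H\<close> in
  \<open>x\<close>.\<close>

definition H :: "real \<Rightarrow> real" where
  "H x = (if x < 0 then (x + \<kappa>) / r + dl * exp ((m_pos - 1) * x) else dr * exp ((m_neg - 1) * x))"
definition Q :: "real \<Rightarrow> real" where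
  "Q x = (if x < 0 then 1 / r + dl * (m_pos - 1) * exp ((m_pos - 1) * x)
          else dr * (m_neg - 1) * exp ((m_neg - 1) * x))"

lemma exp_minus_1: "exp ((m - 1) * x) * exp x = exp (m * x)" for m x :: real
  by (simp add: mult_exp_exp algebra_simps)

lemma G1_H: "G1 x = H x * exp x"
  unfolding G1_def H_def by (simp add: distrib_right mult.assoc exp_minus_1) (simp add: distrib_left mult.commute)

lemma G_deriv: "(G has_real_derivative H x * exp x) (at x)"
  using C2_bounded_G unfolding C2_bounded_def G1_H[symmetric] by blast

lemma H_deriv: "(H has_real_derivative Q x) (at x)"
  unfolding H_def[abs_def] Q_def
proof (rule glue_deriv)
  fix x :: real
  show "((\<lambda>x. (x + \<kappa>) / r + dl * exp ((m_pos - 1) * x)) has_real_derivative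
      1 / r + dl * (m_pos - 1) * exp ((m_pos - 1) * x)) (at x)"
    using r_pos by (auto intro!: derivative_eq_intros)
  show "((\<lambda>x. dr * exp ((m_neg - 1) * x)) has_real_derivative dr * (m_neg - 1) * exp ((m_neg - 1) * x)) (at x)"
    by (auto intro!: derivative_eq_intros)
qed (use match1 match2 in auto)

lemma Q_continuous: "continuous_on UNIV Q"
  unfolding Q_def[abs_def]
  by (rule glue_continuous) (use match2 r_pos in \<open>auto intro!: continuous_intros\<close>)

text \<open>On the left branch the exponential has a negative coefficient, so \<open>Q\<close>
  decreases towards 0, where \<open>match2\<close> identifies its value with that of the positive
  right branch.\<close>

lemma Q_pos: "0 < Q x"
proof (cases "x < 0")
  case True
  have "1 / r + dl * (m_pos - 1) = dr * (m_neg - 1)" by (rule match2)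
  also have "0 < dr * (m_neg - 1)" using dr_neg m_neg_neg by (intro mult_neg_neg) auto
  finally have "- (dl * (m_pos - 1)) < 1 / r" by simp
  moreover have "- (dl * (m_pos - 1)) * exp ((m_pos - 1) * x) \<le> - (dl * (m_pos - 1)) * 1"
    using True dl_neg m_pos_gt_1
    by (intro mult_left_mono) (auto simp: mult_pos_neg less_imp_le mult_neg_pos)
  ultimately show ?thesis using True by (simp add: Q_def)
next
  case False
  then show ?thesis using dr_neg m_neg_neg by (simp add: Q_def mult_neg_neg)
qed

lemma H_strict_mono:
  assumes "x < y"
  shows "H x < H y"
proof (rule DERIV_pos_imp_increasing[OF assms])
  fix t
  show "\<exists>d. (H has_real_derivative d) (at t) \<and> 0 < d"
    by (intro exI conjI) (rule H_deriv, rule Q_pos)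
qed

lemma H_neg: "H x < 0"
proof -
  have *: "H x < 0" if "0 \<le> x" for x
    using that dr_neg by (simp add: H_def mult_neg_pos)
  show ?thesis
  proof (cases "x < 0")
    case True
    then show ?thesis using H_strict_mono[OF True] *[of 0] by simp
  qed (simp add: *)
qed

text \<open>\<open>H\<close> tends to minus infinity on the left and to 0 on the right. Hence the
  marginal after retirement attains every positive wealth.\<close>

lemma H_surj:
  assumes "h < 0"
  shows "\<exists>x. H x = h"
proof -
  have "filterlim (\<lambda>x. (x + \<kappa>) / r + dl * exp ((m_pos - 1) * x)) at_bot at_bot"
    using r_pos m_pos_gt_1 by real_asymp
  then have "\<forall>\<^sub>F x in at_bot. (x + \<kappa>) / r + dl * exp ((m_pos - 1) * x) \<le> h"
    by (simp add: filterlim_at_bot)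
  moreover have "\<forall>\<^sub>F x in at_bot. x < (0::real)" by (rule eventually_gt_at_bot)
  ultimately have "\<forall>\<^sub>F x in at_bot. H x \<le> h" by eventually_elim (simp add: H_def)
  then obtain a where a: "H a \<le> h" using eventually_happens'[OF trivial_limit_at_bot_linorder] by auto
  have "((\<lambda>x. dr * exp ((m_neg - 1) * x)) \<longlongrightarrow> 0) at_top"
    using m_neg_neg by real_asymp
  from order_tendstoD(1)[OF this assms] have "\<forall>\<^sub>F x in at_top. h < dr * exp ((m_neg - 1) * x)" .
  moreover have "\<forall>\<^sub>F x in at_top. (0::real) \<le> x \<and> a \<le> x" by (simp add: eventually_ge_at_top eventually_conj)
  ultimately have "\<forall>\<^sub>F x in at_top. h < H x \<and> a \<le> x" by eventually_elim (simp add: H_def)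
  then obtain b where b: "h < H b" "a \<le> b" using eventually_happens'[OF trivial_limit_at_top_linorder] by auto
  have "\<exists>x. a \<le> x \<and> x \<le> b \<and> H x = h"
    using a b by (intro IVT) (auto intro: DERIV_isCont[OF H_deriv])
  then show ?thesis by blast
qed

lemma G_strict_antimono:
  assumes "x < y"
  shows "G y < G x"
proof (rule DERIV_neg_imp_decreasing[OF assms])
  fix t
  show "\<exists>d. (G has_real_derivative d) (at t) \<and> d < 0"
    by (intro exI conjI) (rule G_deriv, rule mult_neg_pos[OF H_neg exp_gt_zero])
qed

text \<open>\<open>G\<close> is strictly decreasing and tends to 0 on the left.\<close>

lemma G_neg: "G x < 0"
proof -
  have l: "((\<lambda>x. exp x / r * (x - 1 + \<kappa>) + dl / m_pos * exp (m_pos * x)) \<longlongrightarrow> 0) at_bot"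
  proof -
    have "((\<lambda>x. exp x / r * (x - 1 + \<kappa>)) \<longlongrightarrow> 0) at_bot" "((\<lambda>x. exp (m_pos * x)) \<longlongrightarrow> 0) at_bot"
      using m_pos_pos r_pos by real_asymp+
    from tendsto_add[OF this(1) tendsto_mult_right_zero[OF this(2), of "dl / m_pos"]] show ?thesis by simp
  qed
  have "\<forall>\<^sub>F x in at_bot. exp x / r * (x - 1 + \<kappa>) + dl / m_pos * exp (m_pos * x) = G x"
    using eventually_gt_at_bot[of 0] by eventually_elim (simp add: G_def)
  from Lim_transform_eventually[OF l this] have "(G \<longlongrightarrow> 0) at_bot" .
  moreover have "\<forall>\<^sub>F y in at_bot. G (x - 1) \<le> G y"
    using eventually_gt_at_bot[of "x - 1"] by eventually_elim (use G_strict_antimono in \<open>auto intro: less_imp_le\<close>)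
  ultimately have "G (x - 1) \<le> 0" by (rule tendsto_lowerbound) simp
  then show ?thesis using G_strict_antimono[of "x - 1" x] by simp
qed

text \<open>The coefficient for which \<open>G x - kill c * exp (m_neg * x)\<close> vanishes at
  \<open>x = c\<close>, as the value of a stream stopped at \<open>c\<close> must.\<close>

definition kill :: "real \<Rightarrow> real" where "kill c = G c * exp (- m_neg * c)"

lemma kill_neg: "kill c < 0"
  using G_neg by (simp add: kill_def mult_neg_pos)

text \<open>Up to sign, \<open>kill\<close> is the product of two positive increasing
  functions.\<close>

lemma kill_antimono: "c < c' \<Longrightarrow> kill c' < kill c"
proof -
  assume c: "c < c'"
  have "- m_neg * c < - m_neg * c'" using c m_neg_neg by simp
  then have "(- G c) * exp (- m_neg * c) < (- G c') * exp (- m_neg * c')"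
    using G_strict_antimono[OF c] G_neg[of c] by (intro mult_strict_mono) auto
  then show ?thesis by (simp add: kill_def)
qed

text \<open>With \<open>x\<close> the logarithm of the normalised dual variable, \<open>D k x\<close> and \<open>D2 k x\<close> are, up to affine
  normalisation, the first derivative of the dual value and the dual variable times the second derivative.\<close>

definition D :: "real \<Rightarrow> real \<Rightarrow> real" where "D k x = H x - k * m_neg * exp ((m_neg - 1) * x)"
definition D2 :: "real \<Rightarrow> real \<Rightarrow> real" where "D2 k x = Q x - k * m_neg * (m_neg - 1) * exp ((m_neg - 1) * x)"
text \<open>The combination of \<open>D2\<close> and \<open>D\<close> in which \<open>k\<close>
  cancels: the term with \<open>k\<close> is an exponential of rate \<open>m_neg - 1\<close>, which
  \<open>D2 k x + (1 - m_neg) * D k x\<close> annihilates.\<close>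

definition R :: "real \<Rightarrow> real" where "R x = Q x + (1 - m_neg) * H x"

lemma D_deriv: "(D k has_real_derivative D2 k x) (at x)"
  unfolding D_def[abs_def] D2_def by (auto intro!: derivative_eq_intros H_deriv)

lemma D2_continuous: "continuous_on UNIV (D2 k)"
  unfolding D2_def[abs_def] by (intro continuous_intros Q_continuous)

text \<open>For \<open>k \<le> 0\<close> the killing term is nondecreasing, so strict convexity of
  the dual value survives it.\<close>

lemma D_strict_mono:
  assumes "k \<le> 0" "x < y"
  shows "D k x < D k y"
proof -
  have "(m_neg - 1) * y < (m_neg - 1) * x" using assms m_neg_neg by simp
  then have "k * m_neg * exp ((m_neg - 1) * y) \<le> k * m_neg * exp ((m_neg - 1) * x)"
    using assms m_neg_neg by (intro mult_left_mono) (auto simp: mult_nonpos_nonpos)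
  then show ?thesis using H_strict_mono[OF assms(2)] by (simp add: D_def)
qed

lemma D_kill_mono: "k \<le> k' \<Longrightarrow> D k x \<le> D k' x" and D_kill_strict_mono: "k < k' \<Longrightarrow> D k x < D k' x"
  using m_neg_neg by (simp_all add: D_def)

lemma D2_eq: "D2 k x = (1 - m_neg) * (- D k x) + R x"
  unfolding D2_def D_def R_def by (simp add: algebra_simps)

lemma R_0: "0 \<le> x \<Longrightarrow> R x = 0"
  by (simp add: R_def Q_def H_def algebra_simps)

text \<open>On the left branch the derivative is \<open>a * (1 - exp ((m_pos - 1) * t))\<close>: by
  the value of \<open>dl\<close> the slope vanishes exactly at 0 and is positive before it.\<close>

lemma R_strict_mono:
  assumes "x < y" "y < 0"
  shows "R x < R y"
proof -
  define a where "a = (1 - m_neg) / r"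
  define S where "S x = 1 / r + a * (x + \<kappa>) - a / (m_pos - 1) * exp ((m_pos - 1) * x)" for x
  have e: "dl * (m_pos - m_neg) = - (a / (m_pos - 1))"
  proof -
    define b where "b = m_pos - m_neg"
    have "b > 0" using m_pos_gt_1 m_neg_neg by (simp add: b_def)
    then show ?thesis unfolding dl_def a_def b_def[symmetric] using r_pos m_pos_gt_1 by (simp add: divide_simps)
  qed
  have RS: "R x = S x" if "x < 0" for x
  proof -
    have "R x = 1 / r + (1 - m_neg) * (x + \<kappa>) / r + dl * (m_pos - m_neg) * exp ((m_pos - 1) * x)"
      using that by (simp add: R_def Q_def H_def algebra_simps)
    then show ?thesis unfolding e S_def a_def by simp
  qed
  have "S x < S y"
  proof (rule DERIV_pos_imp_increasing[OF assms(1)])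
    fix t assume t: "x \<le> t" "t \<le> y"
    have "(S has_real_derivative a - a / (m_pos - 1) * ((m_pos - 1) * exp ((m_pos - 1) * t))) (at t)"
      unfolding S_def[abs_def] by (auto intro!: derivative_eq_intros)
    moreover have "a - a / (m_pos - 1) * ((m_pos - 1) * exp ((m_pos - 1) * t)) = a * (1 - exp ((m_pos - 1) * t))"
      using m_pos_gt_1 by (simp add: right_diff_distrib)
    moreover have "0 < a * (1 - exp ((m_pos - 1) * t))"
      using r_pos m_pos_gt_1 m_neg_neg t assms unfolding a_def by (intro mult_pos_pos) (auto simp: mult_pos_neg)
    ultimately show "\<exists>d. (S has_real_derivative d) (at t) \<and> 0 < d" by metis
  qed
  then show ?thesis using RS assms by simp
qed

end

section \<open>Expected discounted utility with and without stopping\<close>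

locale dual_bm = drifted_bm \<beta> \<nu> \<theta> M B + dual_model \<beta> \<nu> \<theta> r
  for \<beta> \<nu> \<theta> :: real and M :: "'w measure" and B :: "real \<Rightarrow> 'w \<Rightarrow> real" and r :: real
begin

lemma discounted_utility:
  "(LINT \<omega>|M. (LINT s:{0..}|lborel. exp (- \<beta> * s) * unit_util (exp (X x s \<omega>)))) = G x"
  using discounted_integral[OF C2_bounded_G, of x] by (simp add: op_G)

text \<open>The test function is \<open>G x - G c * E (x - c)\<close>, bounded and zero at
  \<open>c\<close>. Its image under \<open>op\<close> is the utility only from \<open>c\<close>
  upwards, which suffices since the path stays above \<open>c\<close> until the hit.\<close>

lemma discounted_utility_killed:
  assumes c: "c < x"
  shows "(LINT \<omega>|M. (LINT s:{s. 0 \<le> s \<and> ereal s < hit x c \<omega>}|lborel. exp (- \<beta> * s) * unit_util (exp (X x s \<omega>))))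
     = G x - kill c * exp (m_neg * x)"
proof -
  let ?w = "\<lambda>x. G x - G c * E (x - c)" and ?w1 = "\<lambda>x. G1 x - G c * E1 (x - c)"
    and ?w2 = "\<lambda>x. G2 x - G c * E2 (x - c)"
  have C2: "C2_bounded ?w ?w1 ?w2"
    by (rule C2_bounded_lincomb[OF C2_bounded_G C2_bounded_shift[OF C2_bounded_E]])
  have op: "op ?w ?w1 ?w2 z = unit_util (exp z)" if "c \<le> z" for z
  proof -
    have "op ?w ?w1 ?w2 z = op G G1 G2 z - G c * op E E1 E2 (z - c)"
      unfolding op_def by (simp add: algebra_simps)
    then show ?thesis using op_G op_E[of "z - c"] that by simp
  qed
  have "(LINT \<omega>|M. (LINT s:{s. 0 \<le> s \<and> ereal s < hit x c \<omega>}|lborel. exp (- \<beta> * s) * unit_util (exp (X x s \<omega>))))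
     = (LINT \<omega>|M. (LINT s:{s. 0 \<le> s \<and> ereal s < hit x c \<omega>}|lborel. exp (- \<beta> * s) * op ?w ?w1 ?w2 (X x s \<omega>)))"
    unfolding set_lebesgue_integral_def
  proof (intro Bochner_Integration.integral_cong refl)
    fix \<omega> s assume \<omega>: "\<omega> \<in> space M"
    show "indicator {s. 0 \<le> s \<and> ereal s < hit x c \<omega>} s *\<^sub>R (exp (- \<beta> * s) * unit_util (exp (X x s \<omega>)))
       = indicator {s. 0 \<le> s \<and> ereal s < hit x c \<omega>} s *\<^sub>R (exp (- \<beta> * s) * op ?w ?w1 ?w2 (X x s \<omega>))"
    proof (cases "0 \<le> s \<and> ereal s < hit x c \<omega>")
      case True
      then have "\<omega> \<in> above x c s" using less_hit_iff[OF \<omega> c] by blast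
      then have "c \<le> X x s \<omega>" using True by (auto simp: above_def intro: less_imp_le)
      then show ?thesis by (simp only: op)
    qed simp
  qed
  also have "\<dots> = ?w x"
    by (rule discounted_integral_killed[OF C2 c]) (simp add: E_def)
  also have "\<dots> = G x - kill c * exp (m_neg * x)"
    using c by (simp add: E_def kill_def mult.assoc mult_exp_exp algebra_simps)
  finally show ?thesis .
qed

end

section \<open>The retirement boundary\<close>

locale tail_weight =
  fixes m :: real
  assumes m_gt_1: "1 < m"
begin

text \<open>The mass of \<open>(b, \<infinity>)\<close> under the density
  \<open>w powr (- m)\<close>. Increments of \<open>tail_int\<close> are estimated below by
  increments of \<open>wt\<close>.\<close>

definition wt :: "real \<Rightarrow> real" where "wt b = b powr (1 - m) / (m - 1)"

definition tail_int :: "(real \<Rightarrow> real) \<Rightarrow> real \<Rightarrow> real" where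
  "tail_int q b = (LINT w:{b<..}|lborel. w powr (- m) * q w)"

definition tame :: "(real \<Rightarrow> real) \<Rightarrow> bool" where
  "tame q \<longleftrightarrow> continuous_on {0<..} q \<and> (\<exists>K. \<forall>w>0. \<bar>q w\<bar> \<le> K)"

lemma wt_pos: "0 < b \<Longrightarrow> 0 < wt b"
  using m_gt_1 by (simp add: wt_def)

lemma wt_strict_antimono: "0 < b \<Longrightarrow> b < b' \<Longrightarrow> wt b' < wt b"
  using m_gt_1 by (auto simp: wt_def intro!: divide_strict_right_mono powr_less_mono2_neg)

lemma wt_antimono: "0 < b \<Longrightarrow> b \<le> b' \<Longrightarrow> wt b' \<le> wt b"
  using wt_strict_antimono by (cases "b = b'") (auto simp: less_imp_le)

lemma wt_isCont: "0 < b \<Longrightarrow> isCont wt b"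
  unfolding wt_def using m_gt_1 by (auto intro!: continuous_intros)

lemma wt_at_0: "filterlim wt at_top (at_right 0)"
  unfolding wt_def using m_gt_1 by real_asymp

lemma wt_integral:
  assumes b: "0 < b"
  shows "set_integrable lborel {b<..} (\<lambda>w. w powr (- m))" "(LINT w:{b<..}|lborel. w powr (- m)) = wt b"
proof -
  have e: "einterval (ereal b) \<infinity> = {b<..}" by (auto simp: einterval_def)
  have d: "((\<lambda>w. - wt w) has_real_derivative w powr (- m)) (at w)" if "w > 0" for w
  proof -
    have "((\<lambda>w. - wt w) has_real_derivative - ((1 - m) * w powr (1 - m - 1) / (m - 1))) (at w)"
      unfolding wt_def using that m_gt_1 by (auto intro!: derivative_eq_intros)
    moreover have "- ((1 - m) * w powr (1 - m - 1) / (m - 1)) = w powr (- m)"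
      using m_gt_1 by (simp add: field_simps)
    ultimately show ?thesis by simp
  qed
  have l: "((\<lambda>w. - wt w) \<longlongrightarrow> - wt b) (at_right b)"
    using wt_isCont[OF b] by (intro tendsto_minus) (simp add: isCont_def filterlim_at_split)
  have t: "((\<lambda>w. - wt w) \<longlongrightarrow> 0) at_top" unfolding wt_def using m_gt_1 by real_asymp
  have *: "set_integrable lborel (einterval (ereal b) \<infinity>) (\<lambda>w. w powr (- m))"
    "(LBINT w=ereal b..\<infinity>. w powr (- m)) = 0 - (- wt b)"
    by (rule interval_integral_FTC_nonneg[where F = "\<lambda>w. - wt w"];
        use b l t d in \<open>auto simp: ereal_tendsto_simps intro!: continuous_intros\<close>)+
  show "set_integrable lborel {b<..} (\<lambda>w. w powr (- m))" using *(1) unfolding e .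
  show "(LINT w:{b<..}|lborel. w powr (- m)) = wt b"
    using *(2) unfolding interval_lebesgue_integral_def e by simp
qed

lemma wt_integral_Ioc:
  assumes b: "0 < b" "b \<le> b'"
  shows "set_integrable lborel {b<..b'} (\<lambda>w. w powr (- m))" "(LINT w:{b<..b'}|lborel. w powr (- m)) = wt b - wt b'"
proof -
  show i: "set_integrable lborel {b<..b'} (\<lambda>w. w powr (- m))"
    by (rule set_integrable_subset[OF wt_integral(1)[OF b(1)]]) auto
  have u: "{b<..b'} \<union> {b'<..} = {b<..}" using b by auto
  have "(LINT w:{b<..b'} \<union> {b'<..}|lborel. w powr (- m))
      = (LINT w:{b<..b'}|lborel. w powr (- m)) + (LINT w:{b'<..}|lborel. w powr (- m))"
    by (rule set_integral_Un[OF _ i wt_integral(1)]) (use b in auto)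
  then show "(LINT w:{b<..b'}|lborel. w powr (- m)) = wt b - wt b'"
    using wt_integral(2) b unfolding u by simp
qed

lemma tame_integrable:
  assumes q: "tame q" and b: "0 < b"
  shows "set_integrable lborel {b<..} (\<lambda>w. w powr (- m) * q w)"
proof -
  obtain K where K: "\<And>w. w > 0 \<Longrightarrow> \<bar>q w\<bar> \<le> K" using q by (auto simp: tame_def)
  have [measurable]: "(\<lambda>w. indicator {b<..} w *\<^sub>R q w) \<in> borel_measurable borel"
    by (rule borel_measurable_continuous_on_indicator)
       (use q b in \<open>auto simp: tame_def intro: continuous_on_subset\<close>)
  have "integrable lborel (\<lambda>w. w powr (- m) * (indicator {b<..} w *\<^sub>R q w))"
  proof (rule Bochner_Integration.integrable_bound)
    show "integrable lborel (\<lambda>w. K * (indicator {b<..} w *\<^sub>R w powr (- m)))"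
      using wt_integral(1)[OF b] by (simp add: set_integrable_def)
    show "AE w in lborel. norm (w powr (- m) * (indicator {b<..} w *\<^sub>R q w))
        \<le> norm (K * (indicator {b<..} w *\<^sub>R w powr (- m)))"
      using K b by (intro AE_I2)
        (auto simp: indicator_def abs_mult mult.commute intro!: mult_right_mono order_trans[OF _ abs_ge_self])
  qed measurable
  then show ?thesis by (simp add: set_integrable_def ac_simps)
qed

lemma tail_int_split:
  assumes q: "tame q" and b: "0 < b" "b \<le> b'"
  shows "tail_int q b = (LINT w:{b<..b'}|lborel. w powr (- m) * q w) + tail_int q b'"
    and "set_integrable lborel {b<..b'} (\<lambda>w. w powr (- m) * q w)"
proof -
  show i: "set_integrable lborel {b<..b'} (\<lambda>w. w powr (- m) * q w)"
    by (rule set_integrable_subset[OF tame_integrable[OF q b(1)]]) auto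
  have u: "{b<..b'} \<union> {b'<..} = {b<..}" using b by auto
  have "(LINT w:{b<..b'} \<union> {b'<..}|lborel. w powr (- m) * q w)
      = (LINT w:{b<..b'}|lborel. w powr (- m) * q w) + (LINT w:{b'<..}|lborel. w powr (- m) * q w)"
    by (rule set_integral_Un[OF _ i tame_integrable[OF q]]) (use b in auto)
  then show "tail_int q b = (LINT w:{b<..b'}|lborel. w powr (- m) * q w) + tail_int q b'"
    unfolding tail_int_def u .
qed

lemma tail_int_diff_ge:
  assumes q: "tame q" and b: "0 < b" "b \<le> b'" and l: "\<And>w. b < w \<Longrightarrow> w \<le> b' \<Longrightarrow> l \<le> q w"
  shows "l * (wt b - wt b') \<le> tail_int q b - tail_int q b'"
proof -
  have "(LINT w:{b<..b'}|lborel. l * w powr (- m)) \<le> (LINT w:{b<..b'}|lborel. w powr (- m) * q w)"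
    by (rule set_integral_mono)
       (use wt_integral_Ioc[OF b] tail_int_split[OF q b] l in \<open>auto simp: mult.commute intro!: mult_right_mono\<close>)
  then show ?thesis using wt_integral_Ioc(2)[OF b] tail_int_split(1)[OF q b] by simp
qed

lemma tame_uminus: "tame q \<Longrightarrow> tame (\<lambda>w. - q w)"
  unfolding tame_def by (auto intro!: continuous_intros)

lemma tail_int_uminus: "tail_int (\<lambda>w. - q w) b = - tail_int q b"
  unfolding tail_int_def set_lebesgue_integral_def by simp

lemma tail_int_diff_le:
  assumes q: "tame q" and b: "0 < b" "b \<le> b'" and u: "\<And>w. b < w \<Longrightarrow> w \<le> b' \<Longrightarrow> q w \<le> u"
  shows "tail_int q b - tail_int q b' \<le> u * (wt b - wt b')"
  using tail_int_diff_ge[OF tame_uminus[OF q] b, of "- u"] u by (simp add: tail_int_uminus)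

lemma tail_int_ge:
  assumes q: "tame q" and b: "0 < b" and l: "\<And>w. b < w \<Longrightarrow> l \<le> q w"
  shows "l * wt b \<le> tail_int q b"
proof -
  have "(LINT w:{b<..}|lborel. l * w powr (- m)) \<le> (LINT w:{b<..}|lborel. w powr (- m) * q w)"
    by (rule set_integral_mono)
       (use wt_integral[OF b] tame_integrable[OF q b] l in \<open>auto simp: mult.commute intro!: mult_right_mono\<close>)
  then show ?thesis using wt_integral(2)[OF b] by (simp add: tail_int_def)
qed

text \<open>A bound \<open>K\<close> on \<open>q\<close> makes \<open>tail_int q\<close> Lipschitz
  with constant \<open>K\<close> relative to the continuous function \<open>wt\<close>.\<close>

lemma tail_int_isCont:
  assumes q: "tame q" and b: "0 < b"
  shows "isCont (tail_int q) b"
proof -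
  obtain K where K: "\<And>w. w > 0 \<Longrightarrow> \<bar>q w\<bar> \<le> K" using q by (auto simp: tame_def)
  have le: "\<bar>tail_int q x - tail_int q y\<bar> \<le> K * \<bar>wt x - wt y\<bar>" if xy: "0 < x" "x \<le> y" for x y
  proof -
    have "- K * (wt x - wt y) \<le> tail_int q x - tail_int q y" "tail_int q x - tail_int q y \<le> K * (wt x - wt y)"
    proof -
      have *: "- K \<le> q w" "q w \<le> K" if "x < w" for w using K[of w] that xy by auto
      show "- K * (wt x - wt y) \<le> tail_int q x - tail_int q y"
        by (rule tail_int_diff_ge[OF q xy]) (rule *)
      show "tail_int q x - tail_int q y \<le> K * (wt x - wt y)"
        by (rule tail_int_diff_le[OF q xy]) (rule *)
    qed
    moreover have "\<bar>wt x - wt y\<bar> = wt x - wt y" using wt_antimono[OF xy] by simp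
    ultimately show ?thesis by (simp add: abs_le_iff)
  qed
  have le2: "\<bar>tail_int q x - tail_int q b\<bar> \<le> K * \<bar>wt x - wt b\<bar>" if "0 < x" for x
    using le[of x b] le[of b x] that b
    by (cases "x \<le> b") (simp_all add: abs_minus_commute[of _ "tail_int q b"] abs_minus_commute[of _ "wt b"])
  have "((\<lambda>x. tail_int q x - tail_int q b) \<longlongrightarrow> 0) (at b)"
  proof (rule Lim_null_comparison)
    show "\<forall>\<^sub>F x in at b. norm (tail_int q x - tail_int q b) \<le> K * \<bar>wt x - wt b\<bar>"
    proof -
      have "\<forall>\<^sub>F x in at b. x \<in> {0<..}" by (rule eventually_at_in_open') (use b in auto)
      then show ?thesis by eventually_elim (simp add: le2)
    qed
    have "((\<lambda>x. K * \<bar>wt x - wt b\<bar>) \<longlongrightarrow> K * \<bar>wt b - wt b\<bar>) (at b)"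
      using wt_isCont[OF b] unfolding isCont_def by (intro tendsto_intros)
    then show "((\<lambda>x. K * \<bar>wt x - wt b\<bar>) \<longlongrightarrow> 0) (at b)" by simp
  qed
  then show ?thesis unfolding isCont_def by (simp add: LIM_zero_iff)
qed

text \<open>\<open>q\<close> may vanish on a whole interval; uniqueness of the root is a matter of
  \<open>tail_int q\<close>, and a positive value somewhere is what makes the tail strictly
  positive.\<close>

definition single_crossing :: "(real \<Rightarrow> real) \<Rightarrow> bool" where
  "single_crossing q \<longleftrightarrow> tame q \<and> (\<forall>w w'. 0 < w \<longrightarrow> w \<le> w' \<longrightarrow> q w \<le> q w') \<and> (\<exists>w>0. 0 < q w)"

lemma tail_int_pos:
  assumes q: "single_crossing q" and b: "0 < b" and nn: "0 \<le> q b"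
  shows "0 < tail_int q b"
proof -
  have t: "tame q" and mono: "\<And>w w'. 0 < w \<Longrightarrow> w \<le> w' \<Longrightarrow> q w \<le> q w'"
    using q by (auto simp: single_crossing_def)
  obtain w0 where w0: "0 < w0" "0 < q w0" using q by (auto simp: single_crossing_def)
  define W where "W = max b w0"
  have W: "b \<le> W" "w0 \<le> W" "0 < W" using b by (auto simp: W_def)
  have "0 * (wt b - wt W) \<le> tail_int q b - tail_int q W"
    by (rule tail_int_diff_ge[OF t b W(1)]) (rule order_trans[OF nn mono[OF b less_imp_le]])
  moreover have "q w0 * wt W \<le> tail_int q W"
    by (rule tail_int_ge[OF t W(3)]) (rule mono, use w0 W in auto)
  moreover have "0 < q w0 * wt W" using w0 wt_pos[OF W(3)] by simp
  ultimately show ?thesis by simp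
qed

text \<open>A nonpositive tail at \<open>b'\<close> forces \<open>q b' < 0\<close>. By monotonicity
  all that is added between \<open>b\<close> and \<open>b'\<close> is then negative, so
  \<open>tail_int q\<close> can vanish only once.\<close>

lemma tail_int_single_crossing:
  assumes q: "single_crossing q" and b: "0 < b" "b < b'" and le: "tail_int q b' \<le> 0"
  shows "tail_int q b < 0"
proof -
  have t: "tame q" and mono: "\<And>w w'. 0 < w \<Longrightarrow> w \<le> w' \<Longrightarrow> q w \<le> q w'"
    using q by (auto simp: single_crossing_def)
  have neg: "q b' < 0" using tail_int_pos[OF q, of b'] b le by (cases "0 \<le> q b'") auto
  have "tail_int q b - tail_int q b' \<le> q b' * (wt b - wt b')"
    by (rule tail_int_diff_le[OF t b(1)]) (use b in \<open>auto intro: mono\<close>)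
  also have "\<dots> < 0" using neg wt_strict_antimono[OF b] by (simp add: mult_neg_pos)
  finally show ?thesis using le by simp
qed

lemma tail_int_root_unique:
  assumes q: "single_crossing q" and "0 < b" "tail_int q b = 0" "0 < b'" "tail_int q b' = 0"
  shows "b = b'"
  using tail_int_single_crossing[OF q, of b b'] tail_int_single_crossing[OF q, of b' b] assms
  by (cases b b' rule: linorder_cases) auto

lemma tail_int_root_exists:
  assumes q: "single_crossing q" and e: "0 < e" "\<And>w. 0 < w \<Longrightarrow> w \<le> e \<Longrightarrow> q w \<le> q0" "q0 < 0"
  shows "\<exists>b>0. tail_int q b = 0"
proof -
  have t: "tame q" using q by (auto simp: single_crossing_def)
  obtain w0 where w0: "0 < w0" "0 < q w0" using q by (auto simp: single_crossing_def)
  have pos: "0 < tail_int q w0" using tail_int_pos[OF q] w0 by simp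
  have "\<forall>\<^sub>F b in at_right 0. wt e + \<bar>tail_int q e\<bar> / (- q0) + 1 \<le> wt b"
    using wt_at_0 by (simp add: filterlim_at_top)
  moreover have "\<forall>\<^sub>F b in at_right 0. b < min e w0"
    by (rule eventually_at_rightI[of _ "min e w0"]) (use e w0 in auto)
  moreover have "\<forall>\<^sub>F b in at_right (0::real). 0 < b" by (simp add: eventually_at_right_less)
  ultimately have "\<forall>\<^sub>F b in at_right 0. 0 < b \<and> b < min e w0 \<and> wt e + \<bar>tail_int q e\<bar> / (- q0) + 1 \<le> wt b"
    by eventually_elim auto
  then obtain b where b: "0 < b" "b < e" "b < w0" "wt e + \<bar>tail_int q e\<bar> / (- q0) + 1 \<le> wt b"
    using eventually_happens'[OF trivial_limit_at_right_real] by auto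
  \<comment> \<open>\<open>wt\<close> is unbounded at 0, and \<open>b\<close> was taken so small
    that the negative contribution between \<open>b\<close> and \<open>e\<close> outweighs
    \<open>tail_int q e\<close>.\<close>
  have "tail_int q b - tail_int q e \<le> q0 * (wt b - wt e)"
    by (rule tail_int_diff_le[OF t b(1)]) (use b e in auto)
  also have "\<dots> \<le> q0 * (\<bar>tail_int q e\<bar> / (- q0) + 1)" using b(4) e(3) by (intro mult_left_mono_neg) auto
  also have "\<dots> = - \<bar>tail_int q e\<bar> + q0" using e(3) by (simp add: field_simps)
  finally have "tail_int q b \<le> 0" using e(3) by linarith
  then have "\<exists>x. b \<le> x \<and> x \<le> w0 \<and> tail_int q x = 0"
    using pos b by (intro IVT) (auto intro!: tail_int_isCont[OF t])
  then obtain x where "b \<le> x" "tail_int q x = 0" by blast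
  then show ?thesis using b(1) by (intro exI[of _ x]) auto
qed

lemma tail_int_strict_mono:
  assumes q: "tame q" "tame q'" and b: "0 < b" and less: "\<And>w. 0 < w \<Longrightarrow> q w < q' w"
  shows "tail_int q b < tail_int q' b"
proof -
  let ?d = "\<lambda>w. q' w - q w"
  have d: "tame ?d"
  proof -
    obtain K K' where "\<And>w. 0 < w \<Longrightarrow> \<bar>q w\<bar> \<le> K" "\<And>w. 0 < w \<Longrightarrow> \<bar>q' w\<bar> \<le> K'"
      using q by (auto simp: tame_def)
    then have "\<bar>q' w - q w\<bar> \<le> K' + K" if "0 < w" for w
      using that by (intro order_trans[OF abs_triangle_ineq4] add_mono)
    then show ?thesis using q by (auto simp: tame_def intro!: continuous_intros)
  qed
  have eq: "tail_int ?d b = tail_int q' b - tail_int q b"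
    unfolding tail_int_def right_diff_distrib
    by (rule set_integral_diff) (intro tame_integrable q b)+
  \<comment> \<open>The pointwise strict inequality needs a uniform gap on a set of positive mass;
    the compact interval supplies one.\<close>
  have "continuous_on {b..b + 1} ?d"
    using d b by (auto simp: tame_def intro: continuous_on_subset)
  from continuous_attains_inf[OF _ _ this] obtain u
    where u: "u \<in> {b..b+1}" "\<And>w. w \<in> {b..b+1} \<Longrightarrow> ?d u \<le> ?d w" by auto
  have "?d u * (wt b - wt (b + 1)) \<le> tail_int ?d b - tail_int ?d (b + 1)"
    by (rule tail_int_diff_ge[OF d b]) (use u(2) in auto)
  moreover have "0 < ?d u * (wt b - wt (b + 1))"
    using u(1) b less[of u] wt_strict_antimono[OF b, of "b + 1"] by simp
  moreover have "0 * wt (b + 1) \<le> tail_int ?d (b + 1)"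
    by (rule tail_int_ge[OF d]) (use b less in \<open>auto simp: less_imp_le\<close>)
  ultimately show ?thesis using eq by simp
qed

text \<open>If \<open>b \<le> b'\<close>, single crossing makes the tail of \<open>q'\<close>
  nonpositive at \<open>b\<close>, while comparison with \<open>q\<close> makes it positive
  there.\<close>

lemma tail_int_root_strict_mono:
  assumes q: "single_crossing q" "single_crossing q'" and less: "\<And>w. 0 < w \<Longrightarrow> q w < q' w"
    and b: "0 < b" "tail_int q b = 0" and b': "0 < b'" "tail_int q' b' = 0"
  shows "b' < b"
proof (rule ccontr)
  assume "\<not> b' < b"
  then have "tail_int q' b \<le> 0"
    using tail_int_single_crossing[OF q(2) b(1), of b'] b' by (cases "b = b'") auto
  moreover have "tail_int q b < tail_int q' b"
    by (rule tail_int_strict_mono) (use q b less in \<open>auto simp: single_crossing_def\<close>)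
  ultimately show False using b by simp
qed

end

text \<open>This is \<open>unit_util (exp x) / exp x\<close>. Division by the dual variable turns
  income into an additive constant and leaves an increasing concave function, whence a monotone
  boundary integrand.\<close>

definition util_rate :: "real \<Rightarrow> real" where
  "util_rate x = (if x < 0 then x - 1 else - exp (- x))"

lemma unit_util_rate: "0 < w \<Longrightarrow> unit_util w = w * util_rate (ln w)"
  by (auto simp: unit_util_def util_rate_def exp_minus)

lemma util_rate_deriv: "(util_rate has_real_derivative (if x < 0 then 1 else exp (- x))) (at x)"
  unfolding util_rate_def[abs_def] by (rule glue_deriv) (auto intro!: derivative_eq_intros)

lemma util_rate_strict_mono:
  assumes "x < y"
  shows "util_rate x < util_rate y"
proof (rule DERIV_pos_imp_increasing[OF assms])
  fix t
  show "\<exists>d. (util_rate has_real_derivative d) (at t) \<and> 0 < d"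
    by (intro exI conjI) (rule util_rate_deriv, simp)
qed

lemma util_rate_neg: "util_rate x < 0" and util_rate_ge: "- exp (- x) \<le> util_rate x"
  using exp_ge_add_one_self[of "- x"] by (auto simp: util_rate_def)

lemma util_rate_concave:
  assumes "0 \<le> a" "x \<le> y"
  shows "util_rate x - util_rate (x + a) \<le> util_rate y - util_rate (y + a)"
proof (rule DERIV_nonneg_imp_nondecreasing[OF assms(2)])
  fix t
  let ?d = "\<lambda>x. if x < 0 then 1 else exp (- x)"
  have "((\<lambda>t. util_rate (t + a)) has_real_derivative ?d (t + a) * 1) (at t)"
    by (rule DERIV_chain2[OF util_rate_deriv]) (auto intro!: derivative_eq_intros)
  from DERIV_diff[OF util_rate_deriv this]
  have "((\<lambda>t. util_rate t - util_rate (t + a)) has_real_derivative ?d t - ?d (t + a)) (at t)" by simp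
  moreover have "0 \<le> ?d t - ?d (t + a)" using assms(1) by auto
  ultimately show "\<exists>d. ((\<lambda>t. util_rate t - util_rate (t + a)) has_real_derivative d) (at t) \<and> 0 \<le> d"
    by (intro exI conjI)
qed

text \<open>The boundary integrand at the dual variable \<open>w * A p (leisure_pre p)\<close> is a power of \<open>w\<close>
  times a constant times this function; see \<open>gain_eq\<close>.\<close>

definition gain :: "real \<Rightarrow> real \<Rightarrow> real \<Rightarrow> real" where
  "gain \<rho> \<eta> w = util_rate (ln w) - util_rate (ln w - ln \<rho>) + \<eta>"

lemma gain_eq:
  assumes "0 < w" "0 < \<rho>"
  shows "unit_util w - \<rho> * unit_util (w / \<rho>) + \<eta> * w = w * gain \<rho> \<eta> w"
  using assms by (simp add: unit_util_rate gain_def ln_div algebra_simps)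

lemma gain_strict_mono:
  assumes "0 < \<rho>" "\<rho> \<le> \<rho>'" "\<eta> \<le> \<eta>'" "\<rho> < \<rho>' \<or> \<eta> < \<eta>'"
  shows "gain \<rho> \<eta> w < gain \<rho>' \<eta>' w"
proof (cases "\<rho> = \<rho>'")
  case True then show ?thesis using assms by (simp add: gain_def)
next
  case False
  then have "ln \<rho> < ln \<rho>'" using assms by simp
  then show ?thesis using util_rate_strict_mono[of "ln w - ln \<rho>'" "ln w - ln \<rho>"] assms by (simp add: gain_def)
qed

lemma gain_lower:
  assumes "0 < \<rho>" "\<rho> < 1"
  shows "\<eta> + ln \<rho> \<le> gain \<rho> \<eta> w"
proof -
  have l: "ln \<rho> < 0" using assms by simp
  \<comment> \<open>By concavity the difference is smallest far to the left. At \<open>y\<close>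
    both arguments lie in the affine branch, where it equals \<open>ln \<rho>\<close>.\<close>
  define y where "y = min (ln w) (ln \<rho>) - 1"
  have y: "y < ln \<rho>" "y \<le> ln w" by (auto simp: y_def)
  have "util_rate y - util_rate (y + - ln \<rho>) \<le> util_rate (ln w) - util_rate (ln w + - ln \<rho>)"
    by (rule util_rate_concave) (use l y in auto)
  moreover have "util_rate y - util_rate (y + - ln \<rho>) = ln \<rho>"
    using y l by (simp add: util_rate_def)
  ultimately show ?thesis by (simp add: gain_def)
qed

lemma gain_upper: "0 < \<rho> \<Longrightarrow> \<rho> < 1 \<Longrightarrow> gain \<rho> \<eta> w \<le> \<eta>"
  using util_rate_strict_mono[of "ln w" "ln w - ln \<rho>"] by (simp add: gain_def)

text \<open>Below \<open>\<rho>\<close> both arguments lie in the affine branch, so the gain is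
  constant near 0. The sign of this constant decides whether the agent ever retires, see
  \<open>A_ratio\<close>.\<close>

lemma gain_small: "0 < \<rho> \<Longrightarrow> \<rho> < 1 \<Longrightarrow> 0 < w \<Longrightarrow> w \<le> \<rho> / 2 \<Longrightarrow> gain \<rho> \<eta> w = \<eta> + ln \<rho>"
proof -
  assume a: "0 < \<rho>" "\<rho> < 1" "0 < w" "w \<le> \<rho> / 2"
  then have "w < \<rho>" by simp
  then have "ln w < ln \<rho>" "ln \<rho> < 0" using a by simp_all
  then show ?thesis by (simp add: gain_def util_rate_def)
qed

context tail_weight
begin

lemma gain_single_crossing:
  assumes \<rho>: "0 < \<rho>" "\<rho> < 1" and \<eta>: "0 < \<eta>"
  shows "single_crossing (gain \<rho> \<eta>)"
  unfolding single_crossing_def tame_def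
proof (intro conjI allI impI)
  have u: "continuous_on UNIV util_rate"
    by (intro continuous_at_imp_continuous_on ballI DERIV_isCont[OF util_rate_deriv])
  have "continuous_on {0<..} (\<lambda>w. util_rate (ln w - a))" for a
    by (rule continuous_on_compose2[OF u, where f = "\<lambda>w. ln w - a"]) (auto intro!: continuous_intros)
  from continuous_on_add[OF continuous_on_diff[OF this[of 0] this[of "ln \<rho>"]] continuous_on_const]
  show "continuous_on {0<..} (gain \<rho> \<eta>)"
    unfolding gain_def[abs_def] by simp
  show "\<exists>K. \<forall>w>0. \<bar>gain \<rho> \<eta> w\<bar> \<le> K"
  proof (intro exI allI impI)
    fix w
    show "\<bar>gain \<rho> \<eta> w\<bar> \<le> \<eta> - ln \<rho>"
      using gain_lower[OF \<rho>, of \<eta> w] gain_upper[OF \<rho>, of \<eta> w] \<rho> \<eta> ln_less_zero[OF \<rho>] by linarith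
  qed
  show "gain \<rho> \<eta> w \<le> gain \<rho> \<eta> w'" if "0 < w" "w \<le> w'" for w w'
    using util_rate_concave[of "- ln \<rho>" "ln w" "ln w'"] that \<rho> by (simp add: gain_def)
  \<comment> \<open>At \<open>w = 2 / \<eta>\<close> the first term of the gain is at least
    \<open>- \<eta> / 2\<close> and minus the second is positive, so \<open>\<eta>\<close>
    prevails.\<close>
  have "exp (- ln (2 / \<eta>)) = \<eta> / 2" using \<eta> by (simp add: exp_minus)
  then have "0 < gain \<rho> \<eta> (2 / \<eta>)"
    using util_rate_ge[of "ln (2 / \<eta>)"] util_rate_neg[of "ln (2 / \<eta>) - ln \<rho>"] \<eta> unfolding gain_def by linarith
  then show "\<exists>w>0. 0 < gain \<rho> \<eta> w" using \<eta> by (intro exI[of _ "2 / \<eta>"]) auto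
qed

end

text \<open>The maximiser is interior for \<open>y < A p l\<close> and the corner 0 otherwise. In
  both cases its optimality is the tangent inequality \<open>1 + t \<le> exp t\<close>.\<close>

lemma conj_util_eq:
  assumes "0 < gam p" "0 < y"
  shows "conj_util p l y = A p l / gam p * unit_util (y / A p l)"
proof -
  define a where "a = A p l"
  define g where "g = gam p"
  have a: "0 < a" and g: "0 < g" using assms by (auto simp: a_def g_def A_def)
  let ?f = "\<lambda>c. - (exp (- g * c) / g) * a - c * y"
  have "Sup (?f ` {0..}) = a / g * unit_util (y / a)"
  proof (cases "y < a")
    case True
    then have ya: "0 < y / a" "y / a < 1" using a assms by auto
    define L where "L = ln (y / a)"
    have eL: "exp L = y / a" and L: "L < 0" using ya by (auto simp: L_def)
    have v: "a / g * unit_util (y / a) = y / g * (L - 1)" using ya a by (simp add: unit_util_def L_def)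
    have f0: "a / g * unit_util (y / a) = ?f (- L / g)"
      unfolding v using g a eL by (simp add: field_simps)
    have "- L / g \<in> {0..}" using L g by (simp add: divide_nonpos_pos)
    then have "a / g * unit_util (y / a) \<in> ?f ` {0..}" using f0 by (intro image_eqI[where f = ?f and x = "- L / g"])
    moreover have "?f c \<le> a / g * unit_util (y / a)" for c
    proof -
      have "1 + (- g * c - L) \<le> exp (- g * c - L)" by (rule exp_ge_add_one_self)
      also have "\<dots> = exp (- g * c) * (a / y)" by (simp add: exp_diff eL)
      finally have "y * (1 + (- g * c - L)) \<le> y * (exp (- g * c) * (a / y))"
        using assms by (intro mult_left_mono) auto
      then have *: "y * (1 + (- g * c - L)) \<le> exp (- g * c) * a" using assms by simp
      have "g * ?f c = - (exp (- g * c) * a) - g * c * y" using g by (simp add: right_diff_distrib)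
      also have "\<dots> \<le> y * (L - 1)" using * by (simp add: algebra_simps)
      also have "\<dots> = g * (y / g * (L - 1))" using g by simp
      finally show ?thesis unfolding v using g by (simp only: mult_le_cancel_left_pos)
    qed
    ultimately show ?thesis by (intro cSup_eq_maximum) auto
  next
    case False
    then have v: "a / g * unit_util (y / a) = - a / g" using a by (simp add: unit_util_def)
    have "a / g * unit_util (y / a) = ?f 0" unfolding v by simp
    then have "a / g * unit_util (y / a) \<in> ?f ` {0..}" by (intro image_eqI[where f = ?f and x = 0]) auto
    moreover have "?f c \<le> a / g * unit_util (y / a)" if "0 \<le> c" for c
    proof -
      have "1 + (- g * c) \<le> exp (- g * c)" by (rule exp_ge_add_one_self)
      then have "a * (1 + (- g * c)) \<le> a * exp (- g * c)" using a by (intro mult_left_mono) auto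
      moreover have "g * c * a \<le> g * c * y" using False that g by (intro mult_left_mono) auto
      ultimately have *: "a \<le> a * exp (- g * c) + g * c * y" by (simp add: algebra_simps)
      have "g * ?f c = - (exp (- g * c) * a) - g * c * y" using g by (simp add: right_diff_distrib)
      also have "\<dots> \<le> g * (- a / g)" using * g by (simp add: algebra_simps)
      finally show ?thesis unfolding v using g by (simp only: mult_le_cancel_left_pos)
    qed
    ultimately show ?thesis by (intro cSup_eq_maximum) auto
  qed
  then show ?thesis by (simp add: conj_util_def a_def g_def)
qed

abbreviation (input) Apre :: "economy \<Rightarrow> real" where "Apre p \<equiv> A p (leisure_pre p)"
abbreviation (input) Apost :: "economy \<Rightarrow> real" where "Apost p \<equiv> A p (leisure_post p)"

lemma A_pos: "0 < A p l"
  by (simp add: A_def)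

lemma gam_pos: "admissible p \<Longrightarrow> 0 < gam p"
  by (simp add: admissible_def gam_def)

lemma A_ratio:
  assumes "admissible p"
  shows "0 < Apost p / Apre p" "Apost p / Apre p < 1"
    and "ever_retires p \<longleftrightarrow> gam p * income p + ln (Apost p / Apre p) < 0"
proof -
  let ?d = "leisure_post p - leisure_pre p"
  have r: "Apost p / Apre p = exp (- (riskav p * (1 - cweight p) * ?d))"
    by (simp add: A_def exp_diff[symmetric] algebra_simps)
  show "0 < Apost p / Apre p" unfolding r by simp
  show "Apost p / Apre p < 1" using assms unfolding r by (simp add: admissible_def)
  have a: "0 < cweight p" "0 < riskav p" using assms by (auto simp: admissible_def)
  have "ever_retires p \<longleftrightarrow> cweight p * income p < (1 - cweight p) * ?d"
    unfolding ever_retires_def using a by (simp add: field_simps)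
  also have "\<dots> \<longleftrightarrow> riskav p * (cweight p * income p) < riskav p * ((1 - cweight p) * ?d)"
    using a by simp
  also have "\<dots> \<longleftrightarrow> gam p * income p + ln (Apost p / Apre p) < 0"
    unfolding r by (simp add: gam_def algebra_simps)
  finally show "ever_retires p \<longleftrightarrow> gam p * income p + ln (Apost p / Apre p) < 0" .
qed

section \<open>The boundary and the killing coefficient of an economy\<close>

context dual_model
begin

sublocale tail_weight m_pos
  by unfold_locales (rule m_pos_gt_1)

definition market :: "economy \<Rightarrow> bool" where
  "market p \<longleftrightarrow> admissible p \<and> discount p = \<beta> \<and> rate p = r \<and> theta p = \<theta>"

lemma m_plus_minus_eq:
  assumes "market p"
  shows "m_plus p = m_pos" "m_minus p = m_neg"
proof -
  have \<nu>2: "2 * (\<beta> - r) - \<theta>\<^sup>2 = 2 * \<nu>" unfolding \<nu>_eq by (simp add: field_simps)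
  have "char_poly p m = \<theta>\<^sup>2 * m\<^sup>2 + 2 * \<nu> * m - 2 * \<beta>" for m
    unfolding \<nu>2[symmetric] using assms by (simp only: char_poly_def market_def)
  also have "\<theta>\<^sup>2 * m\<^sup>2 + 2 * \<nu> * m - 2 * \<beta> = \<theta>\<^sup>2 * ((m - m_pos) * (m - m_neg))" for m
  proof -
    have "\<theta>\<^sup>2 * ((m - m_pos) * (m - m_neg)) = \<theta>\<^sup>2 * m\<^sup>2 - \<theta>\<^sup>2 * (m_pos + m_neg) * m + \<theta>\<^sup>2 * (m_pos * m_neg)"
      by (simp add: algebra_simps power2_eq_square)
    then show ?thesis unfolding m_sum_prod by simp
  qed
  finally have c: "char_poly p m = 0 \<longleftrightarrow> m = m_pos \<or> m = m_neg" for m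
    using \<theta>_pos by simp
  show "m_plus p = m_pos"
    unfolding m_plus_def c by (rule the_equality) (use m_pos_gt_1 m_neg_neg in auto)
  show "m_minus p = m_neg"
    unfolding m_minus_def c by (rule the_equality) (use m_pos_gt_1 m_neg_neg in auto)
qed

abbreviation retire_gain :: "economy \<Rightarrow> real \<Rightarrow> real" where
  "retire_gain p \<equiv> gain (Apost p / Apre p) (gam p * income p)"

abbreviation zbar :: "economy \<Rightarrow> real" where
  "zbar p \<equiv> ybar p / Apre p"

text \<open>Substitution \<open>z = Apre p * w\<close>. The prefactor is positive, so the scaled
  boundary is a root of \<open>tail_int\<close>.\<close>

lemma boundary_integral:
  assumes p: "market p" and b: "0 < b"
  shows "(LINT z:{b<..}|lborel. z powr (- 1 - m_plus p) * (U_pre p z - U_post p z + income p * z))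
     = Apre p powr (1 - m_pos) / gam p * tail_int (retire_gain p) (b / Apre p)"
proof -
  have adm: "admissible p" using p by (simp add: market_def)
  note g = gam_pos[OF adm]
  define a where "a = Apre p"
  define \<rho> where "\<rho> = Apost p / Apre p"
  have a: "0 < a" "0 < \<rho>" "Apost p = a * \<rho>" using A_pos[of p "leisure_pre p"] A_ratio(1)[OF adm] by (auto simp: a_def \<rho>_def)
  let ?f = "\<lambda>z. z powr (- 1 - m_pos) * (U_pre p z - U_post p z + income p * z)"
  have "(LINT z:{b<..}|lborel. ?f z) = \<bar>a\<bar> *\<^sub>R (LINT w|lborel. indicator {b<..} (0 + a * w) *\<^sub>R ?f (0 + a * w))"
    unfolding set_lebesgue_integral_def using a by (intro lborel_integral_real_affine) auto
  also have "\<dots> = (LINT w|lborel. a * (indicator {b<..} (0 + a * w) *\<^sub>R ?f (0 + a * w)))"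
    using a by simp
  also have "\<dots> = (LINT w|lborel. a powr (1 - m_pos) / gam p * (indicator {b / a<..} w *\<^sub>R (w powr (- m_pos) * retire_gain p w)))"
  proof (intro Bochner_Integration.integral_cong refl)
    fix w :: real
    show "a * (indicator {b<..} (0 + a * w) *\<^sub>R ?f (0 + a * w))
        = a powr (1 - m_pos) / gam p * (indicator {b / a<..} w *\<^sub>R (w powr (- m_pos) * retire_gain p w))"
    proof (cases "b / a < w")
      case True
      have "0 < b / a" using a b by simp
      then have w: "0 < w" using True by linarith
      have "b < a * w" using True a by (simp add: field_simps)
      note w = w this
      have u1: "U_pre p (a * w) = a / gam p * unit_util w"
        unfolding U_pre_def using conj_util_eq[OF g, of "a * w" "leisure_pre p"] a w
        unfolding a_def[symmetric] by simp
      have u2: "U_post p (a * w) = a * \<rho> / gam p * unit_util (w / \<rho>)"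
        unfolding U_post_def using conj_util_eq[OF g, of "a * w" "leisure_post p"] a(1,2) w
        unfolding a(3) by simp
      have "U_pre p (a * w) - U_post p (a * w) + income p * (a * w)
          = a / gam p * (unit_util w - \<rho> * unit_util (w / \<rho>) + (gam p * income p) * w)"
        unfolding u1 u2 using g by (simp add: field_simps)
      also have "\<dots> = a / gam p * (w * retire_gain p w)"
        unfolding gain_eq[OF w(1) a(2)] unfolding \<rho>_def ..
      finally have U: "U_pre p (a * w) - U_post p (a * w) + income p * (a * w) = a / gam p * (w * retire_gain p w)" .
      have "a * ?f (a * w) = a * ((a powr (- 1 - m_pos) * w powr (- 1 - m_pos)) * (a / gam p * (w * retire_gain p w)))"
        unfolding U using a w by (simp only: powr_mult)
      also have "\<dots> = (a * a * a powr (- 1 - m_pos)) / gam p * (w * w powr (- 1 - m_pos) * retire_gain p w)"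
        unfolding divide_inverse by (simp only: ac_simps)
      also have "a * a * a powr (- 1 - m_pos) = a powr (1 - m_pos)"
      proof -
        have "a powr 2 * a powr (- 1 - m_pos) = a powr (1 - m_pos)" unfolding powr_add[symmetric] by simp
        then show ?thesis using a by (simp add: power2_eq_square)
      qed
      also have "w * w powr (- 1 - m_pos) = w powr (- m_pos)"
      proof -
        have "w powr 1 * w powr (- 1 - m_pos) = w powr (- m_pos)" unfolding powr_add[symmetric] by simp
        then show ?thesis using w by simp
      qed
      finally show ?thesis using True w by simp
    next
      case False
      then have "\<not> b < a * w" using a by (simp add: field_simps)
      then show ?thesis using False by simp
    qed
  qed
  also have "\<dots> = a powr (1 - m_pos) / gam p * tail_int (retire_gain p) (b / a)"
    unfolding tail_int_def set_lebesgue_integral_def by simp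
  finally show ?thesis unfolding m_plus_minus_eq(1)[OF p] a_def .
qed

lemma retire_gain_single_crossing:
  assumes "market p"
  shows "single_crossing (retire_gain p)"
proof -
  have adm: "admissible p" using assms by (simp add: market_def)
  then have "0 < gam p * income p" using gam_pos[OF adm] by (simp add: admissible_def)
  then show ?thesis by (rule gain_single_crossing[OF A_ratio(1,2)[OF adm]])
qed

text \<open>Justifies the description operator in \<open>ybar\<close>: retirement means a negative
  gain near 0, hence existence of a root, and single crossing gives uniqueness.\<close>

lemma ybar_root:
  assumes p: "market p" and e: "ever_retires p"
  shows "0 < ybar p" "tail_int (retire_gain p) (zbar p) = 0"
proof -
  have adm: "admissible p" using p by (simp add: market_def)
  note sc = retire_gain_single_crossing[OF p]
  have A: "0 < Apre p" by (rule A_pos)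
  define P where "P b \<longleftrightarrow> 0 < b \<and>
    (LINT z:{b<..}|lborel. z powr (- 1 - m_plus p) * (U_pre p z - U_post p z + income p * z)) = 0" for b
  have P: "P b \<longleftrightarrow> 0 < b \<and> tail_int (retire_gain p) (b / Apre p) = 0" for b
  proof (cases "0 < b")
    case True
    have "Apre p powr (1 - m_pos) / gam p \<noteq> 0" using A gam_pos[OF adm] by simp
    then show ?thesis unfolding P_def boundary_integral[OF p True] by (simp only: mult_eq_0_iff simp_thms)
  qed (simp add: P_def)
  have r: "0 < Apost p / Apre p / 2" "gam p * income p + ln (Apost p / Apre p) < 0"
    using A_ratio(1)[OF adm] A_ratio(3)[OF adm] e by (simp, blast)
  have "\<exists>z>0. tail_int (retire_gain p) z = 0"
    by (rule tail_int_root_exists[OF sc r(1) _ r(2)])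
       (simp only: gain_small[OF A_ratio(1,2)[OF adm]] order_refl)
  then obtain z where z: "0 < z" "tail_int (retire_gain p) z = 0" by blast
  have "P (z * Apre p)" unfolding P using z A by simp
  moreover have uniq: "b = b'" if "P b" "P b'" for b b'
  proof -
    have "b / Apre p = b' / Apre p"
      by (rule tail_int_root_unique[OF sc]) (use that A in \<open>simp_all add: P\<close>)
    then show ?thesis using A by simp
  qed
  ultimately have "\<exists>!b. P b" by (intro ex1I[of P "z * Apre p"])
  then have "P (THE b. P b)" by (rule theI')
  moreover have "ybar p = (THE b. P b)" unfolding ybar_def P_def using e by simp
  ultimately have "P (ybar p)" by simp
  then show "0 < ybar p" "tail_int (retire_gain p) (zbar p) = 0" unfolding P by auto
qed

lemma ybar_eq_0: "\<not> ever_retires p \<Longrightarrow> ybar p = 0"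
  by (simp add: ybar_def)

lemma ybar_nonneg: "market p \<Longrightarrow> 0 \<le> ybar p"
  using ybar_root(1)[of p] ybar_eq_0[of p] by (cases "ever_retires p") simp_all

lemma zbar_mono:
  assumes p: "market p" and q: "market q"
    and le: "Apost p / Apre p \<le> Apost q / Apre q" "gam p * income p \<le> gam q * income q"
    and less: "Apost p / Apre p < Apost q / Apre q \<or> gam p * income p < gam q * income q"
  shows "zbar q \<le> zbar p" "ever_retires p \<Longrightarrow> zbar q < zbar p"
proof -
  have adm: "admissible p" "admissible q" using p q by (simp_all add: market_def)
  have A: "0 < Apre p" "0 < Apre q" by (rule A_pos)+
  have s: "zbar q < zbar p" if e: "ever_retires p"
  proof (cases "ever_retires q")
    case True
    show ?thesis
    proof (rule tail_int_root_strict_mono[OF retire_gain_single_crossing[OF p] retire_gain_single_crossing[OF q]])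
      show "retire_gain p w < retire_gain q w" for w
        by (rule gain_strict_mono[OF A_ratio(1)[OF adm(1)] le less])
      show "0 < zbar p" "0 < zbar q" using ybar_root(1)[OF p e] ybar_root(1)[OF q True] A by simp_all
    qed (rule ybar_root(2)[OF p e] ybar_root(2)[OF q True])+
  next
    case False
    then show ?thesis using ybar_root(1)[OF p e] A by (simp add: ybar_eq_0)
  qed
  then show "ever_retires p \<Longrightarrow> zbar q < zbar p" .
  \<comment> \<open>Retirement is itself antitone in the two parameters, so if \<open>p\<close>
    never retires then neither does \<open>q\<close>, and both boundaries are 0.\<close>
  have "ln (Apost p / Apre p) \<le> ln (Apost q / Apre q)"
    using le(1) A_ratio(1)[OF adm(1)] A_ratio(1)[OF adm(2)] by (simp only: ln_le_cancel_iff)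
  then have pq: "ever_retires p" if "ever_retires q"
    using that le(2) unfolding A_ratio(3)[OF adm(1)] A_ratio(3)[OF adm(2)] by linarith
  show "zbar q \<le> zbar p"
  proof (cases "ever_retires p")
    case False
    then have "\<not> ever_retires q" using pq by blast
    then show ?thesis using False by (simp add: ybar_eq_0)
  qed (rule less_imp_le[OF s])
qed

definition kcoef :: "economy \<Rightarrow> real" where
  "kcoef p = (if 0 < ybar p then kill (ln (zbar p)) else 0)"

lemma kcoef_nonpos: "kcoef p \<le> 0"
  using kill_neg less_imp_le by (auto simp: kcoef_def)

text \<open>If \<open>q\<close> never retires its coefficient is 0, which still exceeds every value
  of \<open>kill\<close>.\<close>

lemma kcoef_strict_antimono:
  assumes "market q" "zbar q < zbar p"
  shows "kcoef p < kcoef q"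
proof -
  have A: "0 < Apre p" "0 < Apre q" by (rule A_pos)+
  have q: "0 \<le> zbar q" using ybar_nonneg[OF assms(1)] A by simp
  then have p: "0 < zbar p" using assms(2) by linarith
  then have yp: "0 < ybar p" using A by (simp add: zero_less_divide_iff)
  show ?thesis
  proof (cases "0 < ybar q")
    case True
    then have "ln (zbar q) < ln (zbar p)" using assms(2) p A by (subst ln_less_cancel_iff) auto
    then show ?thesis using kill_antimono yp True by (simp add: kcoef_def)
  next
    case False
    then show ?thesis using yp kill_neg by (simp add: kcoef_def)
  qed
qed

lemma kcoef_antimono:
  assumes "market p" "market q" "zbar q \<le> zbar p"
  shows "kcoef p \<le> kcoef q"
proof (cases "zbar q = zbar p")
  case True
  have A: "0 < Apre p" "0 < Apre q" by (rule A_pos)+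
  have "0 < ybar q \<longleftrightarrow> 0 < zbar q" "0 < ybar p \<longleftrightarrow> 0 < zbar p" using A by (auto simp: zero_less_divide_iff)
  then show ?thesis using True by (simp add: kcoef_def)
qed (use kcoef_strict_antimono[OF assms(2), of p] assms(3) in auto)

text \<open>The factor \<open>a\<close> and the inner derivative \<open>1 / y\<close> combine to
  \<open>exp (- x)\<close>, which turns \<open>G1\<close> into \<open>H\<close>.\<close>

lemma scaled_deriv:
  assumes a: "0 < a" and y: "0 < y"
  shows "((\<lambda>y. a / g * (G (ln (y / a)) - k * exp (m_neg * ln (y / a))) + c * y)
     has_real_derivative D k (ln (y / a)) / g + c) (at y)"
proof -
  define x where "x = ln (y / a)"
  have ex: "exp x = y / a" using a y by (simp add: x_def)
  have ln': "((\<lambda>y. ln (y / a)) has_real_derivative 1 / y) (at y)"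
    using a y by (auto intro!: derivative_eq_intros)
  have "((\<lambda>y. a / g * (G (ln (y / a)) - k * exp (m_neg * ln (y / a))) + c * y)
     has_real_derivative a / g * (H x * exp x * (1 / y) - k * (exp (m_neg * x) * (m_neg * (1 / y)))) + c * 1) (at y)"
    unfolding x_def
    by (intro DERIV_add DERIV_cmult DERIV_diff DERIV_chain2[OF G_deriv] DERIV_fun_exp ln' DERIV_ident)
  also have "a / g * (H x * exp x * (1 / y) - k * (exp (m_neg * x) * (m_neg * (1 / y)))) + c * 1 = D k x / g + c"
    unfolding exp_minus_1[of m_neg x, symmetric] ex D_def using a y by (cases "g = 0") (simp_all add: field_simps)
  finally show ?thesis unfolding x_def .
qed

lemma scaled_deriv2:
  assumes a: "0 < a" and y: "0 < y"
  shows "((\<lambda>y. D k (ln (y / a)) / g + c) has_real_derivative D2 k (ln (y / a)) / (g * y)) (at y)"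
proof -
  have ln': "((\<lambda>y. ln (y / a)) has_real_derivative 1 / y) (at y)"
    using a y by (auto intro!: derivative_eq_intros)
  have "((\<lambda>y. D k (ln (y / a)) / g + c) has_real_derivative D2 k (ln (y / a)) * (1 / y) / g + 0) (at y)"
    by (intro DERIV_add DERIV_const DERIV_cdivide DERIV_chain2[OF D_deriv] ln')
  then show ?thesis by (simp add: mult.commute)
qed

end

section \<open>Dual functions and optimal policies\<close>

context dual_model
begin

lemma deriv_scaled:
  assumes a: "0 < a" and b: "0 \<le> b" "b < y"
    and V: "\<And>y. b < y \<Longrightarrow> V y = a / g * (G (ln (y / a)) - k * exp (m_neg * ln (y / a))) + c * y"
  shows "deriv V y = D k (ln (y / a)) / g + c" "deriv (deriv V) y = D2 k (ln (y / a)) / (g * y)"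
proof -
  have d1: "deriv V y = D k (ln (y / a)) / g + c" if y: "b < y" for y
  proof (rule DERIV_imp_deriv, rule has_field_derivative_transform_within_open)
    show "((\<lambda>y. a / g * (G (ln (y / a)) - k * exp (m_neg * ln (y / a))) + c * y)
       has_real_derivative D k (ln (y / a)) / g + c) (at y)"
      by (rule scaled_deriv[OF a]) (use b(1) y in simp)
    show "open {b<..}" "y \<in> {b<..}" using y by auto
  qed (simp add: V)
  then show "deriv V y = D k (ln (y / a)) / g + c" using b by simp
  show "deriv (deriv V) y = D2 k (ln (y / a)) / (g * y)"
  proof (rule DERIV_imp_deriv, rule has_field_derivative_transform_within_open)
    show "((\<lambda>y. D k (ln (y / a)) / g + c) has_real_derivative D2 k (ln (y / a)) / (g * y)) (at y)"
      by (rule scaled_deriv2[OF a]) (use b in simp)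
    show "open {b<..}" "y \<in> {b<..}" using b by auto
  qed (simp add: d1)
qed

end

context dual_bm
begin

lemma dual_proc_X:
  assumes "market p" "0 < y" "0 < a" "0 \<le> s"
  shows "dual_proc B p y s \<omega> = a * exp (X (ln (y / a)) s \<omega>)"
proof -
  have "exp (X (ln (y / a)) s \<omega>) = exp (ln (y / a)) * exp (\<nu> * s - \<theta> * B s \<omega>)"
    using assms(4) by (simp add: X_def mult_exp_exp add_diff_eq)
  also have "exp (ln (y / a)) = y / a" using assms by simp
  finally show ?thesis
    using assms \<nu>_eq by (simp add: dual_proc_def market_def)
qed

lemma conj_util_dual_proc:
  assumes "market p" "0 < y" "0 \<le> s"
  shows "conj_util p l (dual_proc B p y s \<omega>) = A p l / gam p * unit_util (exp (X (ln (y / A p l)) s \<omega>))"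
proof -
  have g: "0 < gam p" using assms(1) gam_pos by (simp add: market_def)
  have d: "dual_proc B p y s \<omega> = A p l * exp (X (ln (y / A p l)) s \<omega>)"
    by (rule dual_proc_X[OF assms(1,2) A_pos assms(3)])
  have "0 < dual_proc B p y s \<omega>" unfolding d by (simp add: A_pos)
  from conj_util_eq[OF g this, of l] show ?thesis
    unfolding d using A_pos[of p l] by simp
qed

lemma discounted_conj_util:
  assumes "market p" "0 < y" "\<And>\<omega>. S \<omega> \<subseteq> {0..}"
  shows "(LINT \<omega>|M. (LINT s:S \<omega>|lborel. exp (- discount p * s) * conj_util p l (dual_proc B p y s \<omega>)))
     = A p l / gam p * (LINT \<omega>|M. (LINT s:S \<omega>|lborel. exp (- \<beta> * s) * unit_util (exp (X (ln (y / A p l)) s \<omega>))))"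
proof -
  have b: "discount p = \<beta>" using assms(1) by (simp add: market_def)
  have "(LINT s:S \<omega>|lborel. exp (- discount p * s) * conj_util p l (dual_proc B p y s \<omega>))
     = A p l / gam p * (LINT s:S \<omega>|lborel. exp (- \<beta> * s) * unit_util (exp (X (ln (y / A p l)) s \<omega>)))" for \<omega>
  proof -
    have "indicator (S \<omega>) s *\<^sub>R (exp (- discount p * s) * conj_util p l (dual_proc B p y s \<omega>))
       = A p l / gam p * (indicator (S \<omega>) s *\<^sub>R (exp (- \<beta> * s) * unit_util (exp (X (ln (y / A p l)) s \<omega>))))" for s
    proof (cases "s \<in> S \<omega>")
      case True
      then have "0 \<le> s" using assms(3) by auto
      from conj_util_dual_proc[OF assms(1,2) this] show ?thesis by (simp add: b)
    qed simp
    then show ?thesis unfolding set_lebesgue_integral_def by simp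
  qed
  then show ?thesis by simp
qed

lemma V_post_eq:
  assumes "market p" "0 < y"
  shows "V_post M B p y = Apost p / gam p * G (ln (y / Apost p))"
  unfolding V_post_def U_post_def
  using discounted_utility[of "ln (y / Apost p)"] by (subst discounted_conj_util[OF assms]) simp_all

text \<open>In the scaled logarithmic variable \<open>tau\<close> becomes \<open>hit\<close> at
  level \<open>ln (zbar p)\<close>. With boundary 0 the positive dual process never reaches it, and
  \<open>kcoef p = 0\<close> fits this case.\<close>

lemma V_pre_eq:
  assumes p: "market p" and y: "ybar p < y"
  shows "V_pre M B p y = Apre p / gam p * (G (ln (y / Apre p)) - kcoef p * exp (m_neg * ln (y / Apre p)))
     + income p / rate p * y"
proof -
  have y0: "0 < y" using ybar_nonneg[OF p] y by linarith
  let ?a = "Apre p"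
  have a: "0 < ?a" by (rule A_pos)
  have "(LINT \<omega>|M. (LINT s:{s. 0 \<le> s \<and> ereal s < tau B p y \<omega>}|lborel. exp (- \<beta> * s) * unit_util (exp (X (ln (y / ?a)) s \<omega>))))
     = G (ln (y / ?a)) - kcoef p * exp (m_neg * ln (y / ?a))"
  proof (cases "0 < ybar p")
    case True
    let ?c = "ln (zbar p)"
    have "tau B p y \<omega> = hit (ln (y / ?a)) ?c \<omega>" for \<omega>
    proof -
      have "dual_proc B p y s \<omega> \<le> ybar p \<longleftrightarrow> X (ln (y / ?a)) s \<omega> \<le> ?c" if "0 < s" for s
      proof -
        have "dual_proc B p y s \<omega> \<le> ybar p \<longleftrightarrow> exp (X (ln (y / ?a)) s \<omega>) \<le> zbar p"
          using dual_proc_X[OF p y0 a, of s \<omega>] that a by (simp add: field_simps)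
        also have "\<dots> \<longleftrightarrow> X (ln (y / ?a)) s \<omega> \<le> ?c"
          using True a by (simp add: ln_ge_iff)
        finally show ?thesis .
      qed
      then have "{s. 0 < s \<and> dual_proc B p y s \<omega> \<le> ybar p} = {s. 0 < s \<and> X (ln (y / ?a)) s \<omega> \<le> ?c}" by blast
      then show ?thesis unfolding tau_def hit_def by simp
    qed
    moreover have "?c < ln (y / ?a)"
      using True a y y0 by (subst ln_less_cancel_iff) (auto simp: divide_strict_right_mono)
    ultimately show ?thesis using discounted_utility_killed[of ?c "ln (y / ?a)"] True by (simp add: kcoef_def)
  next
    case False
    then have z: "ybar p = 0" using ybar_nonneg[OF p] by simp
    have "tau B p y \<omega> = \<infinity>" for \<omega>
    proof -
      have "0 < dual_proc B p y s \<omega>" for s using y0 by (simp add: dual_proc_def)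
      then have "{s. 0 < s \<and> dual_proc B p y s \<omega> \<le> ybar p} = {}" by (auto simp: z not_le)
      then show ?thesis unfolding tau_def by (simp only: image_empty Inf_empty top_ereal_def)
    qed
    then have "{s. 0 \<le> s \<and> ereal s < tau B p y \<omega>} = {0..}" for \<omega> by auto
    then show ?thesis using discounted_utility[of "ln (y / ?a)"] z by (simp add: kcoef_def)
  qed
  then show ?thesis
    unfolding V_pre_def U_pre_def by (subst discounted_conj_util[OF p y0]) auto
qed

lemma dual_pre_dom_pos: "y \<in> dual_pre_dom p \<Longrightarrow> 0 < y \<and> ybar p \<le> y"
  by (simp add: dual_pre_dom_def)

lemma ext_right_eq:
  assumes f: "\<And>y. b < y \<Longrightarrow> f y = h y" and h: "isCont h b" and y: "b \<le> y"
  shows "ext_right b f y = h y"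
proof (cases "y = b")
  case True
  have "(h \<longlongrightarrow> h b) (at_right b)" using h by (simp add: isCont_def filterlim_at_split)
  moreover have "\<forall>\<^sub>F y in at_right b. h y = f y"
    using eventually_at_right_less[of b] by eventually_elim (simp add: f)
  ultimately have "(f \<longlongrightarrow> h b) (at_right b)" by (rule Lim_transform_eventually)
  then have "Lim (at_right b) f = h b" by (intro tendsto_Lim) simp_all
  then show ?thesis using True by (simp add: ext_right_def)
qed (use y f in \<open>simp add: ext_right_def\<close>)

text \<open>Above the boundary the formulas hold on an open set. At a positive boundary they are
  continuous, so their value is the right limit taken by \<open>ext_right\<close>.\<close>

lemma pre_derivs:
  assumes p: "market p" and y: "y \<in> dual_pre_dom p"
  shows "dV_pre M B p y = D (kcoef p) (ln (y / Apre p)) / gam p + income p / rate p"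
    and "ddV_pre M B p y = D2 (kcoef p) (ln (y / Apre p)) / (gam p * y)"
proof -
  have a: "0 < Apre p" by (rule A_pos)
  have g: "0 < gam p" using p gam_pos by (simp add: market_def)
  note d = deriv_scaled[OF a ybar_nonneg[OF p] _ V_pre_eq[OF p]]
  have y': "0 < y" "ybar p \<le> y" using dual_pre_dom_pos[OF y] by auto
  have c1: "isCont (\<lambda>y. D (kcoef p) (ln (y / Apre p)) / gam p + income p / rate p) b" if "0 < b" for b
    by (rule DERIV_isCont[OF scaled_deriv2[OF a that]])
  have c2: "isCont (\<lambda>y. D2 (kcoef p) (ln (y / Apre p)) / (gam p * y)) b" if "0 < b" for b
  proof -
    have "isCont (\<lambda>y. D2 (kcoef p) (ln (y / Apre p))) b"
    proof (rule isCont_o2[where f = "\<lambda>y. ln (y / Apre p)"])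
      show "isCont (\<lambda>y. ln (y / Apre p)) b" using that a by (intro continuous_intros) auto
      show "isCont (D2 (kcoef p)) (ln (b / Apre p))"
        using D2_continuous by (simp add: continuous_on_eq_continuous_at)
    qed
    then show ?thesis using that g by (intro continuous_intros) auto
  qed
  show "dV_pre M B p y = D (kcoef p) (ln (y / Apre p)) / gam p + income p / rate p"
  proof (cases "0 < ybar p")
    case True
    show ?thesis unfolding dV_pre_def by (rule ext_right_eq[OF d(1) c1[OF True] y'(2)])
  next
    case False
    then have "ybar p < y" using y' by linarith
    then show ?thesis unfolding dV_pre_def by (simp add: ext_right_def d(1))
  qed
  show "ddV_pre M B p y = D2 (kcoef p) (ln (y / Apre p)) / (gam p * y)"
  proof (cases "0 < ybar p")
    case True
    show ?thesis unfolding ddV_pre_def by (rule ext_right_eq[OF d(2) c2[OF True] y'(2)])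
  next
    case False
    then have "ybar p < y" using y' by linarith
    then show ?thesis unfolding ddV_pre_def by (simp add: ext_right_def d(2))
  qed
qed

definition zpre :: "economy \<Rightarrow> real \<Rightarrow> real" where
  "zpre p w = ln (I_pre M B p w / Apre p)"

text \<open>Inside the range of the marginal, \<open>inv_into\<close> returns a genuine preimage,
  which gives the wealth equation; \<open>D2_eq\<close> then removes \<open>kcoef\<close> from the
  portfolio.\<close>

lemma pre_state:
  assumes p: "market p" and w: "w \<in> wealth_pre_dom M B p"
  shows "0 < I_pre M B p w"
    and "D (kcoef p) (zpre p w) = - gam p * (w + income p / r)"
    and "c_pre M B p w = max (- zpre p w) 0 / gam p"
    and "pi_pre M B p w = theta p / (gam p * vol p) * ((1 - m_neg) * (gam p * (w + income p / r)) + R (zpre p w))"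
    and "I_pre M B p w < Apre p \<longleftrightarrow> zpre p w < 0"
proof -
  have a: "0 < Apre p" by (rule A_pos)
  have g: "0 < gam p" using p gam_pos by (simp add: market_def)
  have r: "rate p = r" using p by (simp add: market_def)
  let ?y = "I_pre M B p w"
  have dom: "?y \<in> dual_pre_dom p"
    unfolding I_pre_def by (rule inv_into_into) (use w in \<open>simp add: wealth_pre_dom_def\<close>)
  have eq: "- dV_pre M B p ?y = w"
    unfolding I_pre_def using w by (intro f_inv_into_f[where f = "\<lambda>y. - dV_pre M B p y"]) (simp add: wealth_pre_dom_def)
  show y: "0 < ?y" using dual_pre_dom_pos[OF dom] by simp
  have "- (D (kcoef p) (zpre p w) / gam p + income p / r) = w"
    using eq pre_derivs(1)[OF p dom] by (simp add: zpre_def r)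
  then show D: "D (kcoef p) (zpre p w) = - gam p * (w + income p / r)"
    using g by (simp add: field_simps)
  have "ln (Apre p / ?y) = - zpre p w" unfolding zpre_def using a y by (simp add: ln_div)
  then show "c_pre M B p w = max (- zpre p w) 0 / gam p" by (simp add: c_pre_def)
  have "pi_pre M B p w = theta p * (?y * ddV_pre M B p ?y) / vol p" by (simp add: pi_pre_def)
  also have "?y * ddV_pre M B p ?y = D2 (kcoef p) (zpre p w) / gam p"
    using pre_derivs(2)[OF p dom] y by (simp add: zpre_def)
  also have "D2 (kcoef p) (zpre p w) = (1 - m_neg) * (gam p * (w + income p / r)) + R (zpre p w)"
    unfolding D2_eq D by simp
  finally show "pi_pre M B p w = theta p / (gam p * vol p) * ((1 - m_neg) * (gam p * (w + income p / r)) + R (zpre p w))"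
    by simp
  show "I_pre M B p w < Apre p \<longleftrightarrow> zpre p w < 0"
    unfolding zpre_def using a y by (simp add: ln_less_zero_iff)
qed

text \<open>A larger coefficient raises \<open>D\<close>, so under it the same or a lower value can
  only be attained further to the left.\<close>

lemma D_compare:
  assumes "k \<le> k'" "k \<le> 0" "D k' z' \<le> D k z"
  shows "z' \<le> z" "k < k' \<or> D k' z' < D k z \<Longrightarrow> z' < z"
proof -
  have "D k z' \<le> D k z" using D_kill_mono[OF assms(1), of z'] assms(3) by linarith
  then show "z' \<le> z" using D_strict_mono[OF assms(2), of z z'] by linarith
  assume "k < k' \<or> D k' z' < D k z"
  then have "D k z' < D k z"
    using D_kill_mono[OF assms(1), of z'] D_kill_strict_mono[of k k' z'] assms(3) by linarith
  then show "z' < z" using D_strict_mono[OF assms(2), of z z'] by (cases z z' rule: linorder_cases) auto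
qed

lemma R_mono: "x \<le> y \<Longrightarrow> y < 0 \<Longrightarrow> R x \<le> R y"
  using R_strict_mono[of x y] by (cases "x = y") auto

text \<open>The normalised state \<open>z\<close> depends on wealth and \<open>gam p\<close> alone.
  Leisure enters only through \<open>I_post M B p w = Apost p * exp z\<close>, and this factor
  cancels in both policies.\<close>

lemma post_state:
  assumes p: "market p" and z: "H z = - gam p * w"
  shows "c_post M B p w = max (- z) 0 / gam p" "pi_post M B p w = theta p * Q z / (gam p * vol p)"
proof -
  have a: "0 < Apost p" by (rule A_pos)
  have g: "0 < gam p" using p gam_pos by (simp add: market_def)
  have V: "V_post M B p y = Apost p / gam p * (G (ln (y / Apost p)) - 0 * exp (m_neg * ln (y / Apost p))) + 0 * y"
    if "0 < y" for y
    using V_post_eq[OF p that] by simp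
  have d: "deriv (V_post M B p) y = H (ln (y / Apost p)) / gam p"
      "deriv (deriv (V_post M B p)) y = Q (ln (y / Apost p)) / (gam p * y)" if "0 < y" for y
    using deriv_scaled[OF a order_refl that V] by (simp_all add: D_def D2_def)
  let ?y = "Apost p * exp z"
  have y: "0 < ?y" "ln (?y / Apost p) = z" using a by simp_all
  have inj: "inj_on (\<lambda>y. - deriv (V_post M B p) y) {0<..}"
  proof (rule inj_onI)
    fix y y' assume yy: "y \<in> {0<..}" "y' \<in> {0<..}"
      and "- deriv (V_post M B p) y = - deriv (V_post M B p) y'"
    then have "H (ln (y / Apost p)) = H (ln (y' / Apost p))" using d(1) g by simp
    then have "ln (y / Apost p) = ln (y' / Apost p)"
      using H_strict_mono by (metis less_irrefl linorder_neqE_linordered_idom)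
    then have "y / Apost p = y' / Apost p" using yy a by (subst (asm) ln_inj_iff) auto
    then show "y = y'" using a by simp
  qed
  have I: "I_post M B p w = ?y"
    unfolding I_post_def
  proof (rule inv_into_f_eq[OF inj])
    show "?y \<in> {0<..}" using y by simp
    show "- deriv (V_post M B p) ?y = w" unfolding d(1)[OF y(1)] y(2) z using g by simp
  qed
  have "ln (Apost p / ?y) = - z" using a by (simp add: ln_div ln_mult)
  then show "c_post M B p w = max (- z) 0 / gam p" unfolding c_post_def I by simp
  show "pi_post M B p w = theta p * Q z / (gam p * vol p)"
    unfolding pi_post_def I d(2)[OF y(1)] y(2) using a by simp
qed

end

theorem proposition9p1:
  fixes M :: "'w measure" and B :: "real \<Rightarrow> 'w \<Rightarrow> real" and p :: economy and x :: real
  assumes "brownian_motion M B" and "admissible p"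
  shows
    "((\<forall>Y. income p < Y \<and> admissible (p\<lparr>income := Y\<rparr>) \<longrightarrow>
          ybar (p\<lparr>income := Y\<rparr>) \<le> ybar p \<and>
          (ever_retires p \<longrightarrow> ybar (p\<lparr>income := Y\<rparr>) < ybar p)) \<and>
      (\<forall>L. leisure_pre p < L \<and> admissible (p\<lparr>leisure_pre := L\<rparr>) \<longrightarrow>
          ybar (p\<lparr>leisure_pre := L\<rparr>) \<le> ybar p \<and>
          (ever_retires p \<longrightarrow> ybar (p\<lparr>leisure_pre := L\<rparr>) < ybar p)) \<and>
      (\<forall>L. leisure_post p < L \<and> admissible (p\<lparr>leisure_post := L\<rparr>) \<longrightarrow>
          ybar p \<le> ybar (p\<lparr>leisure_post := L\<rparr>) \<and>
          (ever_retires (p\<lparr>leisure_post := L\<rparr>) \<longrightarrow> ybar p < ybar (p\<lparr>leisure_post := L\<rparr>))))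
     \<and>
     (\<forall>Y Lpre Lpost.
        0 < x \<and> admissible (p\<lparr>income := Y, leisure_pre := Lpre, leisure_post := Lpost\<rparr>) \<longrightarrow>
          c_post M B (p\<lparr>income := Y, leisure_pre := Lpre, leisure_post := Lpost\<rparr>) x = c_post M B p x \<and>
          pi_post M B (p\<lparr>income := Y, leisure_pre := Lpre, leisure_post := Lpost\<rparr>) x = pi_post M B p x)
     \<and>
     (x \<in> wealth_pre_dom M B p \<and> A p (leisure_pre p) \<le> I_pre M B p x \<longrightarrow>
        c_pre M B p x = 0 \<and>
        pi_pre M B p x = theta p * (1 - m_minus p) / vol p * (x + income p / rate p))
     \<and>
     (consuming M B x p \<longrightarrow>
        (\<forall>Y. income p < Y \<and> consuming M B x (p\<lparr>income := Y\<rparr>) \<longrightarrow>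
            c_pre M B p x < c_pre M B (p\<lparr>income := Y\<rparr>) x) \<and>
        (\<forall>L. leisure_pre p < L \<and> consuming M B x (p\<lparr>leisure_pre := L\<rparr>) \<longrightarrow>
            c_pre M B p x \<le> c_pre M B (p\<lparr>leisure_pre := L\<rparr>) x \<and>
            pi_pre M B (p\<lparr>leisure_pre := L\<rparr>) x \<le> pi_pre M B p x \<and>
            (ever_retires p \<longrightarrow>
               c_pre M B p x < c_pre M B (p\<lparr>leisure_pre := L\<rparr>) x \<and>
               pi_pre M B (p\<lparr>leisure_pre := L\<rparr>) x < pi_pre M B p x)) \<and>
        (\<forall>L. leisure_post p < L \<and> consuming M B x (p\<lparr>leisure_post := L\<rparr>) \<longrightarrow>
            c_pre M B (p\<lparr>leisure_post := L\<rparr>) x \<le> c_pre M B p x \<and>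
            pi_pre M B p x \<le> pi_pre M B (p\<lparr>leisure_post := L\<rparr>) x))"
proof -
  have bm: "brownian_motion M B" and adm: "admissible p" by fact+
  define \<nu> where "\<nu> = discount p - rate p - (theta p)\<^sup>2 / 2"
  have th: "0 < theta p" using adm by (simp add: theta_def admissible_def)
  interpret dual_bm "discount p" \<nu> "theta p" M B "rate p"
    by unfold_locales (use adm bm th in \<open>auto simp: admissible_def \<nu>_def\<close>)
  have p: "market p" using adm by (simp add: market_def)
  have th_eq: "theta (p\<lparr>income := Y\<rparr>) = theta p" "theta (p\<lparr>leisure_pre := Y\<rparr>) = theta p"
    "theta (p\<lparr>leisure_post := Y\<rparr>) = theta p" for p and Y
    by (simp_all add: theta_def)
  have A_eq: "A (p\<lparr>income := Y\<rparr>) l = A p l" "A (p\<lparr>leisure_pre := Y\<rparr>) l = A p l"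
    "A (p\<lparr>leisure_post := Y\<rparr>) l = A p l" for p and Y l
    by (simp_all add: A_def)
  have g: "0 < gam p" and r: "0 < rate p" and v: "0 < vol p"
    using adm gam_pos by (auto simp: admissible_def)
  have A_less: "A p l' < A p l" if "l < l'" for l l'
    using that adm by (simp add: A_def admissible_def)
  note A0 = A_pos[of p]

  have Y_case: "zbar (p\<lparr>income := Y\<rparr>) \<le> zbar p" "ever_retires p \<Longrightarrow> zbar (p\<lparr>income := Y\<rparr>) < zbar p"
      "market (p\<lparr>income := Y\<rparr>)" "Apre (p\<lparr>income := Y\<rparr>) = Apre p" "gam (p\<lparr>income := Y\<rparr>) = gam p"
    if "income p < Y" "admissible (p\<lparr>income := Y\<rparr>)" for Y
  proof -
    let ?q = "p\<lparr>income := Y\<rparr>"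
    show q: "market ?q" using that by (simp add: market_def th_eq)
    show a: "Apre ?q = Apre p" and b: "gam ?q = gam p" by (simp_all add: A_def gam_def)
    show "zbar ?q \<le> zbar p" "ever_retires p \<Longrightarrow> zbar ?q < zbar p"
      by (rule zbar_mono[OF p q]; use that g in \<open>simp add: A_eq b\<close>)+
  qed
  have pre_case: "zbar (p\<lparr>leisure_pre := L\<rparr>) \<le> zbar p" "ever_retires p \<Longrightarrow> zbar (p\<lparr>leisure_pre := L\<rparr>) < zbar p"
      "market (p\<lparr>leisure_pre := L\<rparr>)" "Apre (p\<lparr>leisure_pre := L\<rparr>) < Apre p" "gam (p\<lparr>leisure_pre := L\<rparr>) = gam p"
    if "leisure_pre p < L" "admissible (p\<lparr>leisure_pre := L\<rparr>)" for L
  proof -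
    let ?q = "p\<lparr>leisure_pre := L\<rparr>"
    show q: "market ?q" using that by (simp add: market_def th_eq)
    show a: "Apre ?q < Apre p" using A_less[OF that(1)] by (simp add: A_def)
    show b: "gam ?q = gam p" by (simp add: gam_def)
    have c: "Apost ?q = Apost p" by (simp add: A_def)
    have "Apost p / Apre p < Apost ?q / Apre ?q"
      unfolding c by (rule divide_strict_left_mono[OF a]) (simp_all add: A_pos)
    then show "zbar ?q \<le> zbar p" "ever_retires p \<Longrightarrow> zbar ?q < zbar p"
      by (intro zbar_mono[OF p q]; simp add: b)+
  qed
  have post_case: "zbar p \<le> zbar (p\<lparr>leisure_post := L\<rparr>)"
      "ever_retires (p\<lparr>leisure_post := L\<rparr>) \<Longrightarrow> zbar p < zbar (p\<lparr>leisure_post := L\<rparr>)"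
      "market (p\<lparr>leisure_post := L\<rparr>)" "Apre (p\<lparr>leisure_post := L\<rparr>) = Apre p" "gam (p\<lparr>leisure_post := L\<rparr>) = gam p"
    if "leisure_post p < L" "admissible (p\<lparr>leisure_post := L\<rparr>)" for L
  proof -
    let ?q = "p\<lparr>leisure_post := L\<rparr>"
    show q: "market ?q" using that by (simp add: market_def th_eq)
    show a: "Apre ?q = Apre p" and b: "gam ?q = gam p" by (simp_all add: gam_def A_def)
    have c: "Apost ?q < Apost p" using A_less[OF that(1)] by (simp add: A_def)
    \<comment> \<open>More leisure after retirement lowers the ratio, so \<open>p\<close> and
      \<open>?q\<close> exchange their roles in \<open>zbar_mono\<close>.\<close>
    have "Apost ?q / Apre ?q < Apost p / Apre p"
      unfolding a by (rule divide_strict_right_mono[OF c A_pos])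
    then show "zbar p \<le> zbar ?q" "ever_retires ?q \<Longrightarrow> zbar p < zbar ?q"
      by (intro zbar_mono[OF q p]; simp add: b)+
  qed

  have cons: "admissible q" "x \<in> wealth_pre_dom M B q" "I_pre M B q x < Apre q" if "consuming M B x q" for q
    using that by (simp_all add: consuming_def)
  have c_eq: "c_pre M B q x = - zpre q x / gam q" "zpre q x < 0" if q: "market q" and "consuming M B x q" for q
  proof -
    note s = pre_state[OF q cons(2)[OF that(2)]]
    show "zpre q x < 0" using s(5) cons(3)[OF that(2)] by simp
    then show "c_pre M B q x = - zpre q x / gam q" unfolding s(3) by simp
  qed
  have D_eq: "D (kcoef q) (zpre q x) = - gam q * (x + income q / rate p)" if q: "market q" and "consuming M B x q" for q
    by (rule pre_state(2)[OF q cons(2)[OF that(2)]])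
  \<comment> \<open>With equal incomes the wealth terms of the two portfolios agree, which reduces
    the comparison to \<open>R\<close> at two negative arguments.\<close>
  have pi_le: "pi_pre M B q x \<le> pi_pre M B q' x" "zpre q x < zpre q' x \<Longrightarrow> pi_pre M B q x < pi_pre M B q' x"
    if q: "market q" "consuming M B x q" and q': "market q'" "consuming M B x q'"
      and eq: "gam q = gam q'" "income q = income q'" "vol q = vol q'" and le: "zpre q x \<le> zpre q' x" for q q'
  proof -
    have t: "theta q = theta p" "theta q' = theta p" using q q' by (simp_all add: market_def)
    have pos: "0 < theta q / (gam q * vol q)"
      using th q(1) gam_pos[of q] unfolding t market_def admissible_def by simp
    have "R (zpre q x) \<le> R (zpre q' x)" by (rule R_mono[OF le c_eq(2)[OF q']])
    then show "pi_pre M B q x \<le> pi_pre M B q' x"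
      unfolding pre_state(4)[OF q(1) cons(2)[OF q(2)]] pre_state(4)[OF q'(1) cons(2)[OF q'(2)]]
      using pos unfolding t eq by (intro mult_left_mono) auto
    assume "zpre q x < zpre q' x"
    then have "R (zpre q x) < R (zpre q' x)" by (rule R_strict_mono[OF _ c_eq(2)[OF q']])
    then show "pi_pre M B q x < pi_pre M B q' x"
      unfolding pre_state(4)[OF q(1) cons(2)[OF q(2)]] pre_state(4)[OF q'(1) cons(2)[OF q'(2)]]
      using pos unfolding t eq by (intro mult_strict_left_mono) auto
  qed

  show ?thesis
  proof (intro conjI allI impI; (elim conjE)?)
    fix Y assume Y: "income p < Y" "admissible (p\<lparr>income := Y\<rparr>)"
    note c = Y_case[OF Y]
    show "ybar (p\<lparr>income := Y\<rparr>) \<le> ybar p"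
      using c(1,4) A0[of "leisure_pre p"] by (simp add: divide_le_cancel)
    assume "ever_retires p"
    then show "ybar (p\<lparr>income := Y\<rparr>) < ybar p"
      using c(2,4) A0[of "leisure_pre p"] by (simp add: divide_less_cancel)
  next
    fix L assume L: "leisure_pre p < L" "admissible (p\<lparr>leisure_pre := L\<rparr>)"
    let ?q = "p\<lparr>leisure_pre := L\<rparr>"
    note c = pre_case[OF L]
    \<comment> \<open>The unscaled boundary is a product in which both factors fall;
      \<open>zq \<ge> 0\<close> lets the two inequalities be chained.\<close>
    define zp zq where "zp = zbar p" and "zq = zbar ?q"
    have y: "ybar p = Apre p * zp" "ybar ?q = Apre ?q * zq"
      using A0[of "leisure_pre p"] A_pos[of ?q "leisure_pre ?q"] by (simp_all add: zp_def zq_def)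
    have q0: "0 \<le> zq" using ybar_nonneg[OF c(3)] A_pos[of ?q "leisure_pre ?q"] by (simp add: zq_def)
    have 1: "Apre ?q * zq \<le> Apre p * zq" by (rule mult_right_mono[OF less_imp_le[OF c(4)] q0])
    have "Apre p * zq \<le> Apre p * zp"
      unfolding zp_def zq_def by (rule mult_left_mono[OF c(1) less_imp_le[OF A0]])
    with 1 show "ybar ?q \<le> ybar p" unfolding y by linarith
    assume e: "ever_retires p"
    have "Apre p * zq < Apre p * zp"
      unfolding zp_def zq_def by (rule mult_strict_left_mono[OF c(2)[OF e] A0])
    with 1 show "ybar ?q < ybar p" unfolding y by linarith
  next
    fix L assume L: "leisure_post p < L" "admissible (p\<lparr>leisure_post := L\<rparr>)"
    note c = post_case[OF L]
    show "ybar p \<le> ybar (p\<lparr>leisure_post := L\<rparr>)"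
      using c(1,4) A0[of "leisure_pre p"] by (simp add: divide_le_cancel)
    assume "ever_retires (p\<lparr>leisure_post := L\<rparr>)"
    then show "ybar p < ybar (p\<lparr>leisure_post := L\<rparr>)"
      using c(2,4) A0[of "leisure_pre p"] by (simp add: divide_less_cancel)
  next
    fix Y Lpre Lpost
    let ?q = "p\<lparr>income := Y, leisure_pre := Lpre, leisure_post := Lpost\<rparr>"
    assume x: "0 < x" and "admissible ?q"
    then have q: "market ?q" by (simp add: market_def th_eq)
    have gq: "gam ?q = gam p" by (simp add: gam_def)
    \<comment> \<open>Positive wealth lies in the range covered by \<open>H_surj\<close>, and the
      equation for \<open>z\<close> contains neither income nor leisure.\<close>
    obtain z where z: "H z = - gam p * x" using H_surj[of "- gam p * x"] mult_pos_pos[OF g x] by auto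
    then have zq: "H z = - gam ?q * x" unfolding gq .
    have tv: "theta ?q = theta p" "vol ?q = vol p" by (simp_all add: th_eq)
    show "c_post M B ?q x = c_post M B p x" "pi_post M B ?q x = pi_post M B p x"
      unfolding post_state[OF p z] post_state[OF q zq] gq tv by (rule refl)+
  next
    assume w: "x \<in> wealth_pre_dom M B p" and le: "A p (leisure_pre p) \<le> I_pre M B p x"
    note s = pre_state[OF p w]
    have z: "0 \<le> zpre p x" using s(5) le by simp
    show "c_pre M B p x = 0" unfolding s(3) using z by simp
    show "pi_pre M B p x = theta p * (1 - m_minus p) / vol p * (x + income p / rate p)"
      unfolding s(4) m_plus_minus_eq(2)[OF p] R_0[OF z] using g v by simp
  next
    fix Y assume cp: "consuming M B x p" and Y: "income p < Y" and cq: "consuming M B x (p\<lparr>income := Y\<rparr>)"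
    let ?q = "p\<lparr>income := Y\<rparr>"
    note c = Y_case[OF Y cons(1)[OF cq]]
    \<comment> \<open>Income acts twice in the same direction: it lowers the right-hand side of the
      wealth equation strictly and it does not lower \<open>kcoef\<close>. So strictness holds even
      without retirement. In the portfolio the income term rises while \<open>R\<close> falls, so
      the same comparison does not sign it.\<close>
    have "gam p * (x + income p / rate p) < gam p * (x + Y / rate p)"
      using Y g r by (simp add: divide_strict_right_mono)
    then have "D (kcoef ?q) (zpre ?q x) < D (kcoef p) (zpre p x)"
      unfolding D_eq[OF c(3) cq] D_eq[OF p cp] c(5) by simp
    then have "zpre ?q x < zpre p x"
      using D_compare(2)[OF kcoef_antimono[OF p c(3) c(1)] kcoef_nonpos] by simp
    then show "c_pre M B p x < c_pre M B ?q x"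
      unfolding c_eq(1)[OF c(3) cq] c_eq(1)[OF p cp] c(5) using g by (simp add: divide_strict_right_mono)
  next
    fix L assume cp: "consuming M B x p" and L: "leisure_pre p < L" and cq: "consuming M B x (p\<lparr>leisure_pre := L\<rparr>)"
    let ?q = "p\<lparr>leisure_pre := L\<rparr>"
    note c = pre_case[OF L cons(1)[OF cq]]
    \<comment> \<open>Leisure enters the wealth equation only through \<open>kcoef\<close>.\<close>
    have "D (kcoef ?q) (zpre ?q x) = D (kcoef p) (zpre p x)"
      unfolding D_eq[OF c(3) cq] D_eq[OF p cp] c(5) by simp
    then have D_le: "D (kcoef ?q) (zpre ?q x) \<le> D (kcoef p) (zpre p x)" by simp
    note cmp = D_compare[OF kcoef_antimono[OF p c(3) c(1)] kcoef_nonpos D_le]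
    show "c_pre M B p x \<le> c_pre M B ?q x"
      unfolding c_eq(1)[OF c(3) cq] c_eq(1)[OF p cp] c(5) using g cmp(1) by (simp add: divide_right_mono)
    show "pi_pre M B ?q x \<le> pi_pre M B p x"
      by (rule pi_le(1)[OF c(3) cq p cp c(5) _ _ cmp(1)]) simp_all
    \<comment> \<open>If \<open>p\<close> never retires, both coefficients are 0 and the policies
      coincide, so strictness has to come from the boundary.\<close>
    assume e: "ever_retires p"
    have less: "zpre ?q x < zpre p x"
      using cmp(2) kcoef_strict_antimono[OF c(3) c(2)[OF e]] by blast
    show "c_pre M B p x < c_pre M B ?q x"
      unfolding c_eq(1)[OF c(3) cq] c_eq(1)[OF p cp] c(5) using g less by (simp add: divide_strict_right_mono)
    show "pi_pre M B ?q x < pi_pre M B p x"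
      by (rule pi_le(2)[OF c(3) cq p cp c(5) _ _ cmp(1) less]) simp_all
  next
    fix L assume cp: "consuming M B x p" and L: "leisure_post p < L" and cq: "consuming M B x (p\<lparr>leisure_post := L\<rparr>)"
    let ?q = "p\<lparr>leisure_post := L\<rparr>"
    note c = post_case[OF L cons(1)[OF cq]]
    have "D (kcoef p) (zpre p x) = D (kcoef ?q) (zpre ?q x)"
      unfolding D_eq[OF c(3) cq] D_eq[OF p cp] c(5) by simp
    then have D_le: "D (kcoef p) (zpre p x) \<le> D (kcoef ?q) (zpre ?q x)" by simp
    \<comment> \<open>Here \<open>p\<close> has the smaller boundary, hence the larger coefficient,
      and takes the primed role in \<open>D_compare\<close>.\<close>
    note cmp = D_compare(1)[OF kcoef_antimono[OF c(3) p c(1)] kcoef_nonpos D_le]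
    show "c_pre M B ?q x \<le> c_pre M B p x"
      unfolding c_eq(1)[OF c(3) cq] c_eq(1)[OF p cp] c(5) using g cmp by (simp add: divide_right_mono)
    show "pi_pre M B p x \<le> pi_pre M B ?q x"
      by (rule pi_le(1)[OF p cp c(3) cq c(5)[symmetric] _ _ cmp]) simp_all
  qed
qed

end
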